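(* Let $g\in C^2_{\mathrm{axs}}([-1,1])$ satisfy $0<g_0\le g\le g_1<1$ for some constants $g_0<g_1$, and $g'\ge\kappa$ in $[-1,1]$ for some $\kappa>0$. Let $u_0\in C^2_{\mathrm{axs}}([-1,1])$ satisfy $u_0\ge 0$, $|\{u_0>0\}|>0$ and, for some $\gamma\in[-1,1)$, $\{u_0>0\}=(\gamma,1]$ and $u_0'>0$ a.e. in $(\gamma,1)$. Let $u$ be a solution (in the sense of the context) of the axisymmetric nonlocal obstacle problem with data $u_0$ and $g$, with $u\in W^{2,1}_{q,\mathrm{axs}}((-1,1)\times(0,T))$ for every $T\in(0,\infty)$ and every $1\le q<\infty$. Define $$p(t):=\inf\{x\in[-1,1] : u(x,t)>0\},\qquad t\ge 0 .$$ Then $p:[0,\infty)\to[-1,1]$ is continuous.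
   Context: Notation. For $u:[-1,1]\to\mathbb R$ let $u_{\mathrm{axs}}:\mathcal S^2\to\mathbb R$, $u_{\mathrm{axs}}(x_1,x_2,x_3)=u(x_1)$, where $\mathcal S^2\subset\mathbb R^3$ is the unit sphere. $C^2_{\mathrm{axs}}([-1,1])$ is the set of $u$ with $u_{\mathrm{axs}}\in C^2(\mathcal S^2)$; $W^{2,1}_{q,\mathrm{axs}}((-1,1)\times(0,T))$ is the set of $u=u(x,t)$ such that $(X,t)\mapsto u(X_1,t)$ belongs to the parabolic Sobolev space $W^{2,1}_q(\mathcal S^2\times(0,T))$ (two weak space derivatives and one weak time derivative in $L^q$). A prime denotes the derivative in $x$; $u$ is identified with its continuous representative on $[-1,1]\times[0,\infty)$. $H$ is the Heaviside function with $H(r)=1$ for $r>0$ and $H(r)=0$ for $r\le 0$; $\fint$ denotes the average. Axisymmetric nonlocal obstacle problem with data $u_0,g$: a function $u$ is a solution if, for every $T>0$, - $\partial_t u-\big((1-x^2)u'\big)'=-\big(1-\frac{g}{\lambda(t)}\big)H(u)$ a.e. in $(-1,1)\times(0,T)$, - $\lambda(t)=\fint_{\{u(\cdot,t)>0\}}g(r)\,dr$ for a.a. $t\in(0,T)$, - $g\le\lambda(t)$ a.e. in $\{u(\cdot,t)=0\}$, for a.a. $t\in(0,T)$, - $u\ge 0$ in $(-1,1)\times(0,T)$, and $u(\cdot,0)=u_0$ in $(-1,1)$. *)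

theory Defs
  imports "HOL-Analysis.Analysis"
begin

text \<open>\<open>k\<close>-times continuously differentiable functions. The definition is meant for open sets \<open>S\<close>;
  the derivatives are two-sided.\<close>

primrec Ck_on :: "nat \<Rightarrow> ('a::euclidean_space \<Rightarrow> real) \<Rightarrow> 'a set \<Rightarrow> bool" where
  "Ck_on 0 f S \<longleftrightarrow> continuous_on S f"
| "Ck_on (Suc k) f S \<longleftrightarrow>
     (\<forall>x\<in>S. f differentiable (at x)) \<and>
     (\<forall>b\<in>Basis. Ck_on k (\<lambda>x. frechet_derivative f (at x) b) S)"

definition test_functions :: "'a::euclidean_space set \<Rightarrow> ('a \<Rightarrow> real) set" where
  "test_functions \<Omega> =
     {\<phi>. (\<forall>k. Ck_on k \<phi> UNIV) \<and>
          compact (closure {x. \<phi> x \<noteq> 0}) \<and> closure {x. \<phi> x \<noteq> 0} \<subseteq> \<Omega>}"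

definition locally_integrable_on :: "('a::euclidean_space \<Rightarrow> real) \<Rightarrow> 'a set \<Rightarrow> bool" where
  "locally_integrable_on f \<Omega> \<longleftrightarrow>
     (\<forall>K. compact K \<and> K \<subseteq> \<Omega> \<longrightarrow> f absolutely_integrable_on K)"

text \<open>\<open>h\<close> is the weak derivative of \<open>f\<close> in direction \<open>b\<close> on the open set \<open>\<Omega>\<close>.\<close>

definition has_weak_derivative_on ::
    "('a::euclidean_space \<Rightarrow> real) \<Rightarrow> 'a \<Rightarrow> ('a \<Rightarrow> real) \<Rightarrow> 'a set \<Rightarrow> bool" where
  "has_weak_derivative_on f b h \<Omega> \<longleftrightarrow>
     locally_integrable_on f \<Omega> \<and> locally_integrable_on h \<Omega> \<and>
     (\<forall>\<phi>\<in>test_functions \<Omega>.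
        (LINT x|lebesgue_on \<Omega>. f x * frechet_derivative \<phi> (at x) b)
          = - (LINT x|lebesgue_on \<Omega>. h x * \<phi> x))"

definition Lq_on :: "real \<Rightarrow> ('a::euclidean_space \<Rightarrow> real) \<Rightarrow> 'a set \<Rightarrow> bool" where
  "Lq_on q f \<Omega> \<longleftrightarrow>
     f \<in> borel_measurable (lebesgue_on \<Omega>) \<and>
     integrable (lebesgue_on \<Omega>) (\<lambda>x. \<bar>f x\<bar> powr q)"

definition W21q_on :: "real \<Rightarrow> ('a::euclidean_space \<times> real \<Rightarrow> real) \<Rightarrow> 'a set \<Rightarrow> real \<Rightarrow> bool" where
  "W21q_on q F \<Omega> T \<longleftrightarrow>
     (let Q = \<Omega> \<times> {0<..<T} in
      Lq_on q F Q \<and>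
      (\<exists>Ft. Lq_on q Ft Q \<and> has_weak_derivative_on F (0, 1) Ft Q) \<and>
      (\<forall>i\<in>Basis. \<exists>Fi. Lq_on q Fi Q \<and> has_weak_derivative_on F (i, 0) Fi Q \<and>
         (\<forall>j\<in>Basis. \<exists>Fij. Lq_on q Fij Q \<and> has_weak_derivative_on Fi (j, 0) Fij Q)))"

text \<open>For \<open>s = 1\<close> and \<open>s = -1\<close> these are the inverses of the stereographic projections of the unit
  sphere from the poles \<open>(1,0,0)\<close> and \<open>(-1,0,0)\<close>. Together they form an atlas, through which
  function spaces on the sphere are defined.\<close>

definition inv_stereo :: "real \<Rightarrow> real^2 \<Rightarrow> real^3" where
  "inv_stereo s y =
     (1 / ((norm y)\<^sup>2 + 1)) *\<^sub>R vector [s * ((norm y)\<^sup>2 - 1), 2 * y $ 1, 2 * y $ 2]"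

definition C2_sphere :: "(real^3 \<Rightarrow> real) \<Rightarrow> bool" where
  "C2_sphere U \<longleftrightarrow> (\<forall>s\<in>{1, -1}. Ck_on 2 (\<lambda>y. U (inv_stereo s y)) UNIV)"

text \<open>The charts are restricted to discs of radius \<open>2\<close>: the images of these discs still cover the
  sphere (radius greater than \<open>1\<close> suffices), and on them the charts have bounded derivatives and
  their Jacobians are bounded above and away from \<open>0\<close>, so that \<open>L\<^sup>q\<close> with respect to
  Lebesgue measure in the chart is \<open>L\<^sup>q\<close> with respect to surface measure.\<close>

definition W21q_sphere :: "real \<Rightarrow> ((real^3) \<times> real \<Rightarrow> real) \<Rightarrow> real \<Rightarrow> bool" where
  "W21q_sphere q U T \<longleftrightarrow>
     (\<forall>s\<in>{1, -1}. W21q_on q (\<lambda>(y, t). U (inv_stereo s y, t)) (ball 0 2) T)"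

definition C2_axs :: "(real \<Rightarrow> real) \<Rightarrow> bool" where
  "C2_axs u \<longleftrightarrow> C2_sphere (\<lambda>X. u (X $ 1))"

definition W21q_axs :: "real \<Rightarrow> (real \<Rightarrow> real \<Rightarrow> real) \<Rightarrow> real \<Rightarrow> bool" where
  "W21q_axs q u T \<longleftrightarrow> W21q_sphere q (\<lambda>(X, t). u (X $ 1) t) T"

definition heaviside :: "real \<Rightarrow> real" where
  "heaviside r = (if r > 0 then 1 else 0)"

definition average :: "'a::euclidean_space set \<Rightarrow> ('a \<Rightarrow> real) \<Rightarrow> real" where
  "average A f = (LINT x|lebesgue_on A. f x) / measure lebesgue A"

text \<open>The derivatives in the equation are weak derivatives on \<open>(-1,1) \<times> (0,T)\<close>: \<open>ut\<close> is
  \<open>\<partial>\<^sub>t u\<close>, \<open>ux\<close> is \<open>u'\<close> and \<open>w\<close> is \<open>((1 - x\<^sup>2) u')'\<close>.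
  If \<open>{u(\<cdot>,t) > 0}\<close> is a null set, its average is \<open>0\<close> here; for positive \<open>g\<close> the third
  condition then fails, so that this happens only for a null set of times.\<close>

definition axs_obstacle_solution ::
    "(real \<Rightarrow> real) \<Rightarrow> (real \<Rightarrow> real) \<Rightarrow> (real \<Rightarrow> real \<Rightarrow> real) \<Rightarrow> bool" where
  "axs_obstacle_solution u0 g u \<longleftrightarrow>
     (\<exists>lam :: real \<Rightarrow> real. \<forall>T>0.
        (\<exists>ut ux w.
           has_weak_derivative_on (\<lambda>(x, t). u x t) (0, 1) ut ({-1<..<1} \<times> {0<..<T}) \<and>
           has_weak_derivative_on (\<lambda>(x, t). u x t) (1, 0) ux ({-1<..<1} \<times> {0<..<T}) \<and>
           has_weak_derivative_on (\<lambda>(x, t). (1 - x\<^sup>2) * ux (x, t)) (1, 0) w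
             ({-1<..<1} \<times> {0<..<T}) \<and>
           (AE (x, t) in lebesgue_on ({-1<..<1} \<times> {0<..<T}).
              ut (x, t) - w (x, t) = - (1 - g x / lam t) * heaviside (u x t))) \<and>
        (AE t in lebesgue_on {0<..<T}. lam t = average {x\<in>{-1<..<1}. u x t > 0} g) \<and>
        (AE t in lebesgue_on {0<..<T}. AE x in lebesgue_on {-1<..<1}.
           u x t = 0 \<longrightarrow> g x \<le> lam t) \<and>
        (\<forall>x\<in>{-1<..<1}. \<forall>t\<in>{0<..<T}. u x t \<ge> 0) \<and>
        (\<forall>x\<in>{-1<..<1}. u x 0 = u0 x))"

definition free_boundary :: "(real \<Rightarrow> real \<Rightarrow> real) \<Rightarrow> real \<Rightarrow> real" where
  "free_boundary u t = Inf {x\<in>{-1..1}. u x t > 0}"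

end

theory Submission
  imports Defs
begin

text \<open>The time integral \<open>V(x) = \<integral> u(x,s) ds\<close> over \<open>(t\<^sub>1,t\<^sub>2)\<close> satisfies \<open>((1 - x\<^sup>2) V')' = R\<close> with \<open>R\<close> bounded, and the flux
  \<open>(1 - x\<^sup>2) V'\<close> vanishes at \<open>\<plusminus>1\<close> because \<open>V\<close> has no logarithmic singularity there. Hence \<open>V\<close> is
  \<open>C\<^sup>1\<close>, mass is conserved, and \<open>V\<close> has no maximum on \<open>[-1,1]\<close> near which \<open>R\<close> is positive, even at
  an endpoint. Doubling variables, this gives monotonicity of \<open>u\<close> in \<open>x\<close>, so \<open>{u > 0}\<close> lies to the
  right of \<open>p\<close>, and upper semicontinuity of \<open>p\<close> is continuity of \<open>u\<close>.

  For lower semicontinuity, suppose that \<open>p\<close> jumps from \<open>p(t)\<close> down to \<open>p\<^sub>*\<close> along times tending to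
  \<open>t\<close>, with \<open>p\<^sub>*\<close> minimal. Since \<open>g' \<ge> \<kappa>\<close>, the average \<open>\<lambda>\<close> exceeds \<open>g\<close> by a positive constant up to
  some point slightly to the right of \<open>p\<^sub>*\<close>, so there zeros persist for a time by comparison with a
  parabola. This excludes a jump at times after \<open>t\<close>, and for times before \<open>t\<close> it leaves only the case
  that \<open>u > 0\<close> on a whole interval just before \<open>t\<close> and \<open>u = 0\<close> there at \<open>t\<close>. But then \<open>u\<close> would be
  about \<open>(t - s) (1 - g/\<lambda>)\<close>, which decreases in \<open>x\<close>, contradicting monotonicity.\<close>

subsection \<open>Smooth step functions and the lemma of du Bois-Reymond\<close>

text \<open>The equation holds only weakly and \<lambda> is merely measurable in time, so the time
  derivative of u cannot be used pointwise. Integration over a window (t - h, t) replaces it by an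
  increment of the continuous function u. What remains is an ordinary differential equation in x
  with bounded right-hand side, and the window integral is differentiable in t, so that its maxima
  in space and time can be examined pointwise.

  The nonlocal term enters through its mass balance: the integral of (1 - g/\<lambda>) over {u > 0}
  is zero, so mass is conserved. With monotonicity this keeps u(1, t) > 0, and a fixed interval next
  to 1 stays in the positivity set at nearby times. On that interval g exceeds its value near the
  left end by a definite amount, which is what separates \<lambda> from g there.

  Minimality of p_* serves the same estimate: zeros to the left of p_* persist on both sides of t,
  so at all nearby times the positivity set begins at most slightly to the left of p_*, and g varies
  little between there and a point just to the right of p_*.\<close>

lemma Ck_on_cong:
  fixes f h :: "'a::euclidean_space \<Rightarrow> real"
  assumes "open S" "\<And>x. x \<in> S \<Longrightarrow> f x = h x"
  shows "Ck_on k f S \<longleftrightarrow> Ck_on k h S"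
  using assms(2)
proof (induction k arbitrary: f h)
  case 0
  then show ?case by (simp cong: continuous_on_cong)
next
  case (Suc k)
  have D: "(f has_derivative D) (at x) \<longleftrightarrow> (h has_derivative D) (at x)" if "x \<in> S" for x D
    using has_derivative_transform_within_open[OF _ assms(1) that] Suc.prems by metis
  then have "frechet_derivative f (at x) = frechet_derivative h (at x)" if "x \<in> S" for x
    using that by (simp add: frechet_derivative_def)
  then have "Ck_on k (\<lambda>x. frechet_derivative f (at x) b) S
      \<longleftrightarrow> Ck_on k (\<lambda>x. frechet_derivative h (at x) b) S" for b
    by (intro Suc.IH) simp
  moreover have "f differentiable (at x) \<longleftrightarrow> h differentiable (at x)" if "x \<in> S" for x
    using D that by (simp add: differentiable_def)
  ultimately show ?case by simp
qed

text \<open>\<open>Ck_on\<close> is defined through the chosen \<open>frechet_derivative\<close>;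
  this rule lets any explicitly known derivative take its place.\<close>

lemma Ck_on_SucI:
  fixes f :: "'a::euclidean_space \<Rightarrow> real"
  assumes "open S" "\<And>x. x \<in> S \<Longrightarrow> (f has_derivative f' x) (at x)"
    "\<And>b. b \<in> Basis \<Longrightarrow> Ck_on k (\<lambda>x. f' x b) S"
  shows "Ck_on (Suc k) f S"
proof -
  have "Ck_on k (\<lambda>x. frechet_derivative f (at x) b) S" if "b \<in> Basis" for b
    using assms(3)[OF that] frechet_derivative_at[OF assms(2)]
    by (subst Ck_on_cong[OF assms(1), where h = "\<lambda>x. f' x b"]) (auto dest: fun_cong)
  then show ?thesis using assms(2) by (auto simp: differentiable_def)
qed

lemma Ck_on_SucD:
  fixes f :: "'a::euclidean_space \<Rightarrow> real"
  assumes "Ck_on (Suc k) f S"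
  shows "Ck_on k f S"
  using assms
proof (induction k arbitrary: f)
  case 0
  then show ?case
    by (auto intro!: continuous_at_imp_continuous_on differentiable_imp_continuous_within)
qed simp

lemma Ck_on_has_derivative:
  fixes f :: "'a::euclidean_space \<Rightarrow> real"
  assumes "Ck_on (Suc k) f S" "x \<in> S"
  shows "(f has_derivative frechet_derivative f (at x)) (at x)"
  using assms by (simp add: frechet_derivative_works)

lemma Ck_on_const: "Ck_on k (\<lambda>x::'a::euclidean_space. c) S"
proof (induction k arbitrary: c)
  case (Suc k)
  have "frechet_derivative (\<lambda>x::'a. c) (at x) = (\<lambda>h. 0)" for x
    by (rule frechet_derivative_at[symmetric]) simp
  then show ?case using Suc[of 0] by simp
qed simp

lemma Ck_on_add:
  fixes f h :: "'a::euclidean_space \<Rightarrow> real"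
  assumes "open S" "Ck_on k f S" "Ck_on k h S"
  shows "Ck_on k (\<lambda>x. f x + h x) S"
  using assms(2,3)
proof (induction k arbitrary: f h)
  case 0
  then show ?case by (simp add: continuous_on_add)
next
  case (Suc k)
  show ?case
    by (rule Ck_on_SucI[OF assms(1) has_derivative_add[OF Ck_on_has_derivative[OF Suc.prems(1)]
              Ck_on_has_derivative[OF Suc.prems(2)]]])
       (use Suc in auto)
qed

lemma Ck_on_mult:
  fixes f h :: "'a::euclidean_space \<Rightarrow> real"
  assumes "open S" "Ck_on k f S" "Ck_on k h S"
  shows "Ck_on k (\<lambda>x. f x * h x) S"
  using assms(2,3)
proof (induction k arbitrary: f h)
  case 0
  then show ?case by (simp add: continuous_on_mult)
next
  case (Suc k)
  note D = has_derivative_mult[OF Ck_on_has_derivative[OF Suc.prems(1)]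
              Ck_on_has_derivative[OF Suc.prems(2)]]
  show ?case
    by (rule Ck_on_SucI[OF assms(1) D])
       (use Suc Ck_on_SucD[OF Suc.prems(1)] Ck_on_SucD[OF Suc.prems(2)] in
         \<open>auto intro!: Ck_on_add assms(1)\<close>)
qed

lemma Ck_on_inverse:
  fixes f :: "'a::euclidean_space \<Rightarrow> real"
  assumes "open S" "Ck_on k f S" "\<And>x. x \<in> S \<Longrightarrow> f x \<noteq> 0"
  shows "Ck_on k (\<lambda>x. inverse (f x)) S"
  using assms(2)
proof (induction k)
  case 0
  then show ?case using assms by (simp add: continuous_on_inverse)
next
  case (Suc k)
  note I = Suc.IH[OF Ck_on_SucD[OF Suc.prems]]
  have D: "((\<lambda>x. inverse (f x)) has_derivative
     (\<lambda>b. (-1) * (inverse (f x) * (frechet_derivative f (at x) b * inverse (f x))))) (at x)" if "x \<in> S" for x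
    using Deriv.has_derivative_inverse[OF assms(3)[OF that] Ck_on_has_derivative[OF Suc.prems that]]
    by (simp add: mult.assoc)
  show ?case
    by (rule Ck_on_SucI[OF assms(1) D])
       (assumption, intro Ck_on_mult[OF assms(1)] Ck_on_const I, use Suc.prems in auto)
qed

lemma Ck_on_has_real_derivative:
  fixes f :: "real \<Rightarrow> real"
  assumes "Ck_on (Suc k) f S" "x \<in> S"
  shows "(f has_real_derivative frechet_derivative f (at x) 1) (at x)"
proof -
  let ?D = "frechet_derivative f (at x)"
  note D = Ck_on_has_derivative[OF assms]
  have "?D = (*) (?D 1)"
  proof
    fix b
    show "?D b = ?D 1 * b"
      using linear_scale[OF has_derivative_linear[OF D], of b 1] by (simp add: mult.commute)
  qed
  then show ?thesis using D by (metis has_field_derivative_def)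
qed

text \<open>Serves to rescale functions on the line and, with \<open>fst\<close> and
  \<open>snd\<close> for \<open>l\<close>, to lift them to the plane.\<close>

lemma Ck_on_affine_compose:
  fixes f :: "real \<Rightarrow> real" and l :: "'a::euclidean_space \<Rightarrow> real"
  assumes "Ck_on k f UNIV" "bounded_linear l"
  shows "Ck_on k (\<lambda>x. f (l x + c)) UNIV"
  using assms(1)
proof (induction k arbitrary: f)
  case 0
  then show ?case using linear_continuous_on[OF assms(2)]
    by (auto intro!: continuous_intros continuous_on_compose2[OF 0[unfolded Ck_on.simps]])
next
  case (Suc k)
  have D: "((\<lambda>x. f (l x + c)) has_derivative
      (\<lambda>b. frechet_derivative f (at (l x + c)) 1 * l b)) (at x)" for x
  proof -
    have 1: "(f has_derivative (\<lambda>b. frechet_derivative f (at (l x + c)) 1 * b)) (at (l x + c))"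
      using Ck_on_has_real_derivative[OF Suc.prems, of "l x + c"]
      by (simp add: has_field_derivative_def)
    have 3: "((\<lambda>x. l x + c) has_derivative l) (at x)"
      using bounded_linear_imp_has_derivative[OF assms(2)] by (auto intro!: derivative_eq_intros)
    show ?thesis
      by (rule has_derivative_compose[OF 3 1])
  qed
  show ?case
    by (rule Ck_on_SucI[OF open_UNIV D])
       (use Suc in \<open>auto intro!: Ck_on_mult Ck_on_const\<close>)
qed

lemma Ck_on_realI:
  fixes f :: "real \<Rightarrow> real"
  assumes "open S" "\<And>x. x \<in> S \<Longrightarrow> (f has_real_derivative f' x) (at x)" "Ck_on k f' S"
  shows "Ck_on (Suc k) f S"
  using Ck_on_SucI[OF assms(1), of f "\<lambda>x h. f' x * h" k] assms(2,3)
  by (simp add: has_field_derivative_def)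

lemma frechet_derivative_real:
  assumes "(f has_real_derivative D) (at x)"
  shows "frechet_derivative f (at x) = (\<lambda>h. D * h)"
  using frechet_derivative_at[of f "\<lambda>h. D * h" x] assms by (simp add: has_field_derivative_def)

section \<open>A smooth step built from x^(-n) exp(-1/x)\<close>

definition flat :: "nat \<Rightarrow> real \<Rightarrow> real" where
  "flat n x = (if x > 0 then (1 / x) ^ n / exp (1 / x) else 0)"

lemma flat_tendsto: "(flat n \<longlongrightarrow> 0) (at 0)"
proof -
  have "((\<lambda>x. (1 / x) ^ n / exp (1 / x) :: real) \<longlongrightarrow> 0) (at_right 0)"
    using filterlim_compose[OF tendsto_power_div_exp_0[of n] filterlim_inverse_at_top_right]
    by (simp add: inverse_eq_divide)
  then have "(flat n \<longlongrightarrow> 0) (at_right 0)"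
    by (rule Lim_transform_eventually) (auto simp: flat_def eventually_at_right_field intro: exI[of _ 1])
  moreover have "(flat n \<longlongrightarrow> 0) (at_left 0)"
    by (rule Lim_transform_eventually[OF tendsto_const])
       (auto simp: flat_def eventually_at_left_field intro: exI[of _ "-1"])
  ultimately show ?thesis by (simp add: filterlim_split_at)
qed

text \<open>Differentiation only raises the power of 1/x, so the family over all \<open>n\<close> is
  closed under it up to linear combinations. This carries the induction in
  \<open>flat_Ck\<close>.\<close>

lemma flat_has_derivative:
  "(flat n has_real_derivative (flat (n + 2) x + (- real n) * flat (n + 1) x)) (at x)"
proof -
  consider "x < 0" | "x = 0" | "x > 0" by linarith
  then show ?thesis
  proof cases
    case 1
    have "((\<lambda>x. 0) has_real_derivative 0) (at x)" by simp
    then have "(flat n has_real_derivative 0) (at x)"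
      by (rule has_field_derivative_transform_within_open[where S = "{..<0}"])
         (use 1 in \<open>auto simp: flat_def\<close>)
    then show ?thesis using 1 by (simp add: flat_def)
  next
    case 2
    \<comment> \<open>The difference quotient at 0 is again a member of the family, so
      differentiability there is \<open>flat_tendsto\<close>.\<close>
    have "(\<lambda>h. (flat n (0 + h) - flat n 0) / h) = flat (Suc n)"
      by (auto simp: flat_def)
    then have "(flat n has_real_derivative 0) (at 0)"
      using flat_tendsto[of "Suc n"] by (simp add: DERIV_def)
    then show ?thesis using 2 by (simp add: flat_def)
  next
    case 3
    have "((\<lambda>x. (1 / x) ^ n / exp (1 / x)) has_real_derivative
        (flat (n + 2) x + (- real n) * flat (n + 1) x)) (at x)"
    proof -
      have 1: "((\<lambda>y. y ^ n / exp y) has_real_derivative (real n * y ^ (n - 1) - y ^ n) / exp y) (at y)" for y :: real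
        by (auto intro!: derivative_eq_intros simp: field_simps)
      have 2: "((\<lambda>x. 1 / x) has_real_derivative - ((1 / x) ^ 2)) (at x)"
        using 3 by (auto intro!: derivative_eq_intros simp: power2_eq_square)
      \<comment> \<open>The truncated exponent n - 1 does no harm at n = 0, where the factor
        \<open>real n\<close> vanishes.\<close>
      have n: "real n * y ^ (n - 1) * y ^ 2 = real n * y ^ (n + 1)" for y :: real
        by (cases n) (auto simp: power2_eq_square)
      have alg: "(A - B) / E * (- s) = (B * s - A * s) / E" for A B E s :: real
        by (simp add: algebra_simps diff_divide_distrib)
      have "(real n * y ^ (n - 1) - y ^ n) / exp y * (- (y ^ 2))
          = y ^ (n + 2) / exp y + (- real n) * (y ^ (n + 1) / exp y)" for y :: real
        unfolding alg n by (simp add: diff_divide_distrib power_add power2_eq_square)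
      then show ?thesis
        using DERIV_chain2[OF 1 2] 3 by (simp add: flat_def)
    qed
    then show ?thesis
      by (rule has_field_derivative_transform_within_open[where S = "{0<..}"])
         (use 3 in \<open>auto simp: flat_def\<close>)
  qed
qed

lemma flat_Ck: "Ck_on k (flat n) UNIV"
proof (induction k arbitrary: n)
  case 0
  show ?case
    using DERIV_isCont[OF flat_has_derivative] by (auto intro: continuous_at_imp_continuous_on)
next
  case (Suc k)
  show ?case
    by (rule Ck_on_realI[OF open_UNIV flat_has_derivative])
       (intro Ck_on_add Ck_on_mult Ck_on_const Suc open_UNIV)
qed

definition step :: "real \<Rightarrow> real" where
  "step x = flat 0 x * inverse (flat 0 x + flat 0 ((-1) * x + 1))"

text \<open>A bump supported in \<open>{0..1}\<close> with integral 1; its rescalings serve as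
  one-sided mollifiers.\<close>

definition dstep :: "real \<Rightarrow> real" where
  "dstep x = frechet_derivative step (at x) 1"

lemma step_denominator_pos: "flat 0 x + flat 0 ((-1) * x + 1) > 0"
  by (cases "x > 0") (auto simp: flat_def add_pos_nonneg)

lemma step_Ck: "Ck_on k step UNIV"
  unfolding step_def[abs_def]
  by (intro Ck_on_mult Ck_on_inverse Ck_on_add flat_Ck open_UNIV Ck_on_affine_compose
      bounded_linear_mult_right) (use step_denominator_pos in \<open>auto simp: less_le\<close>)

lemma step_deriv: "(step has_real_derivative dstep x) (at x)"
  unfolding dstep_def by (rule Ck_on_has_real_derivative[OF step_Ck[of "Suc 0"]]) simp

lemma dstep_continuous: "continuous_on UNIV dstep"
  using step_Ck[of "Suc 0"] by (simp add: dstep_def[abs_def])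

lemma step_eq_0: "x \<le> 0 \<Longrightarrow> step x = 0"
  by (simp add: step_def flat_def)

lemma step_eq_1: "x \<ge> 1 \<Longrightarrow> step x = 1"
  by (simp add: step_def flat_def)

lemma step_bounds: "0 \<le> step x" "step x \<le> 1"
proof -
  have nn: "flat 0 y \<ge> 0" for y by (simp add: flat_def)
  show "0 \<le> step x" using nn[of x] step_denominator_pos[of x] by (simp add: step_def)
  have "flat 0 x \<le> flat 0 x + flat 0 ((-1) * x + 1)" using nn[of "(-1) * x + 1"] by linarith
  then show "step x \<le> 1" using step_denominator_pos[of x] by (simp add: step_def field_simps)
qed

lemma dstep_eq_0: "x \<notin> {0..1} \<Longrightarrow> dstep x = 0"
proof -
  assume "x \<notin> {0..1}"
  then consider "x < 0" | "x > 1" by fastforce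
  then show ?thesis
  proof cases
    case 1
    have "(step has_real_derivative 0) (at x)"
      by (rule has_field_derivative_transform_within_open[where S = "{..<0}" and f = "\<lambda>x. 0"])
         (use 1 in \<open>auto simp: step_eq_0\<close>)
    then show ?thesis using DERIV_unique step_deriv by blast
  next
    case 2
    have "(step has_real_derivative 0) (at x)"
      by (rule has_field_derivative_transform_within_open[where S = "{1<..}" and f = "\<lambda>x. 1"])
         (use 2 in \<open>auto simp: step_eq_1\<close>)
    then show ?thesis using DERIV_unique step_deriv by blast
  qed
qed

lemma dstep_integral: "integrable lborel dstep" "(LBINT x. dstep x) = 1"
proof -
  have eq: "(\<lambda>x. dstep x * indicator {0..1} x) = dstep"
    using dstep_eq_0 by (force simp: indicator_def)
  have "has_bochner_integral lborel (\<lambda>x. dstep x * indicator {0..1} x) (step 1 - step 0)"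
    by (rule has_bochner_integral_FTC_Icc_real)
       (use step_deriv dstep_continuous in \<open>auto simp: continuous_on_eq_continuous_at\<close>)
  then show "integrable lborel dstep" "(LBINT x. dstep x) = 1"
    by (simp_all add: eq step_eq_0 step_eq_1 has_bochner_integral_iff)
qed

text \<open>The substitution x = c + e n * y moves the scaling into f. As \<open>dstep\<close> lives
  on \<open>{0..1}\<close>, only the values of f on one compact interval matter, and dominated
  convergence applies.\<close>

lemma LINT_dstep_tendsto:
  fixes f :: "real \<Rightarrow> real"
  assumes f: "continuous_on UNIV f" and e: "\<And>n. e n > 0" "e \<longlonglongrightarrow> 0"
  shows "(\<lambda>n. LBINT x. f x * (dstep ((x - c) / e n) / e n)) \<longlonglongrightarrow> f c"
proof -
  have eq: "(LBINT x. f x * (dstep ((x - c) / e n) / e n))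
      = (LBINT y. f (c + e n * y) * dstep y)" for n
    using lborel_integral_real_affine[of "e n" "\<lambda>x. f x * (dstep ((x - c) / e n) / e n)" c] e(1)[of n]
    by simp
  obtain E where E: "\<And>n. e n \<le> E"
    using convergent_imp_Bseq[of e] e(2) unfolding Bseq_def convergent_def
    by (metis abs_le_D1 real_norm_def)
  have "compact (f ` {c..c + E})"
    by (intro compact_continuous_image continuous_on_subset[OF f]) auto
  then obtain M where M: "\<And>x. x \<in> {c..c + E} \<Longrightarrow> \<bar>f x\<bar> \<le> M"
    using compact_imp_bounded[of "f ` {c..c + E}"] unfolding bounded_iff real_norm_def by blast
  have [measurable]: "f \<in> borel_measurable borel" "dstep \<in> borel_measurable borel"
    using f dstep_continuous by (auto intro: borel_measurable_continuous_onI)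
  have "(\<lambda>n. LBINT y. f (c + e n * y) * dstep y) \<longlonglongrightarrow> (LBINT y. f c * dstep y)"
  proof (rule integral_dominated_convergence[where w = "\<lambda>y. M * \<bar>dstep y\<bar>"])
    show "integrable lborel (\<lambda>y. M * \<bar>dstep y\<bar>)"
      using dstep_integral(1) by simp
    show "AE y in lborel. (\<lambda>n. f (c + e n * y) * dstep y) \<longlonglongrightarrow> f c * dstep y"
    proof (rule AE_I2)
      fix y
      have "(\<lambda>n. c + e n * y) \<longlonglongrightarrow> c + 0 * y"
        by (intro tendsto_intros e)
      then have "(\<lambda>n. f (c + e n * y)) \<longlonglongrightarrow> f c"
        using continuous_on_tendsto_compose[OF f, of "\<lambda>n. c + e n * y"] by simp
      then show "(\<lambda>n. f (c + e n * y) * dstep y) \<longlonglongrightarrow> f c * dstep y"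
        by (rule tendsto_mult_right)
    qed
    show "AE y in lborel. norm (f (c + e n * y) * dstep y) \<le> M * \<bar>dstep y\<bar>" for n
    proof (rule AE_I2)
      fix y
      show "norm (f (c + e n * y) * dstep y) \<le> M * \<bar>dstep y\<bar>"
      proof (cases "y \<in> {0..1}")
        case True
        then have "e n * y \<le> E * 1"
          using e(1)[of n] E[of n] by (intro mult_mono) auto
        then have "\<bar>f (c + e n * y)\<bar> \<le> M"
          using True e(1)[of n] by (intro M) auto
        then show ?thesis by (simp add: abs_mult mult_right_mono)
      qed (simp add: dstep_eq_0)
    qed
  qed auto
  then show ?thesis unfolding eq by (simp add: dstep_integral)
qed

section \<open>Test functions on an interval\<close>

lemma test_functionsI:
  assumes "\<And>k. Ck_on k \<phi> UNIV" "\<And>x. x \<notin> K \<Longrightarrow> \<phi> x = 0" "compact K" "K \<subseteq> \<Omega>"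
  shows "\<phi> \<in> test_functions \<Omega>"
proof -
  have "closure {x. \<phi> x \<noteq> 0} \<subseteq> K"
    using assms(2,3) by (intro closure_minimal) (auto simp: compact_imp_closed)
  then show ?thesis
    using assms(1,3,4) bounded_subset[OF compact_imp_bounded[OF assms(3)]]
    by (auto simp: test_functions_def compact_eq_bounded_closed)
qed

lemma test_functions_vanish:
  fixes \<phi> :: "real \<Rightarrow> real"
  assumes "\<phi> \<in> test_functions {a<..<b}" "a < b"
  obtains c d where "a < c" "c < d" "d < b" "\<And>x. x \<notin> {c..d} \<Longrightarrow> \<phi> x = 0"
proof -
  let ?K = "closure {x. \<phi> x \<noteq> 0}"
  have K: "compact ?K" "?K \<subseteq> {a<..<b}" using assms by (auto simp: test_functions_def)
  \<comment> \<open>Adding the midpoint keeps the compact set nonempty when \<phi> is identically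
    zero.\<close>
  define m where "m = (a + b) / 2"
  have "compact (insert m ?K)" using K by simp
  moreover have "insert m ?K \<subseteq> {a<..<b}" using K assms by (auto simp: m_def field_simps)
  ultimately obtain p q where p: "p \<in> insert m ?K" "\<And>x. x \<in> insert m ?K \<Longrightarrow> p \<le> x"
    and q: "q \<in> insert m ?K" "\<And>x. x \<in> insert m ?K \<Longrightarrow> x \<le> q"
    using compact_attains_inf[of "insert m ?K"] compact_attains_sup[of "insert m ?K"] by blast
  have "a < p" "q < b" "p \<le> q" using p q K(2) \<open>insert m ?K \<subseteq> {a<..<b}\<close> by auto
  show ?thesis
  proof (rule that[of "(a + p) / 2" "(q + b) / 2"])
    fix x assume x: "x \<notin> {(a + p) / 2..(q + b) / 2}"
    show "\<phi> x = 0"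
    proof (rule ccontr)
      assume "\<phi> x \<noteq> 0"
      then have "x \<in> insert m ?K" using closure_subset[of "{x. \<phi> x \<noteq> 0}"] by blast
      then have "p \<le> x" "x \<le> q" using p q by auto
      then show False using x \<open>a < p\<close> \<open>q < b\<close> by auto
    qed
  qed (use \<open>a < p\<close> \<open>q < b\<close> \<open>p \<le> q\<close> in auto)
qed

text \<open>\<open>b\<close> runs through smooth approximations of the indicator of \<open>(c,d)\<close>.\<close>

lemma du_Bois_Reymond:
  fixes f N :: "real \<Rightarrow> real"
  assumes f: "continuous_on UNIV f" and N[measurable]: "N \<in> borel_measurable borel"
    and bdd: "\<And>c d. \<alpha> < c \<Longrightarrow> d < \<beta> \<Longrightarrow> \<exists>K. \<forall>x\<in>{c..d}. \<bar>N x\<bar> \<le> K"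
    and weak: "\<And>b b'. b \<in> test_functions {\<alpha><..<\<beta>} \<Longrightarrow>
      (\<And>x. (b has_real_derivative b' x) (at x)) \<Longrightarrow>
      (LBINT x. f x * b' x) = - (LBINT x. N x * b x)"
    and cd: "\<alpha> < c" "c < d" "d < \<beta>"
  shows "f d - f c = (LBINT x. N x * indicator {c<..d} x)"
proof -
  \<comment> \<open>Dividing by n + 2 makes e n < \<beta> - d strict already for n = 0.\<close>
  define e where "e = (\<lambda>n. (\<beta> - d) / real (n + 2))"
  have e: "e n > 0" "d + e n < \<beta>" for n
  proof -
    show "e n > 0" using cd by (simp add: e_def)
    have "e n < (\<beta> - d) / 1"
      unfolding e_def using cd by (intro divide_strict_left_mono) auto
    then show "d + e n < \<beta>" by simp
  qed
  have elim: "e \<longlonglongrightarrow> 0"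
    unfolding e_def by (rule LIMSEQ_ignore_initial_segment[OF lim_const_over_n])
  have e0: "e n \<le> e 0" for n
    unfolding e_def using cd by (intro divide_left_mono) auto
  define b where "b = (\<lambda>n x. step ((1 / e n) * x + (- c / e n)) + (-1) * step ((1 / e n) * x + (- d / e n)))"
  define b' where "b' = (\<lambda>n x. dstep ((x - c) / e n) / e n - dstep ((x - d) / e n) / e n)"
  have b_alt: "b n x = step ((x - c) / e n) - step ((x - d) / e n)" for n x
    by (simp add: b_def diff_divide_distrib)
  have b_deriv: "(b n has_real_derivative b' n x) (at x)" for n x
    using e(1)[of n] unfolding b_alt[abs_def] b'_def
    by (auto intro!: derivative_eq_intros DERIV_chain'[OF _ step_deriv] simp: field_simps)
  have b0: "b n x = 0" if out: "x \<notin> {c..d + e n}" for n x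
  proof -
    consider "x < c" | "x > d + e n" using out by (metis atLeastAtMost_iff linorder_not_le)
    then show ?thesis
    proof cases
      case 1
      then show ?thesis using cd e(1)[of n] by (simp add: b_alt step_eq_0 divide_nonpos_pos)
    next
      case 2
      then show ?thesis using cd e(1)[of n] by (simp add: b_alt step_eq_1 field_simps)
    qed
  qed
  have test: "b n \<in> test_functions {\<alpha><..<\<beta>}" for n
  proof (rule test_functionsI[where K = "{c..d + e n}"])
    show "Ck_on k (b n) UNIV" for k
      unfolding b_def
      by (intro Ck_on_add Ck_on_mult Ck_on_const open_UNIV Ck_on_affine_compose step_Ck
          bounded_linear_mult_right)
  qed (use b0 e(2)[of n] cd in auto)
  obtain K where K: "\<And>x. x \<in> {c..d + e 0} \<Longrightarrow> \<bar>N x\<bar> \<le> K"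
    using bdd[OF cd(1) e(2)[of 0]] by blast
  have K0: "0 \<le> K" using K[of c] cd e(1)[of 0] by force
  have [measurable]: "step \<in> borel_measurable borel"
    using DERIV_isCont[OF step_deriv]
    by (intro borel_measurable_continuous_onI continuous_at_imp_continuous_on) auto
  have [measurable]: "b n \<in> borel_measurable borel" for n
    unfolding b_alt[abs_def] by measurable
  have "(\<lambda>n. LBINT x. N x * b n x) \<longlonglongrightarrow> (LBINT x. N x * indicator {c<..d} x)"
  proof (rule integral_dominated_convergence[where w = "\<lambda>x. K * indicator {c..d + e 0} x"])
    show "integrable lborel (\<lambda>x. K * indicator {c..d + e 0} x)"
      by (intro integrable_mult_right integrable_real_indicator) (auto simp: emeasure_lborel_Icc_eq)
    show "AE x in lborel. norm (N x * b n x) \<le> K * indicator {c..d + e 0} x" for n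
    proof (rule AE_I2)
      fix x
      show "norm (N x * b n x) \<le> K * indicator {c..d + e 0} x"
      proof (cases "x \<in> {c..d + e n}")
        case True
        then have "x \<in> {c..d + e 0}" using e0[of n] by auto
        moreover have "\<bar>b n x\<bar> \<le> 1"
          using step_bounds[of "(x - c) / e n"] step_bounds[of "(x - d) / e n"] by (simp add: b_alt)
        ultimately show ?thesis
          using mult_mono[OF K[of x], of "\<bar>b n x\<bar>" 1] K0 by (simp add: abs_mult)
      next
        case False
        then show ?thesis using b0[OF False] K0 by simp
      qed
    qed
    show "AE x in lborel. (\<lambda>n. N x * b n x) \<longlonglongrightarrow> N x * indicator {c<..d} x"
    proof (rule AE_I2)
      fix x
      \<comment> \<open>At x = y the step is 0 for every n, which is why the limit of b is the
        indicator of a half-open interval.\<close>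
      have lim: "(\<lambda>n. step ((x - y) / e n)) \<longlonglongrightarrow> (if y < x then 1 else 0)" for y
      proof (cases "y < x")
        case True
        have "eventually (\<lambda>n. e n < x - y) sequentially"
          using order_tendstoD(2)[OF elim, of "x - y"] True by simp
        then have "eventually (\<lambda>n. step ((x - y) / e n) = 1) sequentially"
          by eventually_elim (use e in \<open>auto simp: step_eq_1 field_simps intro!: step_eq_1\<close>)
        then show ?thesis using True by (simp add: tendsto_eventually)
      next
        case False
        then have "step ((x - y) / e n) = 0" for n
          using e(1)[of n] by (intro step_eq_0) (simp add: divide_nonpos_pos)
        then show ?thesis using False by simp
      qed
      have "(\<lambda>n. b n x) \<longlonglongrightarrow> (if c < x then 1 else 0) - (if d < x then 1 else 0)"
        unfolding b_alt by (intro tendsto_diff lim)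
      also have "(if c < x then 1 else 0) - (if d < x then 1 else 0) = (indicator {c<..d} x :: real)"
        using cd by (auto simp: indicator_def)
      finally show "(\<lambda>n. N x * b n x) \<longlonglongrightarrow> N x * indicator {c<..d} x"
        by (rule tendsto_mult_left)
    qed
  qed auto
  \<comment> \<open>b' is a mollifier at c minus a mollifier at d.\<close>
  moreover have "(\<lambda>n. LBINT x. f x * b' n x) \<longlonglongrightarrow> f c - f d"
  proof -
    have int: "integrable lborel (\<lambda>x. f x * (dstep ((x - y) / e n) / e n))" for y n
    proof -
      have "continuous_on {y..y + e n} (\<lambda>x. f x * (dstep ((x - y) / e n) / e n))"
        using e(1)[of n]
        by (intro continuous_intros continuous_on_subset[OF f]
            continuous_on_compose2[OF dstep_continuous]) auto
      then have "integrable lborel (\<lambda>x. indicator {y..y + e n} x *\<^sub>R (f x * (dstep ((x - y) / e n) / e n)))"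
        by (intro borel_integrable_compact) auto
      moreover have "dstep ((x - y) / e n) = 0" if "x \<notin> {y..y + e n}" for x
      proof (rule dstep_eq_0, rule notI)
        assume "(x - y) / e n \<in> {0..1}"
        then have "0 \<le> x - y" "x - y \<le> e n"
          using e(1)[of n] by (auto simp: zero_le_divide_iff divide_le_eq)
        then show False using that by auto
      qed
      then have "(\<lambda>x. indicator {y..y + e n} x *\<^sub>R (f x * (dstep ((x - y) / e n) / e n)))
          = (\<lambda>x. f x * (dstep ((x - y) / e n) / e n))"
        by (auto simp: indicator_def fun_eq_iff)
      ultimately show ?thesis by simp
    qed
    have "(LBINT x. f x * b' n x) = (LBINT x. f x * (dstep ((x - c) / e n) / e n))
        - (LBINT x. f x * (dstep ((x - d) / e n) / e n))" for n
      by (subst Bochner_Integration.integral_diff[symmetric, OF int int])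
         (simp add: b'_def right_diff_distrib)
    then show ?thesis
      using tendsto_diff[OF LINT_dstep_tendsto[OF f e(1) elim, of c] LINT_dstep_tendsto[OF f e(1) elim, of d]]
      by simp
  qed
  ultimately have "f c - f d = - (LBINT x. N x * indicator {c<..d} x)"
    using weak[OF test b_deriv] LIMSEQ_unique[of "\<lambda>n. LBINT x. f x * b' n x"] tendsto_minus
    by (metis (no_types, lifting) ext)
  then show ?thesis by simp
qed

subsection \<open>Testing the equation with products\<close>

lemma test_function_deriv:
  fixes \<phi> :: "real \<Rightarrow> real"
  assumes \<phi>: "\<phi> \<in> test_functions \<Omega>" and D: "\<And>x. (\<phi> has_real_derivative \<phi>' x) (at x)"
  shows "\<phi>' \<in> test_functions \<Omega>"
proof (rule test_functionsI)
  let ?K = "closure {x. \<phi> x \<noteq> 0}"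
  have eq: "\<phi>' = (\<lambda>x. frechet_derivative \<phi> (at x) 1)"
    using frechet_derivative_real[OF D] by auto
  have "Ck_on (Suc k) \<phi> UNIV" for k
    using \<phi> unfolding test_functions_def by blast
  then show "Ck_on k \<phi>' UNIV" for k
    unfolding eq by simp
  show "\<phi>' x = 0" if x: "x \<notin> ?K" for x
  proof -
    have "(\<phi> has_real_derivative 0) (at x)"
      by (rule has_field_derivative_transform_within_open[where S = "- ?K" and f = "\<lambda>x. 0"])
         (use x closure_subset[of "{x. \<phi> x \<noteq> 0}"] in auto)
    then show ?thesis using DERIV_unique D by blast
  qed
qed (use \<phi> in \<open>auto simp: test_functions_def\<close>)

lemma test_function_continuous: "\<phi> \<in> test_functions \<Omega> \<Longrightarrow> continuous_on UNIV \<phi>"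
  by (metis (mono_tags, lifting) Ck_on.simps(1) mem_Collect_eq test_functions_def)

lemma test_function_measurable: "\<phi> \<in> test_functions \<Omega> \<Longrightarrow> \<phi> \<in> borel_measurable borel"
  by (intro borel_measurable_continuous_onI test_function_continuous)

lemma test_function_integrable:
  fixes \<phi> :: "real \<Rightarrow> real"
  assumes "\<phi> \<in> test_functions \<Omega>"
  shows "integrable lborel \<phi>"
proof -
  let ?K = "closure {x. \<phi> x \<noteq> 0}"
  have "integrable lborel (\<lambda>x. indicator ?K x *\<^sub>R \<phi> x)"
    using assms continuous_on_subset[OF test_function_continuous[OF assms]]
    by (intro borel_integrable_compact) (auto simp: test_functions_def)
  also have "(\<lambda>x. indicator ?K x *\<^sub>R \<phi> x) = \<phi>"
    using closure_subset[of "{x. \<phi> x \<noteq> 0}"] by (auto simp: indicator_def fun_eq_iff)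
  finally show ?thesis .
qed

lemma test_function_vanish: "\<phi> \<in> test_functions \<Omega> \<Longrightarrow> x \<notin> \<Omega> \<Longrightarrow> \<phi> x = 0"
  using closure_subset[of "{x. \<phi> x \<noteq> 0}"] by (auto simp: test_functions_def)

lemma test_function_prod:
  fixes a b :: "real \<Rightarrow> real"
  assumes a: "a \<in> test_functions A" and b: "b \<in> test_functions B"
  shows "(\<lambda>p. a (fst p) * b (snd p)) \<in> test_functions (A \<times> B)"
proof (rule test_functionsI)
  let ?K = "closure {x. a x \<noteq> 0} \<times> closure {x. b x \<noteq> 0}"
  have "Ck_on k (\<lambda>p::real\<times>real. a (fst p + 0)) UNIV" "Ck_on k (\<lambda>p::real\<times>real. b (snd p + 0)) UNIV" for k
    using a b by (intro Ck_on_affine_compose bounded_linear_fst bounded_linear_snd;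
        auto simp: test_functions_def)+
  then show "Ck_on k (\<lambda>p. a (fst p) * b (snd p)) UNIV" for k
    by (intro Ck_on_mult) auto
  show "a (fst p) * b (snd p) = 0" if "p \<notin> ?K" for p
    using that closure_subset[of "{x. a x \<noteq> 0}"] closure_subset[of "{x. b x \<noteq> 0}"]
    by (cases p) auto
qed (use a b in \<open>auto simp: test_functions_def compact_Times\<close>)

lemma frechet_derivative_prod:
  assumes "(a has_real_derivative a') (at (fst p))" "(b has_real_derivative b') (at (snd p))"
  shows "frechet_derivative (\<lambda>p. a (fst p) * b (snd p)) (at p) =
    (\<lambda>h. a (fst p) * (b' * snd h) + a' * fst h * b (snd p))"
proof -
  have 1: "((\<lambda>p. a (fst p)) has_derivative (\<lambda>h. a' * fst h)) (at p)"
    by (rule has_derivative_compose[OF has_derivative_fst[OF has_derivative_ident]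
        assms(1)[unfolded has_field_derivative_def]])
  have 2: "((\<lambda>p. b (snd p)) has_derivative (\<lambda>h. b' * snd h)) (at p)"
    by (rule has_derivative_compose[OF has_derivative_snd[OF has_derivative_ident]
        assms(2)[unfolded has_field_derivative_def]])
  show ?thesis
    by (rule frechet_derivative_at[symmetric]) (rule has_derivative_mult[OF 1 2])
qed

lemma locally_integrable_mult_test:
  fixes f \<phi> :: "'a::euclidean_space \<Rightarrow> real"
  assumes f: "locally_integrable_on f \<Omega>" and \<phi>: "\<phi> \<in> test_functions \<Omega>" and \<Omega>: "open \<Omega>"
  shows "integrable (lebesgue_on \<Omega>) (\<lambda>x. f x * \<phi> x)"
proof -
  let ?K = "closure {x. \<phi> x \<noteq> 0}"
  have K: "compact ?K" "?K \<subseteq> \<Omega>" using \<phi> by (auto simp: test_functions_def)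
  have bd: "bounded (\<phi> ` ?K)"
    using K by (intro compact_imp_bounded compact_continuous_image
        continuous_on_subset[OF test_function_continuous[OF \<phi>]]) auto
  have fi: "f absolutely_integrable_on ?K"
    using f K by (auto simp: locally_integrable_on_def)
  have me: "\<phi> \<in> borel_measurable (lebesgue_on ?K)"
    using test_function_measurable[OF \<phi>] by (intro measurable_restrict_space1 measurable_completion) simp
  have "(\<lambda>x. \<phi> x * f x) absolutely_integrable_on ?K"
    by (rule absolutely_integrable_bounded_measurable_product[OF bilinear_times me _ bd fi]) simp
  then have "integrable lebesgue (\<lambda>x. indicator ?K x *\<^sub>R (\<phi> x * f x))"
    by (simp add: set_integrable_def)
  also have "(\<lambda>x. indicator ?K x *\<^sub>R (\<phi> x * f x)) = (\<lambda>x. indicator \<Omega> x *\<^sub>R (f x * \<phi> x))"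
    using closure_subset[of "{x. \<phi> x \<noteq> 0}"] K by (auto simp: indicator_def fun_eq_iff)
  finally show ?thesis
    using \<Omega> by (subst integrable_restrict_space) auto
qed

text \<open>Leads from the integrals in the definition of weak derivatives to \<open>lborel\<close>,
  where Fubini is applied.\<close>

lemma LINT_lebesgue_on_eq_lborel:
  fixes f :: "'a::euclidean_space \<Rightarrow> real"
  assumes "open \<Omega>" "f \<in> borel_measurable borel" "\<And>x. x \<notin> \<Omega> \<Longrightarrow> f x = 0"
  shows "(LINT x|lebesgue_on \<Omega>. f x) = (LBINT x. f x)"
proof -
  have "(LINT x|lebesgue_on \<Omega>. f x) = (LINT x|lebesgue. indicator \<Omega> x *\<^sub>R f x)"
    using assms(1) by (subst integral_restrict_space) auto
  also have "(\<lambda>x. indicator \<Omega> x *\<^sub>R f x) = f"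
    using assms(3) by (auto simp: indicator_def fun_eq_iff)
  also have "(LINT x|lebesgue. f x) = (LBINT x. f x)"
    using assms(2) by (intro integral_completion) simp
  finally show ?thesis .
qed

text \<open>All derivatives are moved onto the test functions. Choosing m = (1 - x^2) a' absorbs the
  weight, so that testing \<open>ux\<close> with m b equals testing (1 - x^2) \<open>ux\<close> with
  a' b; both weak space derivatives are thereby eliminated and only u and F remain.\<close>

lemma weak_equation_product:
  fixes u :: "real \<Rightarrow> real \<Rightarrow> real" and U F :: "real \<times> real \<Rightarrow> real" and T :: real
  defines "\<Omega> \<equiv> {-1<..<1} \<times> {0<..<T}"
  assumes ut: "has_weak_derivative_on (\<lambda>(x, t). u x t) (0, 1) ut \<Omega>"
    and ux: "has_weak_derivative_on (\<lambda>(x, t). u x t) (1, 0) ux \<Omega>"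
    and w: "has_weak_derivative_on (\<lambda>(x, t). (1 - x\<^sup>2) * ux (x, t)) (1, 0) w \<Omega>"
    and eq: "AE p in lebesgue_on \<Omega>. ut p - w p = - F p"
    and U: "U \<in> borel_measurable borel" "\<And>x t. (x, t) \<in> \<Omega> \<Longrightarrow> U (x, t) = u x t"
    and F: "F \<in> borel_measurable borel"
    and a: "a \<in> test_functions {-1<..<1}" "\<And>x. (a has_real_derivative a' x) (at x)"
    and m: "m \<in> test_functions {-1<..<1}" "\<And>x. (m has_real_derivative m' x) (at x)"
    and ma: "\<And>x. m x = (1 - x\<^sup>2) * a' x"
    and b: "b \<in> test_functions {0<..<T}" "\<And>x. (b has_real_derivative b' x) (at x)"
  shows "(LBINT p. U p * (a (fst p) * b' (snd p))) + (LBINT p. U p * (m' (fst p) * b (snd p)))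
    = (LBINT p. F p * (a (fst p) * b (snd p)))"
proof -
  have \<Omega>: "open \<Omega>" unfolding \<Omega>_def by (intro open_Times) auto
  define \<phi> where "\<phi> = (\<lambda>p. a (fst p) * b (snd p))"
  define \<psi> where "\<psi> = (\<lambda>p. m (fst p) * b (snd p))"
  have \<phi>: "\<phi> \<in> test_functions \<Omega>" and \<psi>: "\<psi> \<in> test_functions \<Omega>"
    unfolding \<phi>_def \<psi>_def \<Omega>_def using a m b by (auto intro: test_function_prod)
  have D\<phi>: "frechet_derivative \<phi> (at p) (0, 1) = a (fst p) * b' (snd p)"
    "frechet_derivative \<phi> (at p) (1, 0) = a' (fst p) * b (snd p)" for p
    unfolding \<phi>_def using frechet_derivative_prod[OF a(2) b(2)] by auto
  have D\<psi>: "frechet_derivative \<psi> (at p) (1, 0) = m' (fst p) * b (snd p)" for p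
    unfolding \<psi>_def using frechet_derivative_prod[OF m(2) b(2)] by auto
  note tm = test_function_measurable[OF a(1)] test_function_measurable[OF b(1)]
    test_function_measurable[OF test_function_deriv[OF b]]
    test_function_measurable[OF test_function_deriv[OF m]]
  have [measurable]: "(\<lambda>p. a (fst p)) \<in> borel_measurable (borel :: (real \<times> real) measure)"
     "(\<lambda>p. m' (fst p)) \<in> borel_measurable (borel :: (real \<times> real) measure)"
     "(\<lambda>p. b (snd p)) \<in> borel_measurable (borel :: (real \<times> real) measure)"
     "(\<lambda>p. b' (snd p)) \<in> borel_measurable (borel :: (real \<times> real) measure)"
    by (intro measurable_compose[OF _ tm(1)] measurable_compose[OF _ tm(2)]
        measurable_compose[OF _ tm(3)] measurable_compose[OF _ tm(4)];
        simp add: borel_prod[symmetric])+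
  note [measurable] = U(1) F
  have zero: "a (fst p) * c = 0 \<or> b (snd p) = 0" "m' (fst p) * b (snd p) = 0"
    "a (fst p) * b' (snd p) = 0" "a (fst p) * b (snd p) = 0" if "p \<notin> \<Omega>" for p c
    using that test_function_vanish[OF a(1), of "fst p"] test_function_vanish[OF b(1), of "snd p"]
     test_function_vanish[OF test_function_deriv[OF b], of "snd p"]
     test_function_vanish[OF test_function_deriv[OF m], of "fst p"]
    by (cases p; auto simp: \<Omega>_def)+
  have 1: "(LBINT p. U p * (a (fst p) * b' (snd p))) = - (LINT p|lebesgue_on \<Omega>. ut p * \<phi> p)"
  proof -
    have "(LBINT p. U p * (a (fst p) * b' (snd p))) = (LINT p|lebesgue_on \<Omega>. U p * (a (fst p) * b' (snd p)))"
      by (rule LINT_lebesgue_on_eq_lborel[symmetric, OF \<Omega>]) (use zero in auto)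
    also have "\<dots> = (LINT p|lebesgue_on \<Omega>. (case p of (x, t) \<Rightarrow> u x t) * frechet_derivative \<phi> (at p) (0, 1))"
      by (rule Bochner_Integration.integral_cong) (use U(2) in \<open>auto simp: D\<phi>\<close>)
    finally show ?thesis
      using ut \<phi> by (auto simp: has_weak_derivative_on_def)
  qed
  have 2: "(LBINT p. U p * (m' (fst p) * b (snd p))) = (LINT p|lebesgue_on \<Omega>. w p * \<phi> p)"
  proof -
    have "(LBINT p. U p * (m' (fst p) * b (snd p))) = (LINT p|lebesgue_on \<Omega>. U p * (m' (fst p) * b (snd p)))"
      by (rule LINT_lebesgue_on_eq_lborel[symmetric, OF \<Omega>]) (use zero in auto)
    also have "\<dots> = (LINT p|lebesgue_on \<Omega>. (case p of (x, t) \<Rightarrow> u x t) * frechet_derivative \<psi> (at p) (1, 0))"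
      by (rule Bochner_Integration.integral_cong) (use U(2) in \<open>auto simp: D\<psi>\<close>)
    also have "\<dots> = - (LINT p|lebesgue_on \<Omega>. ux p * \<psi> p)"
      using ux \<psi> by (auto simp: has_weak_derivative_on_def)
    also have "(LINT p|lebesgue_on \<Omega>. ux p * \<psi> p) =
      (LINT p|lebesgue_on \<Omega>. (case p of (x, t) \<Rightarrow> (1 - x\<^sup>2) * ux (x, t)) * frechet_derivative \<phi> (at p) (1, 0))"
      by (rule Bochner_Integration.integral_cong) (auto simp: D\<phi> \<psi>_def ma)
    also have "\<dots> = - (LINT p|lebesgue_on \<Omega>. w p * \<phi> p)"
      using w \<phi> by (auto simp: has_weak_derivative_on_def)
    finally show ?thesis by simp
  qed
  have int: "integrable (lebesgue_on \<Omega>) (\<lambda>p. ut p * \<phi> p)" "integrable (lebesgue_on \<Omega>) (\<lambda>p. w p * \<phi> p)"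
    using ut w \<phi> \<Omega> by (auto intro!: locally_integrable_mult_test simp: has_weak_derivative_on_def)
  have "(LBINT p. F p * (a (fst p) * b (snd p))) = (LINT p|lebesgue_on \<Omega>. F p * (a (fst p) * b (snd p)))"
    by (rule LINT_lebesgue_on_eq_lborel[symmetric, OF \<Omega>]) (use zero in auto)
  also have "\<dots> = (LINT p|lebesgue_on \<Omega>. w p * \<phi> p - ut p * \<phi> p)"
  proof (rule integral_cong_AE)
    show "(\<lambda>p. F p * (a (fst p) * b (snd p))) \<in> borel_measurable (lebesgue_on \<Omega>)"
      by (intro measurable_restrict_space1 measurable_completion) simp
    show "(\<lambda>p. w p * \<phi> p - ut p * \<phi> p) \<in> borel_measurable (lebesgue_on \<Omega>)"
      using int by (intro borel_measurable_diff borel_measurable_integrable)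
    show "AE p in lebesgue_on \<Omega>. F p * (a (fst p) * b (snd p)) = w p * \<phi> p - ut p * \<phi> p"
      using eq
    proof eventually_elim
      case (elim p)
      then have "F p = w p - ut p" by simp
      then show ?case by (simp add: \<phi>_def left_diff_distrib)
    qed
  qed
  also have "\<dots> = (LINT p|lebesgue_on \<Omega>. w p * \<phi> p) - (LINT p|lebesgue_on \<Omega>. ut p * \<phi> p)"
    by (rule Bochner_Integration.integral_diff[OF int(2,1)])
  finally show ?thesis using 1 2 by simp
qed

subsection \<open>Time-integrated solutions\<close>

lemma integrable_bounded_mult:
  fixes k p :: "'a \<Rightarrow> real"
  assumes "integrable M p" "k \<in> borel_measurable M" "\<And>x. \<bar>k x\<bar> \<le> K"
  shows "integrable M (\<lambda>x. k x * p x)"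
proof (rule Bochner_Integration.integrable_bound)
  show "integrable M (\<lambda>x. K * \<bar>p x\<bar>)" using assms(1) by simp
  show "(\<lambda>x. k x * p x) \<in> borel_measurable M" using assms by simp
  have "0 \<le> K" using assms(3) abs_ge_zero order_trans by blast
  then show "AE x in M. norm (k x * p x) \<le> norm (K * \<bar>p x\<bar>)"
    using assms(3) by (auto simp: abs_mult intro!: AE_I2 mult_right_mono)
qed

lemma integrable_indicator_real:
  "bounded (A :: real set) \<Longrightarrow> A \<in> sets borel \<Longrightarrow> integrable lborel (indicator A :: real \<Rightarrow> real)"
  using emeasure_bounded_finite by (auto intro!: integrable_real_indicator simp: infinity_ennreal_def)

lemma LINT_product_kernel:
  fixes k :: "real \<times> real \<Rightarrow> real"
  assumes k: "k \<in> borel_measurable borel" "\<And>p. \<bar>k p\<bar> \<le> K"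
    and q: "integrable lborel q" and r: "integrable lborel r"
  shows "(LBINT p. k p * (q (fst p) * r (snd p)))
        = (LBINT t. (LBINT x. k (x, t) * q x) * r t)" (is ?snd)
    and "(LBINT p. k p * (q (fst p) * r (snd p)))
        = (LBINT x. (LBINT t. k (x, t) * r t) * q x)" (is ?fst)
proof -
  have [measurable]: "k \<in> borel_measurable (borel \<Otimes>\<^sub>M borel)"
    using k(1) by (simp add: borel_prod)
  have [measurable]: "q \<in> borel_measurable borel" "r \<in> borel_measurable borel"
    using q r by (auto dest: borel_measurable_integrable)
  have "integrable (lborel \<Otimes>\<^sub>M lborel) (\<lambda>p. q (fst p) * r (snd p))"
  proof (rule lborel_pair.Fubini_integrable)
    show "integrable lborel (\<lambda>x. LBINT y. norm (q (fst (x, y)) * r (snd (x, y))))"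
      using q by (simp add: abs_mult)
    show "AE x in lborel. integrable lborel (\<lambda>y. q (fst (x, y)) * r (snd (x, y)))"
      using r by simp
  qed simp
  then have int: "integrable (lborel \<Otimes>\<^sub>M lborel) (\<lambda>(x, t). k (x, t) * (q x * r t))"
    using integrable_bounded_mult[of "lborel \<Otimes>\<^sub>M lborel" "\<lambda>p. q (fst p) * r (snd p)" k K] k(2)
    by (simp add: case_prod_beta')
  have "(LBINT p. k p * (q (fst p) * r (snd p)))
      = (LINT p|(lborel \<Otimes>\<^sub>M lborel). (case p of (x, t) \<Rightarrow> k (x, t) * (q x * r t)))"
    by (simp add: lborel_prod case_prod_beta')
  moreover have "(LBINT x. k (x, t) * (q x * r t)) = (LBINT x. k (x, t) * q x) * r t" for t
    by (simp add: mult.assoc[symmetric])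
  moreover have "(LBINT t. k (x, t) * (q x * r t)) = (LBINT t. k (x, t) * r t) * q x" for x
  proof -
    have "(LBINT t. k (x, t) * (q x * r t)) = (LBINT t. k (x, t) * r t * q x)"
      by (rule Bochner_Integration.integral_cong[OF refl]) simp
    then show ?thesis by simp
  qed
  ultimately show ?snd ?fst
    using lborel_pair.integral_snd[OF int] lborel_pair.integral_fst'[OF int] by simp_all
qed

lemma continuous_LINT_param:
  fixes k :: "real \<Rightarrow> real \<Rightarrow> real"
  assumes k: "\<And>x. continuous_on UNIV (\<lambda>t. k x t)" "\<And>t. (\<lambda>x. k x t) \<in> borel_measurable borel"
    and K: "\<And>x t. \<bar>k x t\<bar> \<le> K" and q: "integrable lborel q"
  shows "continuous_on UNIV (\<lambda>t. LBINT x. k x t * q x)"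
  unfolding continuous_on_sequentially
proof (intro allI ballI impI)
  fix X :: "nat \<Rightarrow> real" and t assume X: "t \<in> UNIV" "(\<forall>n. X n \<in> UNIV) \<and> X \<longlonglongrightarrow> t"
  have "(\<lambda>n. LBINT x. k x (X n) * q x) \<longlonglongrightarrow> (LBINT x. k x t * q x)"
  proof (rule integral_dominated_convergence[where w = "\<lambda>x. K * \<bar>q x\<bar>"])
    show "AE x in lborel. (\<lambda>n. k x (X n) * q x) \<longlonglongrightarrow> k x t * q x"
      using X continuous_on_tendsto_compose[OF k(1)] by (intro AE_I2 tendsto_mult_right) auto
    show "AE x in lborel. norm (k x (X n) * q x) \<le> K * \<bar>q x\<bar>" for n
      using K by (auto simp: abs_mult intro!: AE_I2 mult_right_mono)
  qed (use k q in \<open>auto dest: borel_measurable_integrable\<close>)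
  then show "((\<lambda>t. LBINT x. k x t * q x) \<circ> X) \<longlonglongrightarrow> (LBINT x. k x t * q x)"
    by (simp add: o_def)
qed

lemma LINT_mult_bound:
  fixes k p :: "real \<Rightarrow> real"
  assumes "integrable lborel p" "k \<in> borel_measurable borel" "\<And>x. \<bar>k x\<bar> \<le> K"
  shows "\<bar>LBINT x. k x * p x\<bar> \<le> K * (LBINT x. \<bar>p x\<bar>)"
proof -
  have "\<bar>LBINT x. k x * p x\<bar> \<le> (LBINT x. \<bar>k x * p x\<bar>)"
    by (rule integral_abs_bound)
  also have "\<dots> \<le> (LBINT x. K * \<bar>p x\<bar>)"
    by (rule integral_mono)
       (use assms integrable_abs[OF integrable_bounded_mult[of lborel p k K]] in
         \<open>auto simp: abs_mult intro: mult_right_mono\<close>)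
  finally show ?thesis by simp
qed

text \<open>To the left of the support of \<open>n\<close> the integral is zero anyway; mean zero
  makes it vanish to the right as well.\<close>

lemma test_function_antiderivative:
  fixes n :: "real \<Rightarrow> real"
  assumes n: "n \<in> test_functions {\<alpha><..<\<beta>}" and "\<alpha> < \<beta>" and n0: "(LBINT z. n z) = 0"
  defines "a \<equiv> \<lambda>x. LBINT z. n z * indicator {..x} z"
  shows "(a has_real_derivative n x) (at x)" and "a \<in> test_functions {\<alpha><..<\<beta>}"
proof -
  obtain c d where cd: "\<alpha> < c" "c < d" "d < \<beta>" "\<And>x. x \<notin> {c..d} \<Longrightarrow> n x = 0"
    using test_functions_vanish[OF n \<open>\<alpha> < \<beta>\<close>] by blast
  have cont: "continuous_on A n" for A
    using test_function_continuous[OF n] continuous_on_subset by blast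
  show der: "(a has_real_derivative n x) (at x)" for x
  proof -
    \<comment> \<open>A base point to the left of both the support and x: beyond it \<open>a\<close>
      is an ordinary integral starting at L.\<close>
    define L where "L = min c x - 1"
    have L: "L < c" "L < x" by (auto simp: L_def)
    have eq: "a y = integral {L..y} n" if "y \<in> {L<..}" for y
    proof -
      have "n z * indicator {..y} z = indicator {L..y} z *\<^sub>R n z" for z
        using cd(4)[of z] L by (auto simp: indicator_def)
      then have "a y = (LINT z:{L..y}|lborel. n z)"
        unfolding a_def set_lebesgue_integral_def by (rule Bochner_Integration.integral_cong[OF refl])
      also have "\<dots> = integral {L..y} n"
          by (intro set_borel_integral_eq_integral, unfold set_integrable_def)
          (rule borel_integrable_compact, auto intro: cont)
      finally show ?thesis .
    qed
    have "((\<lambda>y. integral {L..y} n) has_real_derivative n x) (at x within {L..x + 1})"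
      by (rule integral_has_real_derivative[OF cont]) (use L in auto)
    then have "((\<lambda>y. integral {L..y} n) has_real_derivative n x) (at x)"
      using at_within_interior[of x "{L..x + 1}"] L by simp
    then show ?thesis
      by (rule has_field_derivative_transform_within_open[where S = "{L<..}"])
         (use eq L in auto)
  qed
  have "a x = 0" if "x \<notin> {c..d}" for x
  proof (cases "x < c")
    case True
    then have "(\<lambda>z. n z * indicator {..x} z) = (\<lambda>z. 0)"
      using cd(4) by (auto simp: indicator_def fun_eq_iff)
    then show ?thesis by (simp add: a_def)
  next
    case False
    then have "(\<lambda>z. n z * indicator {..x} z) = n"
      using cd(4) that by (auto simp: indicator_def fun_eq_iff)
    then show ?thesis by (simp add: a_def n0)
  qed
  moreover have "Ck_on (Suc k) a UNIV" for k
    using n by (intro Ck_on_realI[OF open_UNIV der]) (auto simp: test_functions_def)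
  ultimately show "a \<in> test_functions {\<alpha><..<\<beta>}"
    using cd by (intro test_functionsI[where K = "{c..d}"]) (auto intro: Ck_on_SucD)
qed

text \<open>Since 1 - x^2 <= 2 (1 + x), the derivative of V is at least (L/2) / (1 + x). Hence V -
  (L/2) ln (1 + x) is nondecreasing and V tends to minus infinity at -1.\<close>

lemma no_logarithmic_end:
  fixes V q :: "real \<Rightarrow> real"
  assumes "0 < r" "r < 1" "L > 0"
    and V: "\<And>x. x \<in> {-1<..<-1 + r} \<Longrightarrow> (V has_real_derivative q x / (1 - x\<^sup>2)) (at x)"
    and q: "\<And>x. x \<in> {-1<..<-1 + r} \<Longrightarrow> q x \<ge> L"
    and M: "\<And>x. x \<in> {-1<..<-1 + r} \<Longrightarrow> \<bar>V x\<bar> \<le> M"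
  shows False
proof -
  define x1 where "x1 = -1 + r / 2"
  define c where "c = V x1 - (L / 2) * ln (1 + x1)"
  \<comment> \<open>The exponential makes (L/2) ln (1 + x) at most -(c + M) - L/2, which forces V x
    < -M; the bound r / 4 keeps x to the left of \<open>x1\<close>.\<close>
  define x where "x = -1 + min (r / 4) (exp (- (2 * (c + M) / L + 1)))"
  have x1: "x1 \<in> {-1<..<-1 + r}" using assms by (auto simp: x1_def)
  have x: "x \<in> {-1<..<-1 + r}" "x < x1"
    using assms by (auto simp: x_def x1_def min_def)
  have "V x - (L / 2) * ln (1 + x) \<le> V x1 - (L / 2) * ln (1 + x1)"
  proof (rule DERIV_nonneg_imp_nondecreasing[where f = "\<lambda>x. V x - (L / 2) * ln (1 + x)"])
    fix y assume y: "x \<le> y" "y \<le> x1"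
    then have y': "y \<in> {-1<..<-1 + r}" using x x1 by auto
    have pos: "1 - y\<^sup>2 = (1 + y) * (1 - y)" by (simp add: power2_eq_square algebra_simps)
    have "((\<lambda>x. V x - (L / 2) * ln (1 + x)) has_real_derivative
        q y / (1 - y\<^sup>2) - (L / 2) * (1 / (1 + y))) (at y)"
    proof (rule DERIV_diff[OF V[OF y']])
      show "((\<lambda>x. (L / 2) * ln (1 + x)) has_real_derivative (L / 2) * (1 / (1 + y))) (at y)"
        using y' by (intro DERIV_cmult) (auto intro!: derivative_eq_intros)
    qed
    moreover have "L * (1 / (2 * (1 + y))) \<le> q y / (1 - y\<^sup>2)"
    proof -
      have "0 < 1 - y\<^sup>2"
        unfolding pos using y' assms by (intro mult_pos_pos) auto
      moreover have "1 - y\<^sup>2 \<le> (1 + y) * 2"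
        unfolding pos using y' assms by (intro mult_left_mono) auto
      ultimately have "L * (1 / (2 * (1 + y))) \<le> q y * (1 / (1 - y\<^sup>2))"
        using q[OF y'] assms(1-3) y' by (intro mult_mono) (auto intro!: divide_left_mono mult_pos_pos)
      then show ?thesis by simp
    qed
    moreover have "(L / 2) * (1 / (1 + y)) = L * (1 / (2 * (1 + y)))" by simp
    ultimately show "\<exists>D. ((\<lambda>x. V x - (L / 2) * ln (1 + x)) has_real_derivative D) (at y) \<and> 0 \<le> D"
      by (metis diff_ge_0_iff_ge)
  qed (use x in simp)
  then have 1: "V x - (L / 2) * ln (1 + x) \<le> c" by (simp add: c_def)
  have "ln (1 + x) \<le> ln (exp (- (2 * (c + M) / L + 1)))"
    using x by (subst ln_le_cancel_iff) (auto simp: x_def)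
  then have "(L / 2) * ln (1 + x) \<le> (L / 2) * (- (2 * (c + M) / L + 1))"
    using assms by (intro mult_left_mono) auto
  also have "\<dots> = - (c + M) - L / 2" using assms by (simp add: field_simps)
  finally show False using 1 M[OF x(1)] assms by linarith
qed

text \<open>The equation ((1 - x^2) V')' = R with zero flux at both ends, integrated once: the lower
  limit -1 encodes zero flux at -1, and the vanishing integral of R encodes it at 1. In this form R
  may be discontinuous while V' is still a classical derivative.\<close>

definition flux_form :: "(real \<Rightarrow> real) \<Rightarrow> (real \<Rightarrow> real) \<Rightarrow> bool" where
  "flux_form V R \<longleftrightarrow> continuous_on {-1..1} V \<and> R \<in> borel_measurable borel \<and> (\<exists>K. \<forall>x. \<bar>R x\<bar> \<le> K) \<and>
    (LBINT y. R y * indicator {-1..1} y) = 0 \<and>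
    (\<forall>x\<in>{-1<..<1}.
      (V has_real_derivative (LBINT y. R y * indicator {-1..x} y) / (1 - x\<^sup>2)) (at x))"

lemma LINT_indicator_diff:
  fixes R :: "real \<Rightarrow> real"
  assumes R: "R \<in> borel_measurable borel" "\<And>x. \<bar>R x\<bar> \<le> K" and "c \<le> x" "x \<le> y"
  shows "(LBINT z. R z * indicator {c..y} z) - (LBINT z. R z * indicator {c..x} z)
    = (LBINT z. R z * indicator {x<..y} z)"
proof -
  have int: "integrable lborel (\<lambda>z. R z * indicator {a..b} z)" for a b
    using R by (intro integrable_bounded_mult[where K = K] integrable_indicator_real) auto
  have "indicator {x<..y} z = indicator {c..y} z - (indicator {c..x} z :: real)" for z
    using assms(3,4) by (auto simp: indicator_def)
  then show ?thesis
    by (subst Bochner_Integration.integral_diff[OF int int, symmetric]) (simp add: right_diff_distrib)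
qed

lemma LINT_indicator_le:
  fixes R :: "real \<Rightarrow> real"
  assumes R: "R \<in> borel_measurable borel" "\<And>x. \<bar>R x\<bar> \<le> K" and "x \<le> y"
  shows "\<bar>LBINT z. R z * indicator {x<..y} z\<bar> \<le> K * (y - x)"
  using LINT_mult_bound[OF integrable_indicator_real[of "{x<..y}"] R] assms(3) by simp

lemma continuous_on_LINT_indicator:
  fixes R :: "real \<Rightarrow> real"
  assumes R: "R \<in> borel_measurable borel" "\<And>x. \<bar>R x\<bar> \<le> K"
  shows "continuous_on {c..} (\<lambda>x. LBINT z. R z * indicator {c..x} z)"
proof -
  have K: "0 \<le> K" using R(2) abs_ge_zero order_trans by blast
  have "dist (LBINT z. R z * indicator {c..x} z) (LBINT z. R z * indicator {c..y} z)
      \<le> K * dist x y" if "c \<le> x" "c \<le> y" for x y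
  proof (cases "x \<le> y")
    case True
    then show ?thesis
      using LINT_indicator_diff[OF R that(1) True] LINT_indicator_le[OF R True] by (simp add: dist_real_def)
  next
    case False
    then show ?thesis
      using LINT_indicator_diff[OF R that(2), of x] LINT_indicator_le[OF R, of y x] by (simp add: dist_real_def)
  qed
  then have "K-lipschitz_on {c..} (\<lambda>x. LBINT z. R z * indicator {c..x} z)"
    using K by (auto simp: lipschitz_on_def)
  then show ?thesis by (rule lipschitz_on_continuous_on)
qed

text \<open>The constant of integration vanishes since a nonzero flux at \<open>\<plusminus>1\<close> would make \<open>V\<close>
  logarithmically unbounded.\<close>

lemma flux_formI:
  fixes V R :: "real \<Rightarrow> real"
  assumes V: "continuous_on {-1..1} V" and R: "R \<in> borel_measurable borel" "\<And>x. \<bar>R x\<bar> \<le> K"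
    and der: "\<And>x. x \<in> {-1<..<1} \<Longrightarrow>
      (V has_real_derivative (C + (LBINT y. R y * indicator {-1..x} y)) / (1 - x\<^sup>2)) (at x)"
  shows "flux_form V R"
proof -
  define q where "q = (\<lambda>x. C + (LBINT y. R y * indicator {-1..x} y))"
  have der: "(V has_real_derivative q x / (1 - x\<^sup>2)) (at x)" if "x \<in> {-1<..<1}" for x
    using der[OF that] by (simp add: q_def)
  have q: "continuous_on {-1..1} q"
    unfolding q_def
    by (intro continuous_intros continuous_on_subset[OF continuous_on_LINT_indicator[OF R]]) auto
  have "bounded (V ` {-1..1})" using compact_continuous_image[OF V] by (simp add: compact_imp_bounded)
  then obtain M where M: "\<And>x. x \<in> {-1..1} \<Longrightarrow> \<bar>V x\<bar> \<le> M"
    unfolding bounded_iff real_norm_def by blast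
  \<comment> \<open>Only positive flux at -1 is excluded directly. The other sign and the other end
    follow by applying this to -V, V(-x) and -V(-x).\<close>
  have left: "\<not> W y0 > 0" if W: "continuous_on {-1..1} W" and y0: "y0 = (-1::real)"
    and D: "\<And>x. x \<in> {-1<..<1} \<Longrightarrow> (Z has_real_derivative W x / (1 - x\<^sup>2)) (at x)"
    and Z: "\<And>x. x \<in> {-1..1} \<Longrightarrow> \<bar>Z x\<bar> \<le> M" for W Z y0
  proof
    assume "W y0 > 0"
    then obtain d where d: "d > 0" "\<And>x. x \<in> {-1..1} \<Longrightarrow> dist x y0 < d \<Longrightarrow> dist (W x) (W y0) < W y0 / 2"
      using W[unfolded continuous_on_iff, rule_format, of y0 "W y0 / 2"] y0 by auto
    define r where "r = min d (1/2)"
    show False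
    proof (rule no_logarithmic_end[of r "W y0 / 2" Z W M])
      fix x assume x: "x \<in> {-1<..<-1 + r}"
      then have "dist (W x) (W y0) < W y0 / 2" using y0 by (intro d) (auto simp: r_def dist_real_def)
      then show "W y0 / 2 \<le> W x" by (simp add: dist_real_def abs_if split: if_splits)
    qed (use D Z d \<open>W y0 > 0\<close> in \<open>auto simp: r_def\<close>)
  qed
  have reflect: "continuous_on {-1..1} (\<lambda>x. f (- x))" if "continuous_on {-1..1} f" for f :: "real \<Rightarrow> real"
    by (intro continuous_on_compose2[OF that] continuous_intros) auto
  have derm: "((\<lambda>x. - V x) has_real_derivative - q x / (1 - x\<^sup>2)) (at x)" if "x \<in> {-1<..<1}" for x
    using DERIV_minus[OF der[OF that]] by simp
  have derr: "((\<lambda>x. V (- x)) has_real_derivative - q (- x) / (1 - x\<^sup>2)) (at x)" if "x \<in> {-1<..<1}" for x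
    using DERIV_chain2[OF der[of "- x"] DERIV_minus[OF DERIV_ident], where s = UNIV] that by simp
  have derrm: "((\<lambda>x. - V (- x)) has_real_derivative q (- x) / (1 - x\<^sup>2)) (at x)" if "x \<in> {-1<..<1}" for x
    using DERIV_minus[OF derr[OF that]] by simp
  have "\<not> q (-1) > 0"
    by (rule left[OF q refl der]) (use M in auto)
  moreover have "\<not> - q (-1) > 0"
    by (rule left[of "\<lambda>x. - q x", OF continuous_on_minus[OF q] refl derm]) (use M in auto)
  moreover have "\<not> - q (- (- 1)) > 0"
    by (rule left[of "\<lambda>x. - q (- x)", OF continuous_on_minus[OF reflect[OF q]] refl derr]) (use M in auto)
  moreover have "\<not> q (- (- 1)) > 0"
    by (rule left[of "\<lambda>x. q (- x)", OF reflect[OF q] refl derrm]) (use M in auto)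
  moreover have "q (-1) = C"
  proof -
    have "AE y in lborel. R y * indicator {-1} y = 0"
      using AE_lborel_singleton[of "-1::real"] by eventually_elim simp
    then have "(LBINT y. R y * indicator {-1..-1} y) = 0"
      by (intro integral_eq_zero_AE) simp
    then show ?thesis by (simp only: q_def)
  qed
  ultimately show ?thesis
    using V R der by (auto simp: flux_form_def q_def)
qed

text \<open>Retains from the differential equation only the identity of
  \<open>weak_equation_product\<close>. Both functions are total with a common bound, so that
  integrals over the whole line or plane need no domain conditions.\<close>

locale weak_solution =
  fixes u F :: "real \<Rightarrow> real \<Rightarrow> real" and T M :: real
  assumes T_pos: "T > 0"
    and u_cont: "continuous_on UNIV (\<lambda>p. u (fst p) (snd p))"
    and u_bdd: "\<And>x t. \<bar>u x t\<bar> \<le> M"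
    and F_meas: "(\<lambda>p. F (fst p) (snd p)) \<in> borel_measurable borel"
    and F_bdd: "\<And>x t. \<bar>F x t\<bar> \<le> M"
    and weak: "\<And>a a' m m' b b'. a \<in> test_functions {-1<..<1} \<Longrightarrow> (\<And>x. (a has_real_derivative a' x) (at x)) \<Longrightarrow>
      m \<in> test_functions {-1<..<1} \<Longrightarrow> (\<And>x. (m has_real_derivative m' x) (at x)) \<Longrightarrow>
      (\<And>x. m x = (1 - x\<^sup>2) * a' x) \<Longrightarrow>
      b \<in> test_functions {0<..<T} \<Longrightarrow> (\<And>x. (b has_real_derivative b' x) (at x)) \<Longrightarrow>
      (LBINT p. u (fst p) (snd p) * (a (fst p) * b' (snd p)))
        + (LBINT p. u (fst p) (snd p) * (m' (fst p) * b (snd p)))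
      = (LBINT p. F (fst p) (snd p) * (a (fst p) * b (snd p)))"
begin

definition V :: "real \<Rightarrow> real \<Rightarrow> real \<Rightarrow> real" where
  "V t1 t2 x = (LBINT s. u x s * indicator {t1<..t2} s)"

definition J :: "real \<Rightarrow> real \<Rightarrow> real \<Rightarrow> real" where
  "J t1 t2 x = (LBINT s. F x s * indicator {t1<..t2} s)"

definition R :: "real \<Rightarrow> real \<Rightarrow> real \<Rightarrow> real" where
  "R t1 t2 x = u x t2 - u x t1 + J t1 t2 x"

lemma u_meas [measurable]: "(\<lambda>p. u (fst p) (snd p)) \<in> borel_measurable borel"
  by (rule borel_measurable_continuous_onI[OF u_cont])

lemma u_cont1: "continuous_on UNIV (u x)" and u_cont2: "continuous_on UNIV (\<lambda>x. u x t)"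
  using continuous_on_compose2[OF u_cont continuous_on_Pair[OF continuous_on_const continuous_on_id] subset_UNIV]
    continuous_on_compose2[OF u_cont continuous_on_Pair[OF continuous_on_id continuous_on_const] subset_UNIV]
  by auto

lemma u_meas1 [measurable]: "u x \<in> borel_measurable borel"
  and u_meas2 [measurable]: "(\<lambda>x. u x t) \<in> borel_measurable borel"
  using u_cont1 u_cont2 by (auto intro: borel_measurable_continuous_onI)

lemma F_meas' [measurable]: "(\<lambda>p. F (fst p) (snd p)) \<in> borel_measurable (borel \<Otimes>\<^sub>M borel)"
  using F_meas by (simp add: borel_prod)

lemma u_meas' [measurable]: "(\<lambda>p. u (fst p) (snd p)) \<in> borel_measurable (borel \<Otimes>\<^sub>M borel)"
  using u_meas by (simp add: borel_prod)

lemma F_meas1 [measurable]: "F x \<in> borel_measurable borel"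
  and F_meas2 [measurable]: "(\<lambda>x. F x t) \<in> borel_measurable borel"
  using measurable_compose[OF _ F_meas', of "\<lambda>t. (x, t)" borel]
    measurable_compose[OF _ F_meas', of "\<lambda>x. (x, t)" borel] by auto

lemma V_cont: "continuous_on UNIV (V t1 t2)"
  unfolding V_def
  by (rule continuous_LINT_param[where K = M])
     (auto simp: u_cont2 u_bdd intro: integrable_indicator_real)

lemma J_meas [measurable]: "J t1 t2 \<in> borel_measurable borel"
proof -
  have "(\<lambda>x. LBINT s. F x s * indicator {t1<..t2} s) \<in> borel_measurable borel"
    by (rule sigma_finite_measure.borel_measurable_lebesgue_integral)
       (auto simp: sigma_finite_lborel case_prod_beta')
  then show ?thesis by (simp add: J_def[abs_def])
qed

lemma J_bdd: "t1 \<le> t2 \<Longrightarrow> \<bar>J t1 t2 x\<bar> \<le> M * (t2 - t1)"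
  unfolding J_def by (rule LINT_indicator_le[OF F_meas1 F_bdd])

lemma R_meas [measurable]: "R t1 t2 \<in> borel_measurable borel"
  unfolding R_def[abs_def] by measurable

lemma R_bdd: "t1 \<le> t2 \<Longrightarrow> \<bar>R t1 t2 x\<bar> \<le> 2 * M + M * (t2 - t1)"
  using J_bdd[of t1 t2 x] u_bdd[of x t1] u_bdd[of x t2] unfolding R_def by linarith

text \<open>The function f(t), the integral of u(x,t) a(x), has the bounded weak derivative
  \<open>N\<close> in time. The lemma of du Bois-Reymond turns this into an exact increment, and
  Fubini carries the time integral inside.\<close>

lemma time_integrated:
  assumes a: "a \<in> test_functions {-1<..<1}" "\<And>x. (a has_real_derivative a' x) (at x)"
    and m: "m \<in> test_functions {-1<..<1}" "\<And>x. (m has_real_derivative m' x) (at x)"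
    and ma: "\<And>x. m x = (1 - x\<^sup>2) * a' x"
    and t: "0 \<le> t1" "t1 < t2" "t2 < T"
  shows "(LBINT x. R t1 t2 x * a x) = (LBINT x. V t1 t2 x * m' x)"
proof -
  note m't = test_function_deriv[OF m]
  note inta = test_function_integrable[OF a(1)] and intm = test_function_integrable[OF m't]
  note kernel_u = LINT_product_kernel[where K = M, OF u_meas u_bdd]
  note kernel_F = LINT_product_kernel[where K = M, OF F_meas F_bdd]
  note meas_am[measurable] = borel_measurable_integrable[OF inta] borel_measurable_integrable[OF intm]
  define f where "f = (\<lambda>t. LBINT x. u x t * a x)"
  define N1 where "N1 = (\<lambda>t. LBINT x. u x t * m' x)"
  define N2 where "N2 = (\<lambda>t. LBINT x. F x t * a x)"
  define N where "N = (\<lambda>t. N1 t - N2 t)"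
  have f: "continuous_on UNIV f"
    unfolding f_def by (rule continuous_LINT_param[where K = M]) (auto simp: u_cont1 u_bdd inta)
  have N1_bdd: "\<bar>N1 t\<bar> \<le> M * (LBINT x. \<bar>m' x\<bar>)" for t
    unfolding N1_def by (rule LINT_mult_bound[OF intm]) (auto simp: u_bdd)
  have N2_bdd: "\<bar>N2 t\<bar> \<le> M * (LBINT x. \<bar>a x\<bar>)" for t
    unfolding N2_def by (rule LINT_mult_bound[OF inta]) (auto simp: F_bdd)
  define K where "K = M * (LBINT x. \<bar>m' x\<bar>) + M * (LBINT x. \<bar>a x\<bar>)"
  have N_bdd: "\<bar>N t\<bar> \<le> K" for t
    using N1_bdd[of t] N2_bdd[of t] unfolding N_def K_def by linarith
  have [measurable]: "(\<lambda>p. u (snd p) (fst p)) \<in> borel_measurable (borel \<Otimes>\<^sub>M borel)"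
     "(\<lambda>p. F (snd p) (fst p)) \<in> borel_measurable (borel \<Otimes>\<^sub>M borel)"
    using measurable_compose[OF measurable_pair_swap' u_meas'] measurable_compose[OF measurable_pair_swap' F_meas']
    by (auto simp: case_prod_beta')
  have [measurable]: "N1 \<in> borel_measurable borel" "N2 \<in> borel_measurable borel"
    unfolding N1_def N2_def
    by (intro sigma_finite_measure.borel_measurable_lebesgue_integral;
        simp add: sigma_finite_lborel case_prod_beta')+
  have [measurable]: "N \<in> borel_measurable borel"
    unfolding N_def by measurable
  have diff: "(LBINT t. N t * r t) = (LBINT t. N1 t * r t) - (LBINT t. N2 t * r t)"
    if r: "integrable lborel r" for r
    using Bochner_Integration.integral_diff[OF integrable_bounded_mult[OF r, of N1, OF _ N1_bdd]
        integrable_bounded_mult[OF r, of N2, OF _ N2_bdd]]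
    by (simp add: N_def left_diff_distrib)
  have pos: "f t - f s = (LBINT r. N r * indicator {s<..t} r)" if "0 < s" "s < t" "t < T" for s t
  proof (rule du_Bois_Reymond[OF f _ _ _ that])
    fix b b' :: "real \<Rightarrow> real"
    assume b: "b \<in> test_functions {0<..<T}" "\<And>x. (b has_real_derivative b' x) (at x)"
    note intb = test_function_integrable[OF b(1)] test_function_integrable[OF test_function_deriv[OF b]]
    have "(LBINT t. f t * b' t) + (LBINT t. N1 t * b t) = (LBINT t. N2 t * b t)"
      using weak[OF a m ma b] kernel_u(1)[OF inta intb(2)] kernel_u(1)[OF intm intb(1)]
        kernel_F(1)[OF inta intb(1)]
      by (simp add: f_def N1_def N2_def)
    then show "(LBINT t. f t * b' t) = - (LBINT t. N t * b t)"
      using diff[OF intb(1)] by simp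
  qed (use N_bdd in auto)
  have "f t2 - f t1 = (LBINT r. N r * indicator {t1<..t2} r)"
  proof (cases "t1 = 0")
    case False
    then show ?thesis using pos[of t1 t2] t by simp
  next
    case True
    \<comment> \<open>The lemma of du Bois-Reymond reaches only times inside (0, T); the initial
      time is approached from the right, using continuity of \<open>f\<close>.\<close>
    define s where "s = (\<lambda>n. t2 / real (n + 2))"
    have s: "0 < s n" "s n < t2" for n
    proof -
      show "0 < s n" using t True by (simp add: s_def)
      have "s n < t2 / 1"
        unfolding s_def using t True by (intro divide_strict_left_mono) auto
      then show "s n < t2" by simp
    qed
    have slim: "s \<longlonglongrightarrow> 0"
      unfolding s_def by (rule LIMSEQ_ignore_initial_segment[OF lim_const_over_n])
    have "(\<lambda>n. f (s n)) \<longlonglongrightarrow> f 0"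
      using continuous_on_tendsto_compose[OF f slim] by simp
    then have "(\<lambda>n. f t2 - f (s n)) \<longlonglongrightarrow> f t2 - f 0"
      by (intro tendsto_diff tendsto_const)
    moreover have "(\<lambda>n. LBINT r. N r * indicator {s n<..t2} r) \<longlonglongrightarrow> (LBINT r. N r * indicator {0<..t2} r)"
    proof (rule integral_dominated_convergence[where w = "\<lambda>r. K * indicator {0<..t2} r"])
      show "integrable lborel (\<lambda>r. K * indicator {0<..t2} r)"
        by (intro integrable_mult_right integrable_indicator_real) auto
      show "AE r in lborel. norm (N r * indicator {s n<..t2} r) \<le> K * indicator {0<..t2} r" for n
        using N_bdd s(1)[of n] abs_ge_zero[THEN order_trans, OF N_bdd]
        by (auto simp: indicator_def)
      show "AE r in lborel. (\<lambda>n. N r * indicator {s n<..t2} r) \<longlonglongrightarrow> N r * indicator {0<..t2} r"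
      proof (rule AE_I2)
        fix r
        have "eventually (\<lambda>n. indicator {s n<..t2} r = (indicator {0<..t2} r :: real)) sequentially"
        proof (cases "r > 0")
          case True
          then show ?thesis using order_tendstoD(2)[OF slim, of r]
            by (auto elim!: eventually_mono simp: indicator_def)
        next
          case False
          then have "\<not> s n < r" for n using s(1)[of n] by linarith
          then show ?thesis using False by (auto simp: indicator_def)
        qed
        then show "(\<lambda>n. N r * indicator {s n<..t2} r) \<longlonglongrightarrow> N r * indicator {0<..t2} r"
          by (intro tendsto_mult_left tendsto_eventually)
      qed
    qed auto
    moreover have "f t2 - f (s n) = (LBINT r. N r * indicator {s n<..t2} r)" for n
      using pos[OF s t(3)] .
    ultimately show ?thesis using True LIMSEQ_unique by (metis (no_types, lifting) ext)
  qed
  also have "\<dots> = (LBINT x. V t1 t2 x * m' x) - (LBINT x. J t1 t2 x * a x)"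
  proof -
    have I: "integrable lborel (indicator {t1<..t2} :: real \<Rightarrow> real)"
      by (rule integrable_indicator_real) auto
    show ?thesis
      using diff[OF I] kernel_u[OF intm I] kernel_F[OF inta I]
      by (simp add: N1_def N2_def V_def J_def)
  qed
  finally have eq: "f t2 - f t1 + (LBINT x. J t1 t2 x * a x) = (LBINT x. V t1 t2 x * m' x)"
    by simp
  have "(LBINT x. R t1 t2 x * a x)
      = (LBINT x. u x t2 * a x - u x t1 * a x + J t1 t2 x * a x)"
    by (simp add: R_def algebra_simps)
  also have "\<dots> = (f t2 - f t1) + (LBINT x. J t1 t2 x * a x)"
  proof -
    have i: "integrable lborel (\<lambda>x. u x s * a x)" for s
      by (rule integrable_bounded_mult[OF inta _ u_bdd]) simp
    have "integrable lborel (\<lambda>x. J t1 t2 x * a x)"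
      by (rule integrable_bounded_mult[OF inta]) (use J_bdd[of t1 t2] t in auto)
    then show ?thesis
      unfolding f_def
      using Bochner_Integration.integral_add[OF Bochner_Integration.integrable_diff[OF i i]]
        Bochner_Integration.integral_diff[OF i i] by simp
  qed
  finally show ?thesis using eq by simp
qed

end

section \<open>From the tested equation to the flux form\<close>

lemma Ck_on_ident: "Ck_on k (\<lambda>x::real. x) UNIV"
  by (cases k) (auto intro!: Ck_on_realI[where f' = "\<lambda>_. 1"] Ck_on_const simp del: Ck_on.simps(2))

lemma test_function_mult:
  assumes p: "\<And>k. Ck_on k p UNIV" and n: "n \<in> test_functions \<Omega>"
  shows "(\<lambda>x. p x * n x) \<in> test_functions \<Omega>"
proof (rule test_functionsI[where K = "closure {x. n x \<noteq> 0}"])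
  show "Ck_on k (\<lambda>x. p x * n x) UNIV" for k
    using n by (intro Ck_on_mult p open_UNIV) (auto simp: test_functions_def)
  show "p x * n x = 0" if "x \<notin> closure {x. n x \<noteq> 0}" for x
    using that closure_subset[of "{x. n x \<noteq> 0}"] by auto
qed (use n in \<open>auto simp: test_functions_def\<close>)

lemma test_function_add_scaled:
  assumes m: "m \<in> test_functions \<Omega>" and n: "n \<in> test_functions \<Omega>"
  shows "(\<lambda>x. m x + c * n x) \<in> test_functions \<Omega>"
proof (rule test_functionsI[where K = "closure {x. m x \<noteq> 0} \<union> closure {x. n x \<noteq> 0}"])
  show "Ck_on k (\<lambda>x. m x + c * n x) UNIV" for k
    using m n by (intro Ck_on_add Ck_on_mult Ck_on_const open_UNIV) (auto simp: test_functions_def)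
  show "m x + c * n x = 0" if "x \<notin> closure {x. m x \<noteq> 0} \<union> closure {x. n x \<noteq> 0}" for x
  proof -
    have "m x = 0" "n x = 0"
      using that closure_subset[of "{x. m x \<noteq> 0}"] closure_subset[of "{x. n x \<noteq> 0}"] by blast+
    then show ?thesis by simp
  qed
qed (use m n in \<open>auto simp: test_functions_def\<close>)

lemma unit_test_function:
  obtains n n' :: "real \<Rightarrow> real"
  where "n \<in> test_functions {-1<..<1}" "\<And>x. (n has_real_derivative n' x) (at x)" "(LBINT x. n x) = 1"
proof -
  \<comment> \<open>The factor 2 shrinks the support to \<open>{0..1/2}\<close>, a compact part of
    (-1, 1), and preserves the integral.\<close>
  define n where "n = (\<lambda>x. 2 * dstep (2 * x + 0))"
  have Ck: "Ck_on k dstep UNIV" for k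
    using step_Ck[of "Suc k"] by (simp add: dstep_def[abs_def])
  then have Ckn: "Ck_on k n UNIV" for k
    unfolding n_def
    by (intro Ck_on_mult Ck_on_const Ck_on_affine_compose bounded_linear_mult_right open_UNIV)
  have "n \<in> test_functions {-1<..<1}"
    by (rule test_functionsI[where K = "{0..1/2}"]) (use Ckn in \<open>auto simp: n_def dstep_eq_0\<close>)
  moreover have "(LBINT x. n x) = 1"
    using lborel_integral_real_affine[of 2 dstep 0] dstep_integral by (simp add: n_def)
  ultimately show ?thesis
    using that[of n "\<lambda>x. frechet_derivative n (at x) 1"] Ck_on_has_real_derivative[OF Ckn[of "Suc 0"]]
    by simp
qed

lemma has_derivative_from_LINT:
  fixes f N :: "real \<Rightarrow> real"
  assumes N: "continuous_on {\<alpha><..<\<beta>} N"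
    and f: "\<And>c d. \<alpha> < c \<Longrightarrow> c < d \<Longrightarrow> d < \<beta> \<Longrightarrow> f d - f c = (LBINT x. N x * indicator {c<..d} x)"
    and x: "\<alpha> < x" "x < \<beta>"
  shows "(f has_real_derivative N x) (at x)"
proof -
  define c where "c = (\<alpha> + x) / 2"
  define d where "d = (x + \<beta>) / 2"
  have cd: "\<alpha> < c" "c < x" "x < d" "d < \<beta>" using x by (auto simp: c_def d_def)
  have cN: "continuous_on {c..d} N" by (rule continuous_on_subset[OF N]) (use cd in auto)
  have eq: "f c + integral {c..y} N = f y" if "y \<in> {c<..<d}" for y
  proof -
    have y: "c < y" "y < d" using that by auto
    have "AE z in lborel. N z * indicator {c<..y} z = indicator {c..y} z *\<^sub>R N z"
      using AE_lborel_singleton[of c] by eventually_elim (auto simp: indicator_def)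
    moreover have s: "set_integrable lborel {c..y} N"
      unfolding set_integrable_def
      by (rule borel_integrable_compact) (use y in \<open>auto intro: continuous_on_subset[OF cN]\<close>)
    moreover have "(\<lambda>z. N z * indicator {c<..y} z) \<in> borel_measurable borel"
    proof -
      have "(\<lambda>z. (indicator {c..y} z *\<^sub>R N z) * indicator {c<..y} z) \<in> borel_measurable borel"
        using s by (intro borel_measurable_times) (auto simp: set_integrable_def dest: borel_measurable_integrable)
      also have "(\<lambda>z. (indicator {c..y} z *\<^sub>R N z) * indicator {c<..y} z) = (\<lambda>z. N z * indicator {c<..y} z)"
        by (auto simp: indicator_def)
      finally show ?thesis .
    qed
    ultimately have "(LBINT x. N x * indicator {c<..y} x) = (LINT x:{c..y}|lborel. N x)"
      unfolding set_lebesgue_integral_def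
      by (intro integral_cong_AE) (auto simp: set_integrable_def dest: borel_measurable_integrable)
    also have "\<dots> = integral {c..y} N" by (rule set_borel_integral_eq_integral[OF s])
    finally show ?thesis using f[of c y] cd y by simp
  qed
  have "((\<lambda>y. integral {c..y} N) has_real_derivative N x) (at x within {c..d})"
    by (rule integral_has_real_derivative[OF cN]) (use cd in auto)
  then have "((\<lambda>y. f c + integral {c..y} N) has_real_derivative N x) (at x)"
    using at_within_interior[of x "{c..d}"] cd by (auto intro!: derivative_eq_intros)
  then show ?thesis
    by (rule has_field_derivative_transform_within_open[where S = "{c<..<d}"]) (use eq cd in auto)
qed

context weak_solution
begin

theorem flux_form_V:
  \<comment> \<open>Testing with the antiderivative of \<open>n\<close> is possible only if
    \<open>n\<close> has mean zero, so the flux (1 - x^2) V' is determined only up to a constant C.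
    The constant is then disposed of by \<open>flux_formI\<close>.\<close>
  assumes t: "0 \<le> t1" "t1 < t2" "t2 < T"
  shows "flux_form (V t1 t2) (R t1 t2)"
proof -
  let ?V = "V t1 t2"
  define K where "K = 2 * M + M * (t2 - t1)"
  have R_K: "\<bar>R t1 t2 x\<bar> \<le> K" for x using R_bdd[of t1 t2 x] t by (simp add: K_def)
  have V_bdd: "\<bar>?V x\<bar> \<le> M * (t2 - t1)" for x
    unfolding V_def by (rule LINT_indicator_le[OF u_meas1 u_bdd]) (use t in simp)
  have [measurable]: "?V \<in> borel_measurable borel" by (rule borel_measurable_continuous_onI[OF V_cont])
  define Rc where "Rc = (\<lambda>x. R t1 t2 x * indicator {-1..1} x)"
  have Rc_int: "integrable lborel Rc"
    unfolding Rc_def by (rule integrable_bounded_mult[OF integrable_indicator_real _ R_K]) auto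
  note [measurable] = borel_measurable_integrable[OF Rc_int]
  define I where "I = (LBINT x. Rc x)"
  define S where "S = (\<lambda>z. LBINT x. indicator {..z} x * Rc x)"
  have S_eq: "S z = (LBINT x. R t1 t2 x * indicator {-1..z} x)" if "z \<in> {-1..1}" for z
    unfolding S_def Rc_def
    by (rule Bochner_Integration.integral_cong[OF refl]) (use that in \<open>auto simp: indicator_def\<close>)
  then have S_cont: "continuous_on {-1..1} S"
    using continuous_on_subset[OF continuous_on_LINT_indicator[OF R_meas R_K, of "-1"], of "{-1..1}"]
    by (auto intro: continuous_on_eq)
  have S_bdd: "\<bar>S z\<bar> \<le> 1 * (LBINT x. \<bar>Rc x\<bar>)" for z
    unfolding S_def by (rule LINT_mult_bound[OF Rc_int]) (auto simp: indicator_def)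
  have S_meas [measurable]: "S \<in> borel_measurable borel"
  proof -
    have *: "{p :: real \<times> real. snd p \<le> fst p} \<in> sets (borel \<Otimes>\<^sub>M borel)"
      unfolding borel_prod by (intro borel_closed closed_Collect_le continuous_intros)
    have "(\<lambda>p. indicator {..fst p} (snd p) :: real) = indicator {p :: real \<times> real. snd p \<le> fst p}"
      by (auto simp: indicator_def)
    then have [measurable]: "(\<lambda>p::real\<times>real. indicator {..fst p} (snd p) :: real) \<in> borel_measurable (borel \<Otimes>\<^sub>M borel)"
      using borel_measurable_indicator[OF *] by simp
    show ?thesis unfolding S_def
      by (rule sigma_finite_measure.borel_measurable_lebesgue_integral)
         (auto simp: sigma_finite_lborel case_prod_beta')
  qed
  \<comment> \<open>Integration by parts via Fubini on {z < x}. The inner integral over x is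
    \<open>I - S z\<close>, and the constant \<open>I\<close> drops out because \<open>n\<close> has
    mean zero.\<close>
  have by_parts: "(LBINT x. R t1 t2 x * (LBINT z. n z * indicator {..x} z)) = - (LBINT z. S z * n z)"
    if n: "n \<in> test_functions {-1<..<1}" and n0: "(LBINT z. n z) = 0" for n
  proof -
    note intn = test_function_integrable[OF n]
    define a where "a = (\<lambda>x. LBINT z. n z * indicator {..x} z)"
    have a: "a \<in> test_functions {-1<..<1}"
      unfolding a_def by (rule test_function_antiderivative(2)[OF n _ n0]) simp
    have k: "indicator {p :: real \<times> real. snd p < fst p} \<in> borel_measurable (borel :: (real \<times> real) measure)"
      by (intro borel_measurable_indicator borel_open open_Collect_less continuous_intros)
    have G: "(LBINT x. indicator {p :: real \<times> real. snd p < fst p} (x, z) * Rc x) = I - S z" for z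
    proof -
      have 1: "integrable lborel (\<lambda>x. indicator {..z} x * Rc x)"
        by (rule integrable_bounded_mult[OF Rc_int, where K = 1]) (auto simp: indicator_def)
      have "indicator {p. snd p < fst p} (x, z) * Rc x = Rc x - indicator {..z} x * Rc x" for x
        by (auto simp: indicator_def)
      then show ?thesis
        using Bochner_Integration.integral_diff[OF Rc_int 1] by (simp add: I_def S_def)
    qed
    have A: "(LBINT z. indicator {p :: real \<times> real. snd p < fst p} (x, z) * n z) = a x" for x
      unfolding a_def
    proof (rule integral_cong_AE)
      show "AE z in lborel. indicator {p. snd p < fst p} (x, z) * n z = n z * indicator {..x} z"
        using AE_lborel_singleton[of x] by eventually_elim (auto simp: indicator_def)
      have "indicator {p :: real \<times> real. snd p < fst p} (x, z) = (indicator {..<x} z :: real)" for z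
        by (auto simp: indicator_def)
      then show "(\<lambda>z. indicator {p :: real \<times> real. snd p < fst p} (x, z) * n z) \<in> borel_measurable lborel"
        using borel_measurable_integrable[OF intn] by simp
    qed (use borel_measurable_integrable[OF intn] in simp)
    have "R t1 t2 x * a x = a x * Rc x" for x
      using test_function_vanish[OF a, of x]
      by (cases "x \<in> {-1<..<1}") (auto simp: Rc_def indicator_def)
    then have "(LBINT x. R t1 t2 x * a x) = (LBINT x. a x * Rc x)"
      by (intro Bochner_Integration.integral_cong[OF refl])
    also have "\<dots> = (LBINT z. (I - S z) * n z)"
      using LINT_product_kernel[OF k, of 1, OF _ Rc_int intn] by (simp add: A G)
    also have "\<dots> = (LBINT z. I * n z - S z * n z)"
      by (simp add: left_diff_distrib)
    also have "\<dots> = (LBINT z. I * n z) - (LBINT z. S z * n z)"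
      by (rule Bochner_Integration.integral_diff)
         (use intn integrable_bounded_mult[OF intn _ S_bdd] in auto)
    finally show ?thesis using n0 by (simp add: a_def)
  qed
  have Ckw: "Ck_on k (\<lambda>x::real. 1 + (-1) * (x * x)) UNIV" for k
    by (intro Ck_on_add Ck_on_mult Ck_on_const Ck_on_ident open_UNIV)
  \<comment> \<open>This is the integral of V ((1 - x^2) n)'. Thus A + B is the weak form of S - (1
    - x^2) V', tested with n.\<close>
  define A where "A = (\<lambda>n n'. (LBINT x. ?V x * ((1 + (-1) * (x * x)) * n' x)) - (LBINT x. ?V x * (2 * x * n x)))"
  define B where "B = (\<lambda>n. LBINT z. S z * n z)"
  have Ck2: "Ck_on k (\<lambda>x::real. 2 * x) UNIV" for k
    by (intro Ck_on_mult Ck_on_const Ck_on_ident open_UNIV)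
  note int_w = test_function_integrable[OF test_function_mult[OF Ckw]]
  note int_2 = test_function_integrable[OF test_function_mult[OF Ck2]]
  have intV: "integrable lborel (\<lambda>x. ?V x * q x)" "integrable lborel (\<lambda>x. c * (?V x * q x))"
    if "integrable lborel q" for q c
    using integrable_bounded_mult[OF that _ V_bdd] by auto
  have intS: "integrable lborel (\<lambda>x. S x * q x)" "integrable lborel (\<lambda>x. c * (S x * q x))"
    if "integrable lborel q" for q c
    using integrable_bounded_mult[OF that _ S_bdd] by auto
  have AB0: "A n n' + B n = 0"
    if n: "n \<in> test_functions {-1<..<1}" "\<And>x. (n has_real_derivative n' x) (at x)"
      and n0: "(LBINT z. n z) = 0" for n n'
  proof -
    define m where "m = (\<lambda>x. (1 + (-1) * (x * x)) * n x)"
    define m' where "m' = (\<lambda>x. (1 + (-1) * (x * x)) * n' x - 2 * x * n x)"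
    have n't: "n' \<in> test_functions {-1<..<1}" by (rule test_function_deriv[OF n])
    have "(LBINT x. R t1 t2 x * (LBINT z. n z * indicator {..x} z)) = (LBINT x. ?V x * m' x)"
    proof (rule time_integrated[OF _ _ _ _ _ t])
      show "m \<in> test_functions {-1<..<1}"
        unfolding m_def by (rule test_function_mult[OF Ckw n(1)])
      show "(m has_real_derivative m' x) (at x)" for x
        unfolding m_def m'_def by (auto intro!: derivative_eq_intros n(2))
      show "m x = (1 - x\<^sup>2) * n x" for x
        by (simp add: m_def power2_eq_square)
    qed (rule test_function_antiderivative[OF n(1) _ n0]; simp)+
    also have "\<dots> = (LBINT x. ?V x * ((1 + (-1) * (x * x)) * n' x) - ?V x * (2 * x * n x))"
      by (simp add: m'_def right_diff_distrib)
    also have "\<dots> = A n n'"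
      unfolding A_def by (rule Bochner_Integration.integral_diff[OF intV(1)[OF int_w[OF n't]] intV(1)[OF int_2[OF n(1)]]])
    finally show ?thesis using by_parts[OF n(1) n0] by (simp add: B_def)
  qed
  obtain n0 n0' where n0: "n0 \<in> test_functions {-1<..<1}" "\<And>x. (n0 has_real_derivative n0' x) (at x)"
      "(LBINT x. n0 x) = 1"
    using unit_test_function by blast
  \<comment> \<open>For general n, subtracting its mean times \<open>n0\<close> gives a mean-zero
    test function; hence A + B equals C times the integral of n.\<close>
  define C where "C = A n0 n0' + B n0"
  have AB: "A n n' + B n = C * (LBINT x. n x)"
    if n: "n \<in> test_functions {-1<..<1}" "\<And>x. (n has_real_derivative n' x) (at x)" for n n'
  proof -
    define \<theta> where "\<theta> = - (LBINT x. n x)"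
    have n't: "n' \<in> test_functions {-1<..<1}" "n0' \<in> test_functions {-1<..<1}"
      using test_function_deriv n n0 by blast+
    have "A (\<lambda>x. n x + \<theta> * n0 x) (\<lambda>x. n' x + \<theta> * n0' x) + B (\<lambda>x. n x + \<theta> * n0 x) = 0"
    proof (rule AB0)
      show "(\<lambda>x. n x + \<theta> * n0 x) \<in> test_functions {-1<..<1}"
        by (rule test_function_add_scaled[OF n(1) n0(1)])
      show "((\<lambda>x. n x + \<theta> * n0 x) has_real_derivative n' x + \<theta> * n0' x) (at x)" for x
        by (auto intro!: derivative_eq_intros n n0)
      have "(LBINT z. n z + \<theta> * n0 z) = (LBINT z. n z) + (LBINT z. \<theta> * n0 z)"
        by (rule Bochner_Integration.integral_add)
           (use test_function_integrable[OF n(1)] test_function_integrable[OF n0(1)] in auto)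
      then show "(LBINT z. n z + \<theta> * n0 z) = 0"
        by (simp add: \<theta>_def n0)
    qed
    moreover have "(LBINT x. ?V x * ((1 + (-1) * (x * x)) * (n' x + \<theta> * n0' x)))
        = (LBINT x. ?V x * ((1 + (-1) * (x * x)) * n' x)) + \<theta> * (LBINT x. ?V x * ((1 + (-1) * (x * x)) * n0' x))"
    proof -
      have "(LBINT x. ?V x * ((1 + (-1) * (x * x)) * (n' x + \<theta> * n0' x)))
         = (LBINT x. ?V x * ((1 + (-1) * (x * x)) * n' x) + \<theta> * (?V x * ((1 + (-1) * (x * x)) * n0' x)))"
        by (rule Bochner_Integration.integral_cong[OF refl]) (simp only: distrib_left mult.left_commute)
      also have "\<dots> = (LBINT x. ?V x * ((1 + (-1) * (x * x)) * n' x))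
          + (LBINT x. \<theta> * (?V x * ((1 + (-1) * (x * x)) * n0' x)))"
        by (rule Bochner_Integration.integral_add[OF intV(1)[OF int_w[OF n't(1)]] intV(2)[OF int_w[OF n't(2)]]])
      finally show ?thesis by (simp only: integral_mult_right_zero)
    qed
    moreover have "(LBINT x. ?V x * (2 * x * (n x + \<theta> * n0 x)))
        = (LBINT x. ?V x * (2 * x * n x)) + \<theta> * (LBINT x. ?V x * (2 * x * n0 x))"
    proof -
      have "(LBINT x. ?V x * (2 * x * (n x + \<theta> * n0 x)))
         = (LBINT x. ?V x * (2 * x * n x) + \<theta> * (?V x * (2 * x * n0 x)))"
        by (rule Bochner_Integration.integral_cong[OF refl]) (simp only: distrib_left mult.left_commute)
      also have "\<dots> = (LBINT x. ?V x * (2 * x * n x)) + (LBINT x. \<theta> * (?V x * (2 * x * n0 x)))"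
        by (rule Bochner_Integration.integral_add[OF intV(1)[OF int_2[OF n(1)]] intV(2)[OF int_2[OF n0(1)]]])
      finally show ?thesis by (simp only: integral_mult_right_zero)
    qed
    moreover have "B (\<lambda>x. n x + \<theta> * n0 x) = B n + \<theta> * B n0"
    proof -
      have "B (\<lambda>x. n x + \<theta> * n0 x) = (LBINT z. S z * n z + \<theta> * (S z * n0 z))"
        unfolding B_def
        by (rule Bochner_Integration.integral_cong[OF refl]) (simp only: distrib_left mult.left_commute)
      also have "\<dots> = (LBINT z. S z * n z) + (LBINT z. \<theta> * (S z * n0 z))"
        by (rule Bochner_Integration.integral_add[OF intS(1)[OF test_function_integrable[OF n(1)]]
              intS(2)[OF test_function_integrable[OF n0(1)]]])
      finally show ?thesis by (simp only: integral_mult_right_zero B_def)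
    qed
    ultimately have "A n n' + B n + \<theta> * C = 0"
      unfolding A_def C_def by (simp add: algebra_simps)
    then show ?thesis by (simp add: \<theta>_def)
  qed
  \<comment> \<open>The lemma of du Bois-Reymond wants a bare n' under the integral, so the weight
    is attached to V; the term 2 x V in \<open>N\<close> compensates and cancels on division by 1 -
    x^2.\<close>
  define f where "f = (\<lambda>x. ?V x * (1 - x\<^sup>2))"
  define N where "N = (\<lambda>x. S x - C - 2 * x * ?V x)"
  have f_cont: "continuous_on UNIV f"
    unfolding f_def by (intro continuous_intros V_cont)
  have N_cont: "continuous_on {-1..1} N"
    unfolding N_def by (intro continuous_intros S_cont continuous_on_subset[OF V_cont]) auto
  have [measurable]: "N \<in> borel_measurable borel" unfolding N_def by measurable
  have "(f has_real_derivative N x) (at x)" if "x \<in> {-1<..<1}" for x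
  proof (rule has_derivative_from_LINT[of "-1" 1])
    show "continuous_on {-1<..<1} N" by (rule continuous_on_subset[OF N_cont]) auto
    fix c d :: real assume cd: "-1 < c" "c < d" "d < 1"
    show "f d - f c = (LBINT x. N x * indicator {c<..d} x)"
    proof (rule du_Bois_Reymond[OF f_cont _ _ _ cd])
      fix c d :: real assume "-1 < c" "d < 1"
      have "compact (N ` {c..d})"
        by (intro compact_continuous_image continuous_on_subset[OF N_cont]) (use \<open>-1 < c\<close> \<open>d < 1\<close> in auto)
      then show "\<exists>K. \<forall>x\<in>{c..d}. \<bar>N x\<bar> \<le> K"
        using compact_imp_bounded[of "N ` {c..d}"] unfolding bounded_iff real_norm_def by blast
    next
      fix b b' :: "real \<Rightarrow> real"
      assume b: "b \<in> test_functions {-1<..<1}" "\<And>x. (b has_real_derivative b' x) (at x)"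
      note b't = test_function_deriv[OF b]
      have "(LBINT x. N x * b x) = (LBINT x. S x * b x - C * b x - ?V x * (2 * x * b x))"
        by (rule Bochner_Integration.integral_cong[OF refl]) (simp add: N_def algebra_simps)
      also have "\<dots> = (LBINT x. S x * b x - C * b x) - (LBINT x. ?V x * (2 * x * b x))"
        using intS(1)[OF test_function_integrable[OF b(1)]] test_function_integrable[OF b(1)]
        by (intro Bochner_Integration.integral_diff Bochner_Integration.integrable_diff intV(1)[OF int_2[OF b(1)]]) auto
      also have "(LBINT x. S x * b x - C * b x) = B b - (LBINT x. C * b x)"
        unfolding B_def
        using intS(1)[OF test_function_integrable[OF b(1)]] test_function_integrable[OF b(1)]
        by (intro Bochner_Integration.integral_diff) auto
      finally have "(LBINT x. N x * b x)
          = B b - C * (LBINT x. b x) - (LBINT x. ?V x * (2 * x * b x))"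
        by simp
      moreover have "(LBINT x. f x * b' x) = (LBINT x. ?V x * ((1 + (-1) * (x * x)) * b' x))"
        by (rule Bochner_Integration.integral_cong[OF refl]) (simp add: f_def power2_eq_square)
      ultimately show "(LBINT x. f x * b' x) = - (LBINT x. N x * b x)"
        using AB[OF b] by (simp add: A_def)
    qed simp
  qed (use that in auto)
  then have der: "(?V has_real_derivative (- C + S x) / (1 - x\<^sup>2)) (at x)" if "x \<in> {-1<..<1}" for x
  proof -
    have pos: "1 - y\<^sup>2 \<noteq> 0" if "y \<in> {-1<..<1}" for y :: real
      using that by (auto simp: power2_eq_1_iff)
    have "((\<lambda>y. f y / (1 - y\<^sup>2)) has_real_derivative (N x * (1 - x\<^sup>2) - f x * (- (2 * x))) / ((1 - x\<^sup>2) * (1 - x\<^sup>2))) (at x)"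
      using that \<open>\<And>x. x \<in> {-1<..<1} \<Longrightarrow> (f has_real_derivative N x) (at x)\<close> pos
      by (auto intro!: derivative_eq_intros)
    moreover have "(N x * (1 - x\<^sup>2) - f x * (- (2 * x))) / ((1 - x\<^sup>2) * (1 - x\<^sup>2)) = (- C + S x) / (1 - x\<^sup>2)"
    proof -
      have "N x * (1 - x\<^sup>2) - f x * (- (2 * x)) = (- C + S x) * (1 - x\<^sup>2)"
        by (simp add: N_def f_def algebra_simps)
      then show ?thesis using pos[OF that] by simp
    qed
    ultimately have "((\<lambda>y. f y / (1 - y\<^sup>2)) has_real_derivative (- C + S x) / (1 - x\<^sup>2)) (at x)"
      by simp
    then show ?thesis
      by (rule has_field_derivative_transform_within_open[where S = "{-1<..<1}"])
         (use that pos in \<open>auto simp: f_def\<close>)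
  qed
  show ?thesis
  proof (rule flux_formI[OF _ R_meas R_K])
    show "continuous_on {-1..1} ?V" by (rule continuous_on_subset[OF V_cont]) auto
    show "(?V has_real_derivative (- C + (LBINT y. R t1 t2 y * indicator {-1..x} y)) / (1 - x\<^sup>2)) (at x)"
      if "x \<in> {-1<..<1}" for x
      using der[OF that] S_eq[of x] that by simp
  qed
qed

end

subsection \<open>Maximum principle and monotonicity in space\<close>

lemma LINT_indicator_ge:
  fixes R :: "real \<Rightarrow> real"
  assumes R: "R \<in> borel_measurable borel" "\<And>x. \<bar>R x\<bar> \<le> K" and "x \<le> y"
    and c: "AE z in lborel. z \<in> {x<..y} \<longrightarrow> c \<le> R z"
  shows "c * (y - x) \<le> (LBINT z. R z * indicator {x<..y} z)"
proof -
  have I: "integrable lborel (indicator {x<..y} :: real \<Rightarrow> real)"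
    by (rule integrable_indicator_real) auto
  have "(LBINT z. c * indicator {x<..y} z) \<le> (LBINT z. R z * indicator {x<..y} z)"
  proof (rule integral_mono_AE)
    show "integrable lborel (\<lambda>z. R z * indicator {x<..y} z)"
      by (rule integrable_bounded_mult[OF I _ R(2)]) (use R in simp)
    show "AE z in lborel. c * indicator {x<..y} z \<le> R z * indicator {x<..y} z"
      using c by eventually_elim (auto simp: indicator_def)
  qed (use I in simp)
  then show ?thesis using assms(3) by simp
qed

lemma flux_form_minus:
  assumes V: "flux_form V R" and V': "flux_form V' R'"
  shows "flux_form (\<lambda>x. V x - V' x) (\<lambda>x. R x - R' x)"
proof -
  obtain K K' where K: "\<And>x. \<bar>R x\<bar> \<le> K" "\<And>x. \<bar>R' x\<bar> \<le> K'"
    using V V' unfolding flux_form_def by blast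
  have [measurable]: "R \<in> borel_measurable borel" "R' \<in> borel_measurable borel"
    using V V' by (auto simp: flux_form_def)
  have *: "(LBINT y. (R y - R' y) * indicator {-1..x} y)
      = (LBINT y. R y * indicator {-1..x} y) - (LBINT y. R' y * indicator {-1..x} y)" for x
  proof -
    have i: "integrable lborel (indicator {-1..x} :: real \<Rightarrow> real)"
      by (rule integrable_indicator_real) auto
    show ?thesis
      using Bochner_Integration.integral_diff[OF integrable_bounded_mult[OF i _ K(1)] integrable_bounded_mult[OF i _ K(2)]]
      by (simp add: left_diff_distrib)
  qed
  have "\<bar>R x - R' x\<bar> \<le> K + K'" for x using K[of x] by linarith
  then have "\<exists>K. \<forall>x. \<bar>R x - R' x\<bar> \<le> K" by blast
  then show ?thesis
    using V V' by (auto simp: flux_form_def * diff_divide_distrib intro!: continuous_intros DERIV_diff)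
qed

lemma flux_form_zero: "flux_form (\<lambda>x. 0) (\<lambda>x. 0)"
  by (auto simp: flux_form_def)

text \<open>The flux S vanishes at an interior maximum because V' does, and at the ends by
  \<open>flux_form\<close>. Since S increases at rate at least c near y0, V increases strictly to
  the right of y0; at y0 = 1 one looks to the left, where S < 0.\<close>

lemma flux_form_no_local_max:
  assumes V: "flux_form V R" and y0: "y0 \<in> {-1..1}" and r: "r > 0" and c: "c > 0"
    and max: "\<And>y. y \<in> {-1..1} \<Longrightarrow> \<bar>y - y0\<bar> < r \<Longrightarrow> V y \<le> V y0"
    and R: "AE y in lborel. y \<in> {-1..1} \<longrightarrow> \<bar>y - y0\<bar> < r \<longrightarrow> c \<le> R y"
  shows False
proof -
  define S where "S = (\<lambda>x. LBINT y. R y * indicator {-1..x} y)"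
  obtain K where K: "\<And>x. \<bar>R x\<bar> \<le> K" using V unfolding flux_form_def by blast
  have m: "R \<in> borel_measurable borel" and cont: "continuous_on {-1..1} V" and S1: "S 1 = 0"
    and der: "\<And>x. x \<in> {-1<..<1} \<Longrightarrow> (V has_real_derivative S x / (1 - x\<^sup>2)) (at x)"
    using V by (auto simp: flux_form_def S_def)
  have w: "1 - x\<^sup>2 > 0" if "x \<in> {-1<..<1}" for x :: real
    using that by (simp add: abs_square_less_1 abs_less_iff)
  have inc: "S x + c * (y - x) \<le> S y" if "-1 \<le> x" "x \<le> y" "y \<le> 1" "\<bar>x - y0\<bar> < r" "\<bar>y - y0\<bar> < r" for x y
  proof -
    have "AE z in lborel. z \<in> {x<..y} \<longrightarrow> c \<le> R z"
      using R by eventually_elim (use that in auto)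
    then show ?thesis
      using LINT_indicator_ge[OF m K that(2), of c] LINT_indicator_diff[OF m K that(1,2)]
      unfolding S_def by linarith
  qed
  show False
  proof (cases "y0 < 1")
    case True
    define x1 where "x1 = min ((y0 + 1) / 2) (y0 + r / 2)"
    have x1: "y0 < x1" "x1 < 1" "x1 - y0 < r" using True r by (auto simp: x1_def min_def)
    have "S y0 \<ge> 0"
    proof (cases "y0 = -1")
      case True
      have "AE y in lborel. R y * indicator {-1} y = 0"
        using AE_lborel_singleton[of "-1::real"] by eventually_elim simp
      then have "(LBINT y. R y * indicator {-1..-1} y) = 0"
        by (intro integral_eq_zero_AE) simp
      then show ?thesis using True by (simp only: S_def)
    next
      case False
      then have y: "y0 \<in> {-1<..<1}" using y0 True by auto
      have "S y0 / (1 - y0\<^sup>2) = 0"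
      proof (rule DERIV_local_max[OF der[OF y]])
        show "0 < min r (min (y0 + 1) (1 - y0))" using r y by auto
        show "\<forall>z. \<bar>y0 - z\<bar> < min r (min (y0 + 1) (1 - y0)) \<longrightarrow> V z \<le> V y0"
          by (auto intro!: max)
      qed
      then show ?thesis using w[OF y] by simp
    qed
    then have "S x > 0" if "y0 < x" "x < x1" for x
    proof -
      have "0 < c * (x - y0)" using that c by simp
      moreover have "S y0 + c * (x - y0) \<le> S x" by (rule inc) (use that x1 y0 r in auto)
      ultimately show ?thesis using \<open>S y0 \<ge> 0\<close> by linarith
    qed
    then have "V y0 < V x1"
      using x1 y0 w
      by (intro DERIV_pos_imp_increasing_open[OF x1(1)] continuous_on_subset[OF cont])
         (auto intro!: exI[of _ "S _ / _"] der)
    then show False using max[of x1] x1 y0 by auto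
  next
    case False
    then have [simp]: "y0 = 1" using y0 by auto
    define x1 where "x1 = max 0 (1 - r / 2)"
    have x1: "0 \<le> x1" "x1 < 1" "1 - x1 < r" using r by (auto simp: x1_def max_def)
    have "S x < 0" if "x1 < x" "x < 1" for x
    proof -
      have "0 < c * (1 - x)" using that c by simp
      moreover have "S x + c * (1 - x) \<le> S 1" by (rule inc) (use that x1 r in auto)
      ultimately show ?thesis using S1 by linarith
    qed
    then have "V 1 < V x1"
      using x1 w
      by (intro DERIV_neg_imp_decreasing_open[OF x1(2)] continuous_on_subset[OF cont])
         (auto intro!: exI[of _ "S _ / _"] der divide_neg_pos)
    then show False using max[of x1] x1 by auto
  qed
qed

text \<open>R is controlled only almost everywhere and has no meaningful value at the single point
  y0; a continuous minorant does.\<close>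

lemma flux_form_local_max:
  assumes V: "flux_form V R" and y0: "y0 \<in> {-1..1}" and r: "r > 0"
    and max: "\<And>y. y \<in> {-1..1} \<Longrightarrow> \<bar>y - y0\<bar> < r \<Longrightarrow> V y \<le> V y0"
    and G: "continuous_on UNIV G"
    and R: "AE y in lborel. y \<in> {-1..1} \<longrightarrow> \<bar>y - y0\<bar> < r \<longrightarrow> G y \<le> R y"
  shows "G y0 \<le> 0"
proof (rule ccontr)
  assume "\<not> G y0 \<le> 0"
  then have pos: "G y0 / 2 > 0" by simp
  then obtain d where d: "d > 0" "\<And>y. dist y y0 < d \<Longrightarrow> dist (G y) (G y0) < G y0 / 2"
    using G unfolding continuous_on_iff by (metis UNIV_I)
  show False
  proof (rule flux_form_no_local_max[OF V y0, of "min r d" "G y0 / 2"])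
    show "AE y in lborel. y \<in> {-1..1} \<longrightarrow> \<bar>y - y0\<bar> < min r d \<longrightarrow> G y0 / 2 \<le> R y"
      using R
    proof eventually_elim
      case (elim y)
      show ?case
      proof (intro impI)
        assume y: "y \<in> {-1..1}" "\<bar>y - y0\<bar> < min r d"
        then have "dist (G y) (G y0) < G y0 / 2" by (intro d) (simp add: dist_real_def)
        then have "G y0 / 2 \<le> G y" unfolding dist_real_def by linarith
        then show "G y0 / 2 \<le> R y" using elim y by auto
      qed
    qed
  qed (use r d pos max in auto)
qed

text \<open>The barrier for \<open>zero_persists\<close>. Its right-hand side is the derivative of 2
  c (1 - x^2) (x - z); the indicator makes it bounded on the whole line.\<close>

lemma flux_form_parabola:
  fixes c z :: real
  shows "flux_form (\<lambda>x. c * (x - z)\<^sup>2) (\<lambda>x. c * (2 * (1 - x\<^sup>2) - 4 * x * (x - z)) * indicator {-1..1} x)"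
proof -
  let ?r = "\<lambda>x. c * (2 * (1 - x\<^sup>2) - 4 * x * (x - z))"
  have cont: "continuous_on A ?r" for A by (intro continuous_intros)
  have der: "((\<lambda>x. (1 - x\<^sup>2) * (c * (2 * (x - z)))) has_real_derivative ?r x) (at x)" for x
    by (auto intro!: derivative_eq_intros simp: algebra_simps power2_eq_square)
  have int: "(LBINT y. ?r y * indicator {-1..1} y * indicator {-1..x} y) = (1 - x\<^sup>2) * (c * (2 * (x - z)))"
    if "x \<in> {-1..1}" for x
  proof -
    have "(LBINT y. ?r y * indicator {-1..x} y)
        = (1 - x\<^sup>2) * (c * (2 * (x - z))) - (1 - (-1)\<^sup>2) * (c * (2 * (-1 - z)))"
      by (rule integral_FTC_Icc_real) (use that der cont[of UNIV] in \<open>auto simp: continuous_on_eq_continuous_at\<close>)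
    moreover have "(\<lambda>y. ?r y * indicator {-1..1} y * indicator {-1..x} y) = (\<lambda>y. ?r y * indicator {-1..x} y)"
      using that by (auto simp: indicator_def)
    ultimately show ?thesis by simp
  qed
  have "bounded (?r ` {-1..1})"
    by (intro compact_imp_bounded compact_continuous_image cont) simp
  then obtain K where K: "\<And>x. x \<in> {-1..1} \<Longrightarrow> \<bar>?r x\<bar> \<le> K"
    unfolding bounded_iff real_norm_def by blast
  have "\<bar>?r x * indicator {-1..1} x\<bar> \<le> max K 0" for x
    using K[of x] by (auto simp: indicator_def)
  then have "\<exists>K. \<forall>x. \<bar>?r x * indicator {-1..1} x\<bar> \<le> K" by blast
  moreover have "?r \<in> borel_measurable borel" by (rule borel_measurable_continuous_onI[OF cont])
  moreover have "((\<lambda>x. c * (x - z)\<^sup>2) has_real_derivative ((1 - x\<^sup>2) * (c * (2 * (x - z)))) / (1 - x\<^sup>2)) (at x)"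
    if "x \<in> {-1<..<1}" for x
  proof -
    have "1 - x\<^sup>2 \<noteq> 0" using that by (auto simp: power2_eq_1_iff)
    then show ?thesis by (auto intro!: derivative_eq_intros)
  qed
  moreover have "(LBINT y. ?r y * indicator {-1..1} y * indicator {-1..1} y) = 0"
    using int[of 1] by simp
  moreover have "(\<lambda>y. ?r y * indicator {-1..1} y * indicator {-1..1} y) = (\<lambda>y. ?r y * indicator {-1..1} y)"
    by (auto simp: indicator_def)
  ultimately show ?thesis
    unfolding flux_form_def using int by (auto intro!: continuous_intros)
qed

text \<open>One-sided, because the maximum over a time interval may be attained at its final
  time.\<close>

lemma left_max_deriv_nonneg:
  fixes f :: "real \<Rightarrow> real"
  assumes "(f has_real_derivative D) (at t)" "s < t" "\<And>r. s \<le> r \<Longrightarrow> r \<le> t \<Longrightarrow> f r \<le> f t"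
  shows "0 \<le> D"
proof (rule ccontr)
  assume "\<not> 0 \<le> D"
  then obtain d where d: "d > 0" "\<And>h. h > 0 \<Longrightarrow> h < d \<Longrightarrow> f t < f (t - h)"
    using DERIV_neg_dec_left[OF assms(1)] by auto
  define h where "h = min (d / 2) (t - s)"
  have "0 < h" "h < d" "h \<le> t - s" using assms(2) d(1) by (auto simp: h_def min_def)
  then show False using d(2)[of h] assms(3)[of "t - h"] by auto
qed

section \<open>Regularity of moving time windows\<close>

context weak_solution
begin

lemma V_minus: "c \<le> t1 \<Longrightarrow> t1 \<le> t2 \<Longrightarrow>
    V t1 t2 x = (LBINT s. u x s * indicator {c..t2} s) - (LBINT s. u x s * indicator {c..t1} s)"
  using LINT_indicator_diff[OF u_meas1 u_bdd, of c t1 t2 x] by (simp add: V_def)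

lemma V_le:
  assumes "t1 \<le> t2" "\<And>s. t1 < s \<Longrightarrow> s \<le> t2 \<Longrightarrow> u x s \<le> c"
  shows "V t1 t2 x \<le> c * (t2 - t1)"
proof -
  have "- c * (t2 - t1) \<le> (LBINT z. - u x z * indicator {t1<..t2} z)"
    by (rule LINT_indicator_ge[where K = M]) (use assms u_bdd in auto)
  then show ?thesis by (simp add: V_def)
qed

lemma V_ge:
  assumes "t1 \<le> t2" "\<And>s. t1 < s \<Longrightarrow> s \<le> t2 \<Longrightarrow> c \<le> u x s"
  shows "c * (t2 - t1) \<le> V t1 t2 x"
  unfolding V_def by (rule LINT_indicator_ge[where K = M]) (use assms u_bdd in auto)

text \<open>The fundamental theorem of calculus at both ends of the window: continuity of u in time
  suffices for differentiability of the window integral.\<close>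

lemma V_has_derivative:
  assumes "h > 0"
  shows "((\<lambda>s. V (s - h) s x) has_real_derivative u x t - u x (t - h)) (at t)"
proof -
  define c where "c = t - h - 1"
  define P where "P = (\<lambda>s. LBINT r. u x r * indicator {c..s} r)"
  have P: "(P has_real_derivative u x s) (at s)" if "c < s" for s
  proof (rule has_derivative_from_LINT[of c "s + 1"])
    show "P q - P p = (LBINT r. u x r * indicator {p<..q} r)" if "c < p" "p < q" for p q
      unfolding P_def using LINT_indicator_diff[OF u_meas1 u_bdd, of c p q x] that by simp
  qed (use that in \<open>auto intro: continuous_on_subset[OF u_cont1]\<close>)
  have "((\<lambda>s. P s - P (s - h)) has_real_derivative u x t - u x (t - h)) (at t)"
    using assms by (auto intro!: derivative_eq_intros P DERIV_chain'[OF _ P] simp: c_def)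
  then show ?thesis
    by (rule has_field_derivative_transform_within_open[where S = "{c + h<..}"])
       (use assms in \<open>auto simp: P_def c_def V_minus[of "t - h - 1"]\<close>)
qed

text \<open>The window integral is Lipschitz in time with constant 2 M for all x, which turns
  continuity in x into joint continuity.\<close>

lemma V_joint_cont:
  assumes h: "h > 0"
  shows "continuous_on UNIV (\<lambda>p. V (snd p - h) (snd p) (fst p))"
  unfolding continuous_on_sequentially
proof (intro allI ballI impI)
  fix X :: "nat \<Rightarrow> real \<times> real" and p assume "p \<in> UNIV" "(\<forall>n. X n \<in> UNIV) \<and> X \<longlonglongrightarrow> p"
  then have X: "(\<lambda>n. fst (X n)) \<longlonglongrightarrow> fst p" "(\<lambda>n. snd (X n)) \<longlonglongrightarrow> snd p"
    using tendsto_fst[of X p] tendsto_snd[of X p] by auto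
  let ?W = "\<lambda>x t. V (t - h) t x"
  have lip: "\<bar>?W x t - ?W x s\<bar> \<le> 2 * M * \<bar>t - s\<bar>" for x t s
  proof -
    define c where "c = min t s - h"
    define P where "P = (\<lambda>s. LBINT r. u x r * indicator {c..s} r)"
    have P: "\<bar>P a - P b\<bar> \<le> M * \<bar>a - b\<bar>" if "c \<le> a" "c \<le> b" for a b
      using LINT_indicator_diff[OF u_meas1 u_bdd, of c a b x] LINT_indicator_le[OF u_meas1 u_bdd, of a b x]
        LINT_indicator_diff[OF u_meas1 u_bdd, of c b a x] LINT_indicator_le[OF u_meas1 u_bdd, of b a x] that
      unfolding P_def by (cases "a \<le> b") auto
    have "?W x t = P t - P (t - h)" "?W x s = P s - P (s - h)"
      using h by (auto simp: P_def c_def intro!: V_minus)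
    moreover have "\<bar>P t - P s\<bar> \<le> M * \<bar>t - s\<bar>" by (rule P) (use h in \<open>auto simp: c_def\<close>)
    moreover have "\<bar>P (t - h) - P (s - h)\<bar> \<le> M * \<bar>t - h - (s - h)\<bar>" by (rule P) (auto simp: c_def)
    moreover have "t - h - (s - h) = t - s" by simp
    ultimately show ?thesis by (simp only: mult_2 distrib_right)
  qed
  have "(\<lambda>n. ?W (fst (X n)) (snd (X n)) - ?W (fst (X n)) (snd p)) \<longlonglongrightarrow> 0"
  proof (rule tendsto_rabs_zero_cancel, rule tendsto_sandwich[OF _ _ tendsto_const])
    show "\<forall>\<^sub>F n in sequentially. \<bar>?W (fst (X n)) (snd (X n)) - ?W (fst (X n)) (snd p)\<bar> \<le> 2 * M * \<bar>snd (X n) - snd p\<bar>"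
      using lip by simp
    show "(\<lambda>n. 2 * M * \<bar>snd (X n) - snd p\<bar>) \<longlonglongrightarrow> 0"
      by (rule tendsto_mult_right_zero[OF tendsto_rabs_zero[OF LIM_zero[OF X(2)]]])
  qed simp
  moreover have "(\<lambda>n. ?W (fst (X n)) (snd p)) \<longlonglongrightarrow> ?W (fst p) (snd p)"
    using continuous_on_tendsto_compose[OF V_cont X(1)] by simp
  ultimately have "(\<lambda>n. (?W (fst (X n)) (snd (X n)) - ?W (fst (X n)) (snd p)) + ?W (fst (X n)) (snd p)) \<longlonglongrightarrow> 0 + ?W (fst p) (snd p)"
    by (rule tendsto_add)
  then show "((\<lambda>p. V (snd p - h) (snd p) (fst p)) \<circ> X) \<longlonglongrightarrow> V (snd p - h) (snd p) (fst p)"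
    by (simp add: o_def)
qed

lemma u_modulus:
  assumes "\<epsilon> > 0"
  obtains d where "d > 0" "\<And>x y s t. x \<in> {-1..1} \<Longrightarrow> y \<in> {-1..1} \<Longrightarrow> s \<in> {0..T} \<Longrightarrow> t \<in> {0..T} \<Longrightarrow>
    \<bar>x - y\<bar> < d \<Longrightarrow> \<bar>s - t\<bar> < d \<Longrightarrow> \<bar>u x s - u y t\<bar> < \<epsilon>"
proof -
  have "uniformly_continuous_on ({-1..1} \<times> {0..T}) (\<lambda>p. u (fst p) (snd p))"
    by (intro compact_uniformly_continuous continuous_on_subset[OF u_cont] compact_Times) auto
  then obtain d where d: "d > 0" "\<And>p q. p \<in> {-1..1} \<times> {0..T} \<Longrightarrow> q \<in> {-1..1} \<times> {0..T} \<Longrightarrow> dist q p < d \<Longrightarrow>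
      dist (u (fst q) (snd q)) (u (fst p) (snd p)) < \<epsilon>"
    using assms unfolding uniformly_continuous_on_def by metis
  show ?thesis
  proof (rule that[of "d / 2"])
    fix x y s t :: real
    assume *: "x \<in> {-1..1}" "y \<in> {-1..1}" "s \<in> {0..T}" "t \<in> {0..T}" "\<bar>x - y\<bar> < d / 2" "\<bar>s - t\<bar> < d / 2"
    have "dist (x, s) (y, t) \<le> \<bar>x - y\<bar> + \<bar>s - t\<bar>"
      unfolding dist_Pair_Pair dist_real_def by (rule sqrt_sum_squares_le_sum_abs[THEN order_trans]) simp
    then show "\<bar>u x s - u y t\<bar> < \<epsilon>"
      using d(2)[of "(y, t)" "(x, s)"] * by (auto simp: dist_real_def)
  qed (use d in simp)
qed

end

text \<open>\<open>Q\<close> stands for \<open>1 / \<lambda>\<close>, and \<open>F\<close> is the negative of the right-hand side of the equation.\<close>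

locale obstacle = weak_solution u F T M
  for u F :: "real \<Rightarrow> real \<Rightarrow> real" and T M :: real +
  fixes g Q :: "real \<Rightarrow> real" and g0 g1 \<kappa> :: real
  assumes F_eq: "\<And>x t. F x t = (1 - g x * Q t) * heaviside (u x t)"
    and u_nonneg: "\<And>x t. 0 \<le> u x t"
    and g_cont: "continuous_on UNIV g"
    and g_bds: "0 < g0" "\<And>x. g0 \<le> g x" "\<And>x. g x \<le> g1"
    and \<kappa>_pos: "0 < \<kappa>"
    and g_slope: "\<And>x y. -1 \<le> y \<Longrightarrow> y \<le> x \<Longrightarrow> x \<le> 1 \<Longrightarrow> \<kappa> * (x - y) \<le> g x - g y"
    and Q_meas [measurable]: "Q \<in> borel_measurable borel"
    and Q_bds: "\<And>t. 1 / g1 \<le> Q t" "\<And>t. Q t \<le> 1 / g0"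
    and compl: "AE x in lborel. AE t in lborel. x \<in> {-1<..<1} \<longrightarrow> t \<in> {0<..<T} \<longrightarrow> u x t = 0 \<longrightarrow> g x * Q t \<le> 1"
    and mass_balance: "AE t in lborel. t \<in> {0<..<T} \<longrightarrow> (LBINT x. F x t * indicator {-1..1} x) = 0"
    and init_mono: "\<And>x y. -1 \<le> y \<Longrightarrow> y \<le> x \<Longrightarrow> x \<le> 1 \<Longrightarrow> u y 0 \<le> u x 0"
    and init_pos: "\<exists>x\<in>{-1..1}. 0 < u x 0"
begin

definition A :: "real \<Rightarrow> real \<Rightarrow> real" where
  "A t1 t2 = (LBINT s. Q s * indicator {t1<..t2} s)"

text \<open>The value that R would have if u were positive on the entire window; unlike R it is
  continuous in x.\<close>

definition G :: "real \<Rightarrow> real \<Rightarrow> real \<Rightarrow> real" where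
  "G t1 t2 x = u x t2 - u x t1 + (t2 - t1) - g x * A t1 t2"

lemma g1_pos: "0 < g1" using g_bds(1) g_bds(2,3)[of 0] by linarith

lemma Q_pos: "0 < Q t" using Q_bds(1) g1_pos by (meson divide_pos_pos less_le_trans zero_less_one)

lemma Q_abs: "\<bar>Q t\<bar> \<le> 1 / g0" using Q_bds(2)[of t] Q_pos[of t] by linarith

lemma A_ge: "t1 \<le> t2 \<Longrightarrow> (1 / g1) * (t2 - t1) \<le> A t1 t2"
  unfolding A_def by (rule LINT_indicator_ge[OF Q_meas Q_abs]) (use Q_bds in auto)

lemma G_cont: "continuous_on UNIV (G t1 t2)"
  unfolding G_def by (intro continuous_intros u_cont2 g_cont)

lemma LINT_linear: "t1 \<le> t2 \<Longrightarrow> (LBINT s. (1 - g x * Q s) * indicator {t1<..t2} s) = (t2 - t1) - g x * A t1 t2"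
proof -
  assume "t1 \<le> t2"
  have i: "integrable lborel (indicator {t1<..t2} :: real \<Rightarrow> real)"
    by (rule integrable_indicator_real) auto
  have "(LBINT s. (1 - g x * Q s) * indicator {t1<..t2} s)
      = (LBINT s. indicator {t1<..t2} s - g x * (Q s * indicator {t1<..t2} s))"
    by (rule Bochner_Integration.integral_cong[OF refl]) (simp add: algebra_simps)
  also have "\<dots> = (LBINT s. indicator {t1<..t2} s) - (LBINT s. g x * (Q s * indicator {t1<..t2} s))"
    using i integrable_bounded_mult[OF i _ Q_abs]
    by (intro Bochner_Integration.integral_diff) auto
  finally show ?thesis using \<open>t1 \<le> t2\<close> by (simp add: A_def)
qed

lemma R_eq_G:
  assumes "t1 \<le> t2" "\<And>s. t1 < s \<Longrightarrow> s < t2 \<Longrightarrow> 0 < u x s"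
  shows "R t1 t2 x = G t1 t2 x"
proof -
  have "J t1 t2 x = (LBINT s. (1 - g x * Q s) * indicator {t1<..t2} s)"
    unfolding J_def
  proof (rule integral_cong_AE)
    show "AE s in lborel. F x s * indicator {t1<..t2} s = (1 - g x * Q s) * indicator {t1<..t2} s"
      using AE_lborel_singleton[of t2]
      by eventually_elim (use assms(2) in \<open>auto simp: F_eq heaviside_def indicator_def\<close>)
  qed simp_all
  then show ?thesis using LINT_linear[OF assms(1)] by (simp add: R_def G_def)
qed

text \<open>Where u = 0 the source F omits 1 - g Q, and the obstacle condition \<open>compl\<close>
  says that the omitted term is nonnegative.\<close>

lemma R_le_G:
  assumes t: "0 \<le> t1" "t1 \<le> t2" "t2 < T"
  shows "AE x in lborel. x \<in> {-1..1} \<longrightarrow> R t1 t2 x \<le> G t1 t2 x"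
  using compl AE_lborel_singleton[of "-1::real"] AE_lborel_singleton[of "1::real"]
proof eventually_elim
  case (elim x)
  show ?case
  proof
    assume "x \<in> {-1..1}"
    then have x: "x \<in> {-1<..<1}" using elim by auto
    have i: "integrable lborel (indicator {t1<..t2} :: real \<Rightarrow> real)"
      by (rule integrable_indicator_real) auto
    have "\<bar>1 - g x * Q s\<bar> \<le> 1 + g1 / g0" for s
    proof -
      have "g x * Q s \<le> g1 * (1 / g0)"
        using g_bds Q_bds Q_pos[of s] g1_pos by (intro mult_mono) (auto simp: less_imp_le)
      moreover have "0 \<le> g x * Q s" using g_bds(1) g_bds(2)[of x] Q_pos[of s] by auto
      ultimately show ?thesis by auto
    qed
    note b = this
    have "J t1 t2 x \<le> (LBINT s. (1 - g x * Q s) * indicator {t1<..t2} s)"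
      unfolding J_def
    proof (rule integral_mono_AE)
      show "AE s in lborel. F x s * indicator {t1<..t2} s \<le> (1 - g x * Q s) * indicator {t1<..t2} s"
        using elim(1)
      proof eventually_elim
        case (elim s)
        show ?case
        proof (cases "s \<in> {t1<..t2} \<and> u x s = 0")
          case True
          then have "g x * Q s \<le> 1" using elim x t by auto
          then show ?thesis using True by (simp add: F_eq heaviside_def)
        next
          case False
          then show ?thesis using u_nonneg[of x s] by (auto simp: F_eq heaviside_def indicator_def)
        qed
      qed
      show "integrable lborel (\<lambda>s. F x s * indicator {t1<..t2} s)"
        by (rule integrable_bounded_mult[OF i _ F_bdd]) simp
      show "integrable lborel (\<lambda>s. (1 - g x * Q s) * indicator {t1<..t2} s)"
        by (rule integrable_bounded_mult[OF i _ b]) simp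
    qed
    then show "R t1 t2 x \<le> G t1 t2 x" using LINT_linear[OF t(2), of x] by (simp add: R_def G_def)
  qed
qed

lemma g_mono:
  assumes "-1 \<le> y" "y \<le> x" "x \<le> 1"
  shows "g y \<le> g x"
proof -
  have "0 \<le> \<kappa> * (x - y)" using \<kappa>_pos assms by simp
  then show ?thesis using g_slope[OF assms] by linarith
qed

text \<open>Doubling of the space variable: \<open>u(y,t) - u(x,t)\<close> is a subsolution in \<open>y < x\<close> wherever it is
  positive, since there \<open>u(y,t) > 0\<close> and \<open>g(y) \<le> g(x)\<close>. Averaging over \<open>(t - h, t)\<close> provides
  enough regularity for a pointwise maximum argument.\<close>

theorem u_mono:
  assumes t1: "0 \<le> t1" "t1 < T" and xy: "-1 \<le> y1" "y1 \<le> x1" "x1 \<le> 1"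
  shows "u y1 t1 \<le> u x1 t1"
proof (rule ccontr)
  assume "\<not> u y1 t1 \<le> u x1 t1"
  then have neg: "u y1 t1 - u x1 t1 > 0" by simp
  have t1pos: "0 < t1" using neg init_mono[OF xy] t1 by (cases "t1 = 0") auto
  \<comment> \<open>The contradiction margin is 2 \<eta>. A penalty \<open>\<delta> * t\<close>
    equal to \<eta> at t1 makes the time inequality strict and still leaves \<eta>.\<close>
  define \<eta> where "\<eta> = (u y1 t1 - u x1 t1) / 2"
  define \<delta> where "\<delta> = \<eta> / t1"
  have \<eta>: "\<eta> > 0" and \<delta>: "\<delta> > 0" and \<delta>t: "\<delta> * t1 = \<eta>"
    using neg t1pos by (auto simp: \<eta>_def \<delta>_def)
  obtain d where d: "d > 0" "\<And>x y s t. x \<in> {-1..1} \<Longrightarrow> y \<in> {-1..1} \<Longrightarrow> s \<in> {0..T} \<Longrightarrow> t \<in> {0..T} \<Longrightarrow>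
    \<bar>x - y\<bar> < d \<Longrightarrow> \<bar>s - t\<bar> < d \<Longrightarrow> \<bar>u x s - u y t\<bar> < \<eta> / 8"
    using u_modulus[of "\<eta> / 8"] \<eta> by auto
  define h where "h = min (d / 2) (t1 / 2)"
  have h: "0 < h" "h < d" "h < t1" using d t1pos by (auto simp: h_def min_def)
  define W where "W = (\<lambda>x t. V (t - h) t x)"
  have W: "\<bar>W x t - h * u x r\<bar> \<le> h * (\<eta> / 8)"
    if "x \<in> {-1..1}" "h \<le> t" "t \<le> t1" "t - h \<le> r" "r \<le> t" for x t r
  proof -
    have *: "\<bar>u x s - u x r\<bar> < \<eta> / 8" if "t - h < s" "s \<le> t" for s
      using that \<open>x \<in> {-1..1}\<close> \<open>h \<le> t\<close> \<open>t \<le> t1\<close> \<open>t - h \<le> r\<close> \<open>r \<le> t\<close> h t1 d(1) by (intro d(2)) auto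
    have "u x s \<le> u x r + \<eta> / 8" "u x r - \<eta> / 8 \<le> u x s" if "t - h < s" "s \<le> t" for s
      using *[OF that] by linarith+
    then have "W x t \<le> (u x r + \<eta> / 8) * (t - (t - h))" "(u x r - \<eta> / 8) * (t - (t - h)) \<le> W x t"
      unfolding W_def using h by (intro V_le V_ge; simp)+
    then show ?thesis unfolding abs_le_iff by (simp add: algebra_simps)
  qed
  define D where "D = (\<lambda>(y, x, t). W y t - W x t - \<delta> * h * t)"
  define K where "K = ({-1..1} \<times> {-1..1} \<times> {h..t1}) \<inter> {p :: real \<times> real \<times> real. fst p \<le> fst (snd p)}"
  have "compact K"
    unfolding K_def by (intro compact_Int_closed compact_Times compact_Icc closed_Collect_le continuous_intros)
  moreover have "(y1, x1, t1) \<in> K" using xy h by (auto simp: K_def)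
  moreover have "continuous_on K D"
  proof -
    have V1: "continuous_on K (\<lambda>p. V (snd (snd p) - h) (snd (snd p)) (fst p))"
    proof -
      have c: "continuous_on K (\<lambda>p. (fst p, snd (snd p)))" by (intro continuous_intros)
      show ?thesis using continuous_on_compose2[OF V_joint_cont[OF h(1)] c] by simp
    qed
    have V2: "continuous_on K (\<lambda>p. V (snd (snd p) - h) (snd (snd p)) (fst (snd p)))"
    proof -
      have c: "continuous_on K (\<lambda>p. (fst (snd p), snd (snd p)))" by (intro continuous_intros)
      show ?thesis using continuous_on_compose2[OF V_joint_cont[OF h(1)] c] by simp
    qed
    show ?thesis
      unfolding D_def W_def case_prod_beta' by (intro continuous_intros V1 V2)
  qed
  ultimately obtain p where p: "p \<in> K" "\<And>q. q \<in> K \<Longrightarrow> D q \<le> D p"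
    using continuous_attains_sup[of K D] by blast
  obtain y0 x0 t0 where p_eq: "p = (y0, x0, t0)" by (metis prod.exhaust)
  have in0: "y0 \<in> {-1..1}" "x0 \<in> {-1..1}" "y0 \<le> x0" "h \<le> t0" "t0 \<le> t1"
    using p(1) by (auto simp: K_def p_eq)
  have maxD: "W y t - W x t - \<delta> * h * t \<le> W y0 t0 - W x0 t0 - \<delta> * h * t0"
    if "y \<in> {-1..1}" "x \<in> {-1..1}" "y \<le> x" "h \<le> t" "t \<le> t1" for y x t
    using p(2)[of "(y, x, t)"] that by (simp add: K_def D_def p_eq)
  \<comment> \<open>In units of h \<eta>: the margin 2, minus two averaging errors 1/8, minus the
    penalty 1.\<close>
  have big: "h * (\<eta> * (3/4)) \<le> W y0 t0 - W x0 t0 - \<delta> * h * t0"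
  proof -
    have "h * (u y1 t1 - u x1 t1) - 2 * (h * (\<eta> / 8)) - h * \<eta> \<le> W y1 t1 - W x1 t1 - \<delta> * h * t1"
    proof -
      have "\<bar>W y1 t1 - h * u y1 t1\<bar> \<le> h * (\<eta> / 8)" "\<bar>W x1 t1 - h * u x1 t1\<bar> \<le> h * (\<eta> / 8)"
        using xy h by (intro W; simp)+
      moreover have "\<delta> * h * t1 = h * \<eta>" using \<delta>t by (simp add: mult.assoc[symmetric] mult.commute[of h])
      ultimately show ?thesis unfolding right_diff_distrib by linarith
    qed
    moreover have "u y1 t1 - u x1 t1 = 2 * \<eta>" by (simp add: \<eta>_def)
    ultimately show ?thesis
      using maxD[of y1 x1 t1] xy h by (auto simp: algebra_simps)
  qed
  have \<delta>ht: "0 \<le> \<delta> * h * t0" using \<delta> h in0 by simp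
  have h\<eta>: "h * \<eta> > 0" using h \<eta> by simp
  \<comment> \<open>On the diagonal the two averages cancel and only the nonpositive penalty term is
    left.\<close>
  have "y0 \<noteq> x0" using big \<delta>ht h\<eta> by auto
  then have yx: "y0 < x0" using in0 by simp
  \<comment> \<open>At t0 = h the window starts at time 0, so initial monotonicity bounds the
    difference by two averaging errors, h \<eta> / 4.\<close>
  have t0h: "h < t0"
  proof (rule ccontr)
    assume "\<not> h < t0"
    then have [simp]: "t0 = h" using in0 by simp
    have "W y0 h - W x0 h \<le> h * (u y0 0 - u x0 0) + 2 * (h * (\<eta> / 8))"
    proof -
      have "\<bar>W y0 h - h * u y0 0\<bar> \<le> h * (\<eta> / 8)" "\<bar>W x0 h - h * u x0 0\<bar> \<le> h * (\<eta> / 8)"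
        using in0 h by (intro W; simp)+
      then show ?thesis unfolding right_diff_distrib by linarith
    qed
    moreover have "h * (u y0 0 - u x0 0) \<le> 0"
      using init_mono[of y0 x0] in0 h by (intro mult_nonneg_nonpos) auto
    ultimately show False using big \<delta>ht h\<eta> by (auto simp: algebra_simps)
  qed
  have Wx0: "0 \<le> W x0 t0"
    using V_ge[of "t0 - h" t0 0 x0] u_nonneg h by (simp add: W_def)
  \<comment> \<open>One more averaging error gives 3/4 - 1/8 = 5/8; u is therefore positive near y0
    throughout the window, and R = G there.\<close>
  have uy0: "u y0 t0 \<ge> \<eta> * (5/8)"
  proof -
    have "h * (\<eta> * (3/4)) \<le> h * u y0 t0 + h * (\<eta> / 8)"
    proof -
      have "\<bar>W y0 t0 - h * u y0 t0\<bar> \<le> h * (\<eta> / 8)" using in0 h by (intro W; simp)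
      then show ?thesis using big \<delta>ht Wx0 by linarith
    qed
    then have "h * (\<eta> * (3/4)) \<le> h * (u y0 t0 + \<eta> / 8)" by (simp add: algebra_simps)
    then show ?thesis using h by simp
  qed
  have pos: "u y s > 0" if "y \<in> {-1..1}" "\<bar>y - y0\<bar> < d" "t0 - h < s" "s < t0" for y s
  proof -
    have "\<bar>u y s - u y0 t0\<bar> < \<eta> / 8"
      using that in0 h t1 d(1) by (intro d(2)) auto
    then show ?thesis using uy0 \<eta> by linarith
  qed
  have t0: "0 \<le> t0 - h" "t0 - h < t0" "t0 < T" using in0 h t1 by auto
  \<comment> \<open>The radius x0 - y0 keeps y below x0, hence inside the domain of the
    maximum.\<close>
  have Gy: "G (t0 - h) t0 y0 \<le> 0"
  proof (rule flux_form_local_max[OF flux_form_V[OF t0] in0(1), of "min d (x0 - y0)"])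
    fix y assume "y \<in> {-1..1}" "\<bar>y - y0\<bar> < min d (x0 - y0)"
    then show "V (t0 - h) t0 y \<le> V (t0 - h) t0 y0"
      using maxD[of y x0 t0] in0 by (auto simp: W_def)
  next
    show "AE y in lborel. y \<in> {-1..1} \<longrightarrow> \<bar>y - y0\<bar> < min d (x0 - y0) \<longrightarrow> G (t0 - h) t0 y \<le> R (t0 - h) t0 y"
      using R_eq_G[of "t0 - h" t0] pos h by (intro AE_I2) (auto intro: less_imp_le)
  qed (use d yx G_cont in auto)
  \<comment> \<open>At x0 the solution may touch zero, so only R <= G is known; at a minimum of V
    this is the right direction.\<close>
  have Gx: "- G (t0 - h) t0 x0 \<le> 0"
  proof (rule flux_form_local_max[OF flux_form_minus[OF flux_form_zero flux_form_V[OF t0]] in0(2), of "x0 - y0"])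
    fix x assume "x \<in> {-1..1}" "\<bar>x - x0\<bar> < x0 - y0"
    then show "0 - V (t0 - h) t0 x \<le> 0 - V (t0 - h) t0 x0"
      using maxD[of y0 x t0] in0 by (auto simp: W_def)
  next
    show "AE x in lborel. x \<in> {-1..1} \<longrightarrow> \<bar>x - x0\<bar> < x0 - y0 \<longrightarrow> - G (t0 - h) t0 x \<le> 0 - R (t0 - h) t0 x"
      using R_le_G[of "t0 - h" t0] t0 by (auto elim!: eventually_mono)
  qed (use yx G_cont in \<open>auto intro!: continuous_intros\<close>)
  have "((\<lambda>t. W y0 t - W x0 t - \<delta> * h * t) has_real_derivative
      (u y0 t0 - u y0 (t0 - h)) - (u x0 t0 - u x0 (t0 - h)) - \<delta> * h) (at t0)"
    unfolding W_def by (auto intro!: derivative_eq_intros V_has_derivative h)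
  then have "0 \<le> (u y0 t0 - u y0 (t0 - h)) - (u x0 t0 - u x0 (t0 - h)) - \<delta> * h"
    by (rule left_max_deriv_nonneg[OF _ t0h]) (use maxD in0 in auto)
  moreover have "G (t0 - h) t0 y0 - G (t0 - h) t0 x0
      = (u y0 t0 - u y0 (t0 - h)) - (u x0 t0 - u x0 (t0 - h)) + (g x0 - g y0) * A (t0 - h) t0"
    by (simp add: G_def algebra_simps)
  moreover have "0 \<le> (g x0 - g y0) * A (t0 - h) t0"
  proof (rule mult_nonneg_nonneg)
    show "0 \<le> g x0 - g y0" using g_mono[of y0 x0] in0 by auto
    have "0 \<le> (1 / g1) * (t0 - (t0 - h))" using g1_pos h by simp
    then show "0 \<le> A (t0 - h) t0" using A_ge[of "t0 - h" t0] h by linarith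
  qed
  moreover have "0 < \<delta> * h" using \<delta> h by simp
  ultimately show False using Gy Gx by linarith
qed

end

subsection \<open>Nondegeneracy and absence of sudden extinction\<close>

lemma mono_deriv_nonneg:
  fixes f :: "real \<Rightarrow> real"
  assumes D: "(f has_real_derivative D) (at x)" and "a < x"
    and mono: "\<And>y. a < y \<Longrightarrow> y \<le> x \<Longrightarrow> f y \<le> f x"
  shows "0 \<le> D"
proof (rule left_max_deriv_nonneg[OF D])
  show "(a + x) / 2 < x" using assms(2) by simp
  show "f r \<le> f x" if "(a + x) / 2 \<le> r" "r \<le> x" for r
    using that assms(2) by (intro mono) auto
qed

context obstacle
begin

text \<open>Two integrals vanish: that of R because there is no flux through the ends, and that of F
  at almost every time because \<lambda> is the average of g over {u > 0}.\<close>

lemma mass_conservation: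
  assumes t: "0 < t" "t < T"
  shows "(LBINT x. u x t * indicator {-1..1} x) = (LBINT x. u x 0 * indicator {-1..1} x)"
proof -
  have i: "integrable lborel (indicator {-1..1} :: real \<Rightarrow> real)"
    "integrable lborel (indicator {0<..t} :: real \<Rightarrow> real)"
    by (auto intro: integrable_indicator_real)
  note ker = LINT_product_kernel[where K = M, OF F_meas F_bdd i]
  have "(LBINT s. (LBINT x. F x s * indicator {-1..1} x) * indicator {0<..t} s) = 0"
  proof (rule integral_eq_zero_AE)
    show "AE s in lborel. (LBINT x. F x s * indicator {-1..1} x) * indicator {0<..t} s = 0"
      using mass_balance by eventually_elim (use t in \<open>auto simp: indicator_def\<close>)
  qed
  then have J0: "(LBINT x. J 0 t x * indicator {-1..1} x) = 0"
    using ker by (simp add: J_def)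
  have iu: "integrable lborel (\<lambda>x. u x s * indicator {-1..1} x)" for s
    by (rule integrable_bounded_mult[OF i(1) _ u_bdd]) simp
  have iJ: "integrable lborel (\<lambda>x. J 0 t x * indicator {-1..1} x)"
    by (rule integrable_bounded_mult[OF i(1) _ J_bdd]) (use t in auto)
  have "0 = (LBINT x. R 0 t x * indicator {-1..1} x)"
    using flux_form_V[of 0 t] t by (simp add: flux_form_def)
  also have "\<dots> = (LBINT x. (u x t * indicator {-1..1} x - u x 0 * indicator {-1..1} x) + J 0 t x * indicator {-1..1} x)"
    by (rule Bochner_Integration.integral_cong[OF refl]) (simp add: R_def algebra_simps)
  also have "\<dots> = (LBINT x. u x t * indicator {-1..1} x) - (LBINT x. u x 0 * indicator {-1..1} x)"
    using Bochner_Integration.integral_add[OF Bochner_Integration.integrable_diff[OF iu iu] iJ]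
      Bochner_Integration.integral_diff[OF iu iu] J0 by simp
  finally show ?thesis by simp
qed

lemma initial_mass_pos: "0 < (LBINT x. u x 0 * indicator {-1..1} x)"
proof -
  obtain z where z: "z \<in> {-1..1}" "0 < u z 0" using init_pos by blast
  obtain d where d: "d > 0" "\<And>x. dist x z < d \<Longrightarrow> dist (u x 0) (u z 0) < u z 0"
    using u_cont2[of 0] z unfolding continuous_on_iff by (metis UNIV_I)
  \<comment> \<open>If z = 1, monotonicity yields no interval of positivity; continuity provides one
    to the left of z.\<close>
  define a where "a = max (-1) (z - d / 2)"
  have a: "-1 \<le> a" "a \<le> z" using z d by (auto simp: a_def)
  have ua: "0 < u x 0" if "a \<le> x" "x \<le> 1" for x
  proof (cases "x \<le> z")
    case True
    then have "dist (u x 0) (u z 0) < u z 0" using that d by (intro d) (auto simp: dist_real_def a_def)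
    then show ?thesis by (auto simp: dist_real_def)
  next
    case False
    then show ?thesis using init_mono[of z x] z that by auto
  qed
  show ?thesis
  proof (cases "a < 1")
    case True
    have "u a 0 * (1 - a) \<le> (LBINT x. u x 0 * indicator {a<..1} x)"
      by (rule LINT_indicator_ge[where K = M]) (use u_bdd init_mono[of a] a True in auto)
    moreover have "(LBINT x. u x 0 * indicator {-1..1} x) - (LBINT x. u x 0 * indicator {-1..a} x)
        = (LBINT x. u x 0 * indicator {a<..1} x)"
      by (rule LINT_indicator_diff[where K = M]) (use u_bdd a True in auto)
    moreover have "0 \<le> (LBINT x. u x 0 * indicator {-1..a} x)"
      by (rule Bochner_Integration.integral_nonneg) (use u_nonneg in auto)
    moreover have "0 < u a 0 * (1 - a)" using ua[of a] True by simp
    ultimately show ?thesis by linarith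
  next
    case False
    then show ?thesis using a z d by (auto simp: a_def max_def split: if_splits)
  qed
qed

text \<open>By monotonicity a zero at 1 would make u vanish on all of [-1, 1], against conservation
  of the positive initial mass.\<close>

lemma u_pos_at_1:
  assumes t: "0 \<le> t" "t < T"
  shows "0 < u 1 t"
proof (rule ccontr)
  assume "\<not> 0 < u 1 t"
  then have "u x t = 0" if "x \<in> {-1..1}" for x
    using u_mono[OF t, of x 1] u_nonneg[of x t] that by force
  then have "u x t * indicator {-1..1} x = 0" for x
    by (cases "x \<in> {-1..1}") auto
  then have "(LBINT x. u x t * indicator {-1..1} x) = 0" by (intro integral_eq_zero_AE AE_I2)
  then show False
    using mass_conservation[of t] initial_mass_pos t by (cases "t = 0") auto
qed

text \<open>Nondegeneracy: a zero persists while \<open>u\<close> stays below the stationary supersolution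
  \<open>(c/20) (x - x')\<^sup>2\<close> at \<open>xb\<close>; no boundary condition is needed at the degenerate end \<open>-1\<close>.\<close>

lemma zero_persists:
  assumes s: "0 \<le> s" "s' < T" and x: "-1 \<le> x'" "x' < xb" "xb < 1" and c: "0 < c"
    and Qg: "AE r in lborel. s < r \<longrightarrow> r < s' \<longrightarrow> c \<le> 1 - g xb * Q r"
    and zero: "u xb s = 0"
    and small: "\<And>r. s \<le> r \<Longrightarrow> r \<le> s' \<Longrightarrow> u xb r \<le> (c / 20) * (xb - x')\<^sup>2"
    and t1: "s \<le> t1" "t1 \<le> s'"
  shows "u x' t1 = 0"
proof (rule ccontr)
  assume "u x' t1 \<noteq> 0"
  define \<theta> where "\<theta> = u x' t1"
  have \<theta>: "\<theta> > 0" using \<open>u x' t1 \<noteq> 0\<close> u_nonneg[of x' t1] by (simp add: \<theta>_def)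
  have us: "u x s = 0" if "-1 \<le> x" "x \<le> xb" for x
    using u_mono[of s x xb] u_nonneg[of x s] zero that s t1 x by auto
  have st1: "s < t1" using us[of x'] \<theta> t1 x by (cases "s = t1") (auto simp: \<theta>_def)
  obtain d where d: "d > 0" "\<And>x y s t. x \<in> {-1..1} \<Longrightarrow> y \<in> {-1..1} \<Longrightarrow> s \<in> {0..T} \<Longrightarrow> t \<in> {0..T} \<Longrightarrow>
    \<bar>x - y\<bar> < d \<Longrightarrow> \<bar>s - t\<bar> < d \<Longrightarrow> \<bar>u x s - u y t\<bar> < \<theta> / 8"
    using u_modulus[of "\<theta> / 8"] \<theta> by auto
  define h where "h = min (d / 2) ((t1 - s) / 2)"
  have h: "0 < h" "h < d" "s + h < t1"
  proof -
    have hh: "h \<le> d / 2" "h \<le> (t1 - s) / 2" unfolding h_def by (rule min.cobounded1 min.cobounded2)+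
    show "0 < h" using d st1 by (simp add: h_def)
    show "h < d" using hh(1) d(1) by simp
    have "2 * h \<le> t1 - s" using hh(2) by simp
    then show "s + h < t1" using \<open>0 < h\<close> by simp
  qed
  define W where "W = (\<lambda>x t. V (t - h) t x)"
  \<comment> \<open>Applying ((1 - x^2) B')' to this parabola gives (c/20) (2 (1 - x^2) - 4 x (x -
    x')), and the bracket is at most 2 + 8 = 10. The value is thus at most c/2, half of the lower
    bound c for F where u > 0.\<close>
  define B where "B = (\<lambda>x. (c / 20) * (x - x')\<^sup>2)"
  have B: "0 \<le> B x" for x using c by (simp add: B_def)
  have hB: "0 \<le> h * B x" for x using B h by simp
  define E where "E = (\<lambda>p. W (fst p) (snd p) - h * B (fst p))"
  define K where "K = {-1..xb} \<times> {s + h..t1}"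
  have "compact K" unfolding K_def by (intro compact_Times compact_Icc)
  moreover have "(x', t1) \<in> K" using x h by (auto simp: K_def)
  moreover have "continuous_on K E"
    unfolding E_def W_def B_def by (intro continuous_intros continuous_on_subset[OF V_joint_cont[OF h(1)]]) auto
  ultimately obtain p where p: "p \<in> K" "\<And>q. q \<in> K \<Longrightarrow> E q \<le> E p"
    using continuous_attains_sup[of K E] by blast
  obtain x0 t0 where p_eq: "p = (x0, t0)" by (metis prod.exhaust)
  have in0: "-1 \<le> x0" "x0 \<le> xb" "s + h \<le> t0" "t0 \<le> t1"
    using p(1) by (auto simp: K_def p_eq)
  have max: "W y t - h * B y \<le> W x0 t0 - h * B x0" if "-1 \<le> y" "y \<le> xb" "s + h \<le> t" "t \<le> t1" for y t
    using p(2)[of "(y, t)"] that by (simp add: K_def E_def p_eq)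
  have osc: "\<bar>u y q - u y' r\<bar> < \<theta> / 8"
    if "y \<in> {-1..1}" "y' \<in> {-1..1}" "s \<le> q" "q \<le> t1" "s \<le> r" "r \<le> t1" "\<bar>y - y'\<bar> < d" "\<bar>q - r\<bar> \<le> h" for y y' q r
    using that s t1 h by (intro d(2)) auto
  have Wle: "W x t \<le> h * k" if "s + h \<le> t" "\<And>r. t - h \<le> r \<Longrightarrow> r \<le> t \<Longrightarrow> u x r \<le> k" for x t k
    using V_le[of "t - h" t x k] that h by (simp add: W_def mult.commute)
  have "h * (\<theta> - \<theta> / 8) \<le> W x' t1"
  proof -
    have "(\<theta> - \<theta> / 8) * (t1 - (t1 - h)) \<le> V (t1 - h) t1 x'"
    proof (rule V_ge)
      fix r assume "t1 - h < r" "r \<le> t1"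
      then have "\<bar>u x' r - u x' t1\<bar> < \<theta> / 8" using x h d(1) by (intro osc) auto
      then show "\<theta> - \<theta> / 8 \<le> u x' r" unfolding \<theta>_def by linarith
    qed (use h in simp)
    then show ?thesis by (simp add: W_def mult.commute)
  qed
  \<comment> \<open>The barrier vanishes at x', so a positive value of u there gives the maximum
    this size.\<close>
  then have big: "h * (\<theta> - \<theta> / 8) \<le> W x0 t0 - h * B x0"
  proof -
    have "W x' t1 - h * B x' \<le> W x0 t0 - h * B x0" using x h by (intro max) auto
    moreover have "h * B x' = 0" by (simp add: B_def)
    ultimately show ?thesis using \<open>h * (\<theta> - \<theta> / 8) \<le> W x' t1\<close> by linarith
  qed
  have h\<theta>: "0 < h * \<theta>" using h \<theta> by simp
  \<comment> \<open>On the initial edge the window begins at s, where u vanishes up to xb; the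
    average is then at most h \<theta> / 8.\<close>
  have t0: "s + h < t0"
  proof (rule ccontr)
    assume "\<not> s + h < t0"
    then have t0: "t0 = s + h" using in0 by simp
    have "W x0 t0 \<le> h * (\<theta> / 8)"
    proof (rule Wle)
      fix r assume "t0 - h \<le> r" "r \<le> t0"
      then have "\<bar>u x0 r - u x0 s\<bar> < \<theta> / 8" using in0 x h t0 d(1) by (intro osc) auto
      then show "u x0 r \<le> \<theta> / 8" using us[of x0] in0 by linarith
    qed (use t0 in simp)
    then show False using big hB[of x0] h\<theta> by (simp add: algebra_simps)
  qed
  have x0: "x0 < xb"
  proof (rule ccontr)
    assume "\<not> x0 < xb"
    then have x0: "x0 = xb" using in0 by simp
    have "W x0 t0 \<le> h * B x0"
    proof (rule Wle)
      fix r assume "t0 - h \<le> r" "r \<le> t0"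
      then show "u x0 r \<le> B x0" using small[of r] in0 t1 x0 by (simp add: B_def)
    qed (use in0 in simp)
    then show False using big h\<theta> by (simp add: algebra_simps)
  qed
  have ux0: "\<theta> * (6/8) \<le> u x0 t0"
  proof -
    have "W x0 t0 \<le> h * (u x0 t0 + \<theta> / 8)"
    proof (rule Wle)
      fix r assume "t0 - h \<le> r" "r \<le> t0"
      then have "\<bar>u x0 r - u x0 t0\<bar> < \<theta> / 8" using in0 x h t0 d(1) by (intro osc) auto
      then show "u x0 r \<le> u x0 t0 + \<theta> / 8" by linarith
    qed (use in0 in simp)
    then have "h * (\<theta> - \<theta> / 8) \<le> h * (u x0 t0 + \<theta> / 8)" using big hB[of x0] by linarith
    then show ?thesis using h by simp
  qed
  have pos: "0 < u y r" if "-1 \<le> y" "y \<le> 1" "\<bar>y - x0\<bar> < d" "t0 - h < r" "r \<le> t0" for y r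
  proof -
    have "\<bar>u y r - u x0 t0\<bar> < \<theta> / 8" using that in0 x h t0 by (intro osc) auto
    then show ?thesis using ux0 \<theta> by linarith
  qed
  have t0': "0 \<le> t0 - h" "t0 - h < t0" "t0 < T" using t0 h s t1 in0 by auto
  define LB where "LB = (\<lambda>x. (c / 20) * (2 * (1 - x\<^sup>2) - 4 * x * (x - x')))"
  have LB: "LB x \<le> c / 2" if "x \<in> {-1..1}" for x
  proof -
    have "- (x * (x - x')) \<le> 2"
    proof -
      have "\<bar>x * (x - x')\<bar> \<le> 1 * 2"
        unfolding abs_mult using that x by (intro mult_mono) auto
      then show ?thesis by linarith
    qed
    have "0 \<le> x\<^sup>2" by simp
    have "2 * (1 - x\<^sup>2) - 4 * x * (x - x') \<le> 10"
    proof -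
      have "2 * (1 - p) - 4 * q \<le> 10" if "- q \<le> 2" "0 \<le> p" for p q :: real
        using that by simp
      from this[OF \<open>- (x * (x - x')) \<le> 2\<close> \<open>0 \<le> x\<^sup>2\<close>] show ?thesis by (simp only: mult.assoc)
    qed
    then have "LB x \<le> (c / 20) * 10" unfolding LB_def using c by (intro mult_left_mono) auto
    then show ?thesis by simp
  qed
  have ff: "flux_form (\<lambda>x. V (t0 - h) t0 x - (h * (c / 20)) * (x - x')\<^sup>2)
      (\<lambda>x. R (t0 - h) t0 x - (h * (c / 20)) * (2 * (1 - x\<^sup>2) - 4 * x * (x - x')) * indicator {-1..1} x)"
    by (rule flux_form_minus[OF flux_form_V[OF t0'] flux_form_parabola])
  \<comment> \<open>\<open>c * h\<close> stands for the time integral of F: near x0 and left of xb,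
    u is positive on the window and g is at most \<open>g xb\<close>.\<close>
  define Gc where "Gc = (\<lambda>x. u x t0 - u x (t0 - h) + c * h - h * LB x)"
  have "Gc x0 \<le> 0"
  proof (rule flux_form_local_max[OF ff, of x0 "min d (xb - x0)"])
    show "x0 \<in> {-1..1}" using in0 x by simp
    show "0 < min d (xb - x0)" using d x0 by simp
    fix y assume y: "y \<in> {-1..1}" "\<bar>y - x0\<bar> < min d (xb - x0)"
    then have "y \<le> xb" by (auto simp: abs_less_iff)
    with y show "V (t0 - h) t0 y - (h * (c / 20)) * (y - x')\<^sup>2 \<le> V (t0 - h) t0 x0 - (h * (c / 20)) * (x0 - x')\<^sup>2"
      using max[of y t0] in0 by (simp add: W_def B_def mult.assoc)
  next
    show "continuous_on UNIV Gc" unfolding Gc_def LB_def by (intro continuous_intros u_cont2)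
    have "Gc y \<le> R (t0 - h) t0 y - (h * (c / 20)) * (2 * (1 - y\<^sup>2) - 4 * y * (y - x')) * indicator {-1..1} y"
      if y: "y \<in> {-1..1}" "\<bar>y - x0\<bar> < min d (xb - x0)" for y
    proof -
      have yb: "y \<le> xb" using y by (auto simp: abs_less_iff)
      have "c * (t0 - (t0 - h)) \<le> J (t0 - h) t0 y"
        unfolding J_def
      proof (rule LINT_indicator_ge[OF F_meas1 F_bdd])
        show "AE r in lborel. r \<in> {t0 - h<..t0} \<longrightarrow> c \<le> F y r"
          using Qg AE_lborel_singleton[of s']
        proof eventually_elim
          case (elim r)
          show ?case
          proof
            assume r: "r \<in> {t0 - h<..t0}"
            then have "u y r > 0" using pos y by auto
            moreover have "s < r" "r < s'" using r t0 in0 t1 elim by auto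
            moreover have "g y * Q r \<le> g xb * Q r"
              using g_mono[of y xb] y yb x Q_pos[of r] by (intro mult_right_mono) auto
            ultimately show "c \<le> F y r" using elim(1) by (simp add: F_eq heaviside_def)
          qed
        qed
      qed (use h in simp)
      then show ?thesis using y by (simp add: Gc_def R_def LB_def mult.assoc)
    qed
    then show "AE y in lborel. y \<in> {-1..1} \<longrightarrow> \<bar>y - x0\<bar> < min d (xb - x0) \<longrightarrow>
        Gc y \<le> R (t0 - h) t0 y - (h * (c / 20)) * (2 * (1 - y\<^sup>2) - 4 * y * (y - x')) * indicator {-1..1} y"
      by simp
  qed
  moreover have "h * LB x0 \<le> h * (c / 2)" using LB[of x0] in0 x h by (intro mult_left_mono) auto
  moreover have "0 \<le> u x0 t0 - u x0 (t0 - h)"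
  proof (rule left_max_deriv_nonneg[OF V_has_derivative[OF h(1)] t0])
    fix r assume "s + h \<le> r" "r \<le> t0"
    then show "V (r - h) r x0 \<le> V (t0 - h) t0 x0" using max[of x0 r] in0 by (simp add: W_def)
  qed
  moreover have "0 < h * c" using h c by simp
  ultimately show False unfolding Gc_def by (simp add: algebra_simps)
qed

text \<open>No sudden extinction on an interval: with \<open>h = t - t\<^sub>1\<close>, the flux \<open>S\<close> of
  \<open>V = \<integral>\<^bsub>(t\<^sub>1,t)\<^esub> u\<close> is nonnegative by monotonicity and satisfies \<open>S'' \<le> - \<kappa> h / g1\<close>, so
  \<open>V\<close> increases by at least a multiple of \<open>h\<close>, whereas \<open>V = o(h)\<close>.\<close>

lemma no_extinction:
  assumes t: "0 < t" "t < T" and ab: "-1 < a" "a < b" "b < 1" and h1: "h1 > 0"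
    and pos: "\<And>s. 0 \<le> s \<Longrightarrow> t - h1 < s \<Longrightarrow> s < t \<Longrightarrow> 0 < u a s"
    and zero: "u b t = 0"
  shows False
proof -
  \<comment> \<open>Quarters of the interval: R has slope at most -k, so the sign of R at the
    midpoint \<mu> decides in which half it is bounded away from 0.\<close>
  define L where "L = (b - a) / 4"
  define \<mu> where "\<mu> = a + 2 * L"
  have "4 * L = b - a" by (simp add: L_def)
  then have L: "0 < L" "\<mu> = b - 2 * L" using ab by (auto simp: \<mu>_def)
  \<comment> \<open>Half of the growth to be derived: V at b will be at least k L^3 = 2 \<epsilon>
    h, while u(b, t) = 0 makes it at most \<epsilon> h.\<close>
  define \<epsilon> where "\<epsilon> = \<kappa> / g1 * L ^ 3 / 2"
  have \<epsilon>: "\<epsilon> > 0" using \<kappa>_pos g1_pos L by (simp add: \<epsilon>_def)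
  obtain d where d: "d > 0" "\<And>x y s t. x \<in> {-1..1} \<Longrightarrow> y \<in> {-1..1} \<Longrightarrow> s \<in> {0..T} \<Longrightarrow> t \<in> {0..T} \<Longrightarrow>
    \<bar>x - y\<bar> < d \<Longrightarrow> \<bar>s - t\<bar> < d \<Longrightarrow> \<bar>u x s - u y t\<bar> < \<epsilon>"
    using u_modulus[OF \<epsilon>] by blast
  define h where "h = min (min (d / 2) h1) t"
  have h: "0 < h" "h < d" "h \<le> h1" "h \<le> t" using d h1 t by (auto simp: h_def min_def)
  define t1 where "t1 = t - h"
  have t1: "0 \<le> t1" "t1 < t" "t - t1 = h" using h by (auto simp: t1_def)
  define S where "S = (\<lambda>x. LBINT y. R t1 t y * indicator {-1..x} y)"
  define k where "k = \<kappa> * h / g1"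
  have k: "k > 0" using \<kappa>_pos g1_pos h by (simp add: k_def)
  have der: "(V t1 t has_real_derivative S x / (1 - x\<^sup>2)) (at x)" if "x \<in> {-1<..<1}" for x
    using flux_form_V[OF t1(1,2) t(2)] that by (auto simp: flux_form_def S_def)
  have w: "0 < 1 - x\<^sup>2" "1 - x\<^sup>2 \<le> 1" if "x \<in> {-1<..<1}" for x :: real
    using that by (auto simp: abs_square_less_1 abs_less_iff)
  have RK: "\<bar>R t1 t x\<bar> \<le> 2 * M + M * (t - t1)" for x using R_bdd[of t1 t x] t1 by simp
  have V_mono: "V t1 t y \<le> V t1 t x" if "-1 \<le> y" "y \<le> x" "x \<le> 1" for x y
  proof -
    have i: "integrable lborel (indicator {t1<..t} :: real \<Rightarrow> real)"
      by (rule integrable_indicator_real) auto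
    have "u y s * indicator {t1<..t} s \<le> u x s * indicator {t1<..t} s" for s
      using u_mono[of s y x] that t1 t by (auto simp: indicator_def)
    then show ?thesis
      unfolding V_def by (intro integral_mono integrable_bounded_mult[OF i _ u_bdd]) auto
  qed
  have S_nonneg: "0 \<le> S x" if x: "x \<in> {-1<..<1}" for x
  proof -
    have "0 \<le> S x / (1 - x\<^sup>2)"
      by (rule mono_deriv_nonneg[OF der[OF x], of "-1"]) (use x V_mono in auto)
    then show ?thesis using w[OF x] by (simp add: zero_le_divide_iff)
  qed
  have zab: "u x t = 0" if "a \<le> x" "x \<le> b" for x
    using u_mono[of t x b] zero u_nonneg[of x t] that t ab by auto
  have RG: "R t1 t x = G t1 t x" if "a \<le> x" "x \<le> b" for x
  proof (rule R_eq_G)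
    fix s assume "t1 < s" "s < t"
    then show "0 < u x s"
      using pos[of s] u_mono[of s a x] that ab t t1 h by (auto simp: t1_def)
  qed (use t1 in simp)
  \<comment> \<open>On [a, b] the term u(x, t) is zero and -u(x, t1) is nonincreasing, so the
    decrease comes from -g A with A at least h / g1.\<close>
  have Rdec: "R t1 t x + k * (x - y) \<le> R t1 t y" if "a \<le> y" "y \<le> x" "x \<le> b" for x y
  proof -
    have "(\<kappa> * (x - y)) * ((1 / g1) * (t - t1)) \<le> (g x - g y) * A t1 t"
    proof (rule mult_mono)
      show "\<kappa> * (x - y) \<le> g x - g y" using that ab by (intro g_slope) auto
      then show "0 \<le> g x - g y" using that \<kappa>_pos mult_nonneg_nonneg[of \<kappa> "x - y"] by linarith
      show "(1 / g1) * (t - t1) \<le> A t1 t" using t1 by (intro A_ge) simp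
    qed (use g1_pos t1 in auto)
    moreover have "(\<kappa> * (x - y)) * ((1 / g1) * (t - t1)) = k * (x - y)"
      using t1 by (simp add: k_def)
    moreover have "u y t1 \<le> u x t1" using u_mono[of t1 y x] that ab t t1 by auto
    ultimately show ?thesis
      using RG[of x] RG[of y] zab[of x] zab[of y] that by (simp add: G_def algebra_simps)
  qed
  \<comment> \<open>Uses V' = S / (1 - x^2) >= S, valid since S >= 0.\<close>
  have grow: "V t1 t y + (k * L * L) * (x - y) \<le> V t1 t x"
    if "y < x" "-1 < y" "x < 1" and S: "\<And>z. y \<le> z \<Longrightarrow> z \<le> x \<Longrightarrow> k * L * L \<le> S z" for x y
  proof -
    have "V t1 t y - (k * L * L) * y \<le> V t1 t x - (k * L * L) * x"
    proof (rule DERIV_nonneg_imp_nondecreasing[where f = "\<lambda>z. V t1 t z - (k * L * L) * z"])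
      fix z assume z: "y \<le> z" "z \<le> x"
      then have z': "z \<in> {-1<..<1}" using that by auto
      have "S z \<le> S z / (1 - z\<^sup>2)"
        using S_nonneg[OF z'] w[OF z'] by (simp add: le_divide_eq mult_left_le)
      moreover have "((\<lambda>z. V t1 t z - (k * L * L) * z) has_real_derivative S z / (1 - z\<^sup>2) - k * L * L) (at z)"
        by (auto intro!: derivative_eq_intros der[OF z'])
      ultimately show "\<exists>D. ((\<lambda>z. V t1 t z - (k * L * L) * z) has_real_derivative D) (at z) \<and> 0 \<le> D"
        using S[OF z] by (intro exI[of _ "S z / (1 - z\<^sup>2) - k * L * L"]) auto
    qed (use that in simp)
    then show ?thesis by (simp add: algebra_simps)
  qed
  have S_diff: "S y - S x = (LBINT z. R t1 t z * indicator {x<..y} z)" if "-1 \<le> x" "x \<le> y" for x y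
    unfolding S_def by (rule LINT_indicator_diff[OF R_meas RK that])
  have V_nn: "0 \<le> V t1 t x" for x
    using V_ge[of t1 t 0 x] u_nonneg t1 by simp
  \<comment> \<open>If R is nonnegative at \<mu>, it is at least k L on the first quarter, and S,
    nonnegative at a, is at least k L^2 on the second. Otherwise -R is at least k L on the last
    quarter, and integrating back from S b >= 0 gives the same bound on the third.\<close>
  have "k * L * L * L \<le> V t1 t b"
  proof (cases "0 \<le> R t1 t \<mu>")
    case True
    have "k * L * L \<le> S z" if z: "a + L \<le> z" "z \<le> \<mu>" for z
    proof -
      have "(k * L) * ((a + L) - a) \<le> (LBINT z. R t1 t z * indicator {a<..a + L} z)"
      proof (rule LINT_indicator_ge[OF R_meas RK])
        have "k * L \<le> R t1 t y" if "a < y" "y \<le> a + L" for y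
        proof -
          have "k * L \<le> k * (\<mu> - y)" using k that by (intro mult_left_mono) (auto simp: \<mu>_def)
          then show ?thesis using Rdec[of y \<mu>] True that L by (simp add: \<mu>_def)
        qed
        then show "AE y in lborel. y \<in> {a<..a + L} \<longrightarrow> k * L \<le> R t1 t y" by simp
      qed (use L in simp)
      moreover have "0 * (z - (a + L)) \<le> (LBINT y. R t1 t y * indicator {a + L<..z} y)"
      proof (rule LINT_indicator_ge[OF R_meas RK])
        have "0 \<le> R t1 t y" if "a + L < y" "y \<le> z" for y
        proof -
          have "0 \<le> k * (\<mu> - y)" using k that z by simp
          then show ?thesis using Rdec[of y \<mu>] True that z L by simp
        qed
        then show "AE y in lborel. y \<in> {a + L<..z} \<longrightarrow> 0 \<le> R t1 t y" by simp
      qed (use z in simp)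
      moreover have "0 \<le> S a" using S_nonneg ab by simp
      ultimately show ?thesis using S_diff[of a "a + L"] S_diff[of "a + L" z] ab L z by simp
    qed
    then have "V t1 t (a + L) + (k * L * L) * (\<mu> - (a + L)) \<le> V t1 t \<mu>"
      by (intro grow) (use ab L in \<open>auto simp: \<mu>_def\<close>)
    moreover have "\<mu> - (a + L) = L" by (simp add: \<mu>_def)
    moreover have "V t1 t \<mu> \<le> V t1 t b" using L ab by (intro V_mono) (auto simp: \<mu>_def)
    ultimately show ?thesis using V_nn[of "a + L"] by simp
  next
    case False
    have "k * L * L \<le> S z" if z: "\<mu> \<le> z" "z \<le> b - L" for z
    proof -
      have "(k * L) * (b - (b - L)) \<le> (LBINT z. - R t1 t z * indicator {b - L<..b} z)"
      proof (rule LINT_indicator_ge[where K = "2 * M + M * (t - t1)"])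
        have "k * L \<le> - R t1 t y" if "b - L < y" "y \<le> b" for y
        proof -
          have "k * L \<le> k * (y - \<mu>)" using k that L by (intro mult_left_mono) auto
          then show ?thesis using Rdec[of \<mu> y] False that L ab by (simp add: \<mu>_def)
        qed
        then show "AE y in lborel. y \<in> {b - L<..b} \<longrightarrow> k * L \<le> - R t1 t y" by simp
      qed (use L RK in auto)
      moreover have "0 * (b - L - z) \<le> (LBINT y. - R t1 t y * indicator {z<..b - L} y)"
      proof (rule LINT_indicator_ge[where K = "2 * M + M * (t - t1)"])
        have "0 \<le> - R t1 t y" if "z < y" "y \<le> b - L" for y
        proof -
          have "0 \<le> k * (y - \<mu>)" using k that z by simp
          then show ?thesis using Rdec[of \<mu> y] False that z L ab by (simp add: \<mu>_def)
        qed
        then show "AE y in lborel. y \<in> {z<..b - L} \<longrightarrow> 0 \<le> - R t1 t y" by simp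
      qed (use z RK in auto)
      moreover have "0 \<le> S b" using S_nonneg ab by simp
      moreover have "-1 \<le> z" using z ab L by (auto simp: \<mu>_def)
      ultimately show ?thesis using S_diff[of z "b - L"] S_diff[of "b - L" b] ab L z by simp
    qed
    then have "V t1 t \<mu> + (k * L * L) * (b - L - \<mu>) \<le> V t1 t (b - L)"
      by (intro grow) (use ab L in \<open>auto simp: \<mu>_def\<close>)
    moreover have "b - L - \<mu> = L" using L by simp
    moreover have "V t1 t (b - L) \<le> V t1 t b" using L ab by (intro V_mono) (auto simp: \<mu>_def)
    ultimately show ?thesis using V_nn[of \<mu>] by simp
  qed
  moreover have "V t1 t b \<le> \<epsilon> * (t - t1)"
  proof (rule V_le)
    fix s assume s: "t1 < s" "s \<le> t"
    then have "\<bar>u b s - u b t\<bar> < \<epsilon>" using ab t t1 h d(1) by (intro d(2)) auto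
    then show "u b s \<le> \<epsilon>" using zero by simp
  qed (use t1 in simp)
  moreover have "k * L * L * L = 2 * (\<epsilon> * h)"
    by (simp add: k_def \<epsilon>_def power3_eq_cube)
  moreover have "0 < \<epsilon> * h" using \<epsilon> h by simp
  ultimately show False using t1 by simp
qed

end

subsection \<open>Continuity of the free boundary\<close>

context obstacle
begin

abbreviation p :: "real \<Rightarrow> real" where
  "p \<equiv> free_boundary u"

lemma continuity_at_time:
  assumes "e > 0"
  obtains d where "d > 0" "\<And>\<tau>. \<bar>\<tau> - t\<bar> < d \<Longrightarrow> \<bar>u x \<tau> - u x t\<bar> < e"
  using u_cont1[of x] assms unfolding continuous_on_iff dist_real_def by (metis UNIV_I)

context
  fixes t :: real
  assumes t: "0 \<le> t" "t < T"
begin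

lemma support_nonempty: "1 \<in> {x\<in>{-1..1}. u x t > 0}"
  using u_pos_at_1[OF t] by simp

lemma support_bdd: "bdd_below {x\<in>{-1..1}. u x t > 0}"
  by (rule bdd_belowI[of _ "-1"]) auto

lemma p_bounds: "p t \<in> {-1..1}"
  using cInf_lower[OF support_nonempty support_bdd] cInf_greatest[of "{x\<in>{-1..1}. u x t > 0}" "-1"]
    support_nonempty
  unfolding free_boundary_def by fastforce

lemma p_le: "x \<in> {-1..1} \<Longrightarrow> 0 < u x t \<Longrightarrow> p t \<le> x"
  unfolding free_boundary_def by (rule cInf_lower[OF _ support_bdd]) simp

lemma p_zero: "-1 \<le> x \<Longrightarrow> x < p t \<Longrightarrow> u x t = 0"
  using p_le[of x] p_bounds u_nonneg[of x t] by force

lemma p_pos: "p t < x \<Longrightarrow> x \<le> 1 \<Longrightarrow> 0 < u x t"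
proof -
  assume x: "p t < x" "x \<le> 1"
  have "{x\<in>{-1..1}. u x t > 0} \<noteq> {}" using support_nonempty by blast
  then obtain y where y: "y \<in> {x\<in>{-1..1}. u x t > 0}" "y < x"
    using x(1) cInf_less_iff[OF _ support_bdd] unfolding free_boundary_def by blast
  then show ?thesis using u_mono[OF t, of y x] x by auto
qed

lemma positive_near_1:
  obtains d \<delta> where "d > 0" "\<delta> > 0" "\<And>x \<tau>. x \<in> {1 - d..1} \<Longrightarrow> 0 \<le> \<tau> \<Longrightarrow> \<tau> < T \<Longrightarrow> \<bar>\<tau> - t\<bar> < \<delta> \<Longrightarrow> 0 < u x \<tau>"
proof -
  define e where "e = u 1 t"
  have e: "e > 0" using u_pos_at_1[OF t] by (simp add: e_def)
  obtain d where d: "d > 0" "\<And>x y s t. x \<in> {-1..1} \<Longrightarrow> y \<in> {-1..1} \<Longrightarrow> s \<in> {0..T} \<Longrightarrow> t \<in> {0..T} \<Longrightarrow>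
    \<bar>x - y\<bar> < d \<Longrightarrow> \<bar>s - t\<bar> < d \<Longrightarrow> \<bar>u x s - u y t\<bar> < e"
    using u_modulus[OF e] by blast
  show ?thesis
  proof (rule that[of "min (d / 2) 1" d])
    fix x \<tau> assume *: "x \<in> {1 - min (d / 2) 1..1}" "0 \<le> \<tau>" "\<tau> < T" "\<bar>\<tau> - t\<bar> < d"
    have "x - 1 < d" "1 - x < d" "-1 \<le> x" using * d(1) by (auto simp: min_def split: if_splits)
    then have "\<bar>u x \<tau> - u 1 t\<bar> < e"
      using * t by (intro d(2)) auto
    then show "0 < u x \<tau>" unfolding e_def by linarith
  qed (use d in auto)
qed

lemma p_less_1: "p t < 1"
proof -
  obtain d \<delta> where d: "d > 0" "\<delta> > 0" "\<And>x \<tau>. x \<in> {1 - d..1} \<Longrightarrow> 0 \<le> \<tau> \<Longrightarrow> \<tau> < T \<Longrightarrow> \<bar>\<tau> - t\<bar> < \<delta> \<Longrightarrow> 0 < u x \<tau>"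
    using positive_near_1 by blast
  have "p t \<le> max (1 - d) 0" using d t by (intro p_le) auto
  then show ?thesis using d by auto
qed

end

text \<open>\<open>\<lambda>(t)\<close> exceeds \<open>g\<close> at the left end of \<open>{u(\<cdot>,t) > 0}\<close> by a fixed amount, because \<open>g' \<ge> \<kappa>\<close>.\<close>

lemma average_exceeds_left_value:
  assumes a: "-1 \<le> a" "a \<le> 1 - 2 * d" "0 < d"
  shows "AE \<tau> in lborel. 0 < \<tau> \<longrightarrow> \<tau> < T \<longrightarrow> (\<forall>x\<in>{-1..1}. 0 < u x \<tau> \<longrightarrow> a \<le> x) \<longrightarrow>
    (\<forall>x\<in>{1 - d..1}. 0 < u x \<tau>) \<longrightarrow> Q \<tau> * (\<kappa> * d\<^sup>2 / 2) \<le> 1 - Q \<tau> * g a"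
  using mass_balance
proof eventually_elim
  case (elim \<tau>)
  show ?case
  proof (intro impI)
    assume \<tau>: "0 < \<tau>" "\<tau> < T" and left: "\<forall>x\<in>{-1..1}. 0 < u x \<tau> \<longrightarrow> a \<le> x"
      and right: "\<forall>x\<in>{1 - d..1}. 0 < u x \<tau>"
    define H where "H = (\<lambda>x. heaviside (u x \<tau>))"
    have [measurable]: "heaviside \<in> borel_measurable borel"
      unfolding heaviside_def[abs_def] by measurable
    have [measurable]: "H \<in> borel_measurable borel" unfolding H_def by measurable
    have H01: "0 \<le> H x" "H x \<le> 1" for x by (auto simp: H_def heaviside_def)
    have i: "integrable lborel (indicator {-1..1} :: real \<Rightarrow> real)" "integrable lborel (indicator {1 - d..1} :: real \<Rightarrow> real)"
      by (auto intro: integrable_indicator_real)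
    have iH: "integrable lborel (\<lambda>x. H x * indicator {-1..1} x)"
      by (rule integrable_bounded_mult[OF i(1), where K = 1]) (use H01 in auto)
    define m where "m = (LBINT x. H x * indicator {-1..1} x)"
    define c where "c = 1 - Q \<tau> * g a"
    have Q: "0 < Q \<tau>" by (rule Q_pos)
    have "m \<le> (LBINT x. indicator {-1..1::real} x)"
      unfolding m_def by (rule integral_mono[OF iH i(1)]) (use H01 in \<open>auto simp: indicator_def\<close>)
    then have m: "m \<le> 2" by simp
    have m0: "0 \<le> m"
      unfolding m_def by (rule Bochner_Integration.integral_nonneg) (use H01 in auto)
    have "0 = (LBINT x. F x \<tau> * indicator {-1..1} x)" using elim \<tau> by simp
    \<comment> \<open>On the positivity set 1 - g Q is at most c, with the additional gain Q
      \<kappa> d on [1 - d, 1], where x - a >= d. Since m <= 2, integration gives the factor 1/2 in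
      the claim.\<close>
    also have "\<dots> \<le> (LBINT x. c * (H x * indicator {-1..1} x) - (Q \<tau> * (\<kappa> * d)) * indicator {1 - d..1} x)"
    proof (rule integral_mono)
      show "integrable lborel (\<lambda>x. F x \<tau> * indicator {-1..1} x)"
        by (rule integrable_bounded_mult[OF i(1) _ F_bdd]) simp
      show "integrable lborel (\<lambda>x. c * (H x * indicator {-1..1} x) - (Q \<tau> * (\<kappa> * d)) * indicator {1 - d..1} x)"
        using iH i(2) by simp
      fix x
      show "F x \<tau> * indicator {-1..1} x \<le> c * (H x * indicator {-1..1} x) - (Q \<tau> * (\<kappa> * d)) * indicator {1 - d..1} x"
      proof (cases "x \<in> {-1..1} \<and> 0 < u x \<tau>")
        case True
        then have ax: "a \<le> x" using left by blast
        have "\<kappa> * (x - a) \<le> g x - g a" using ax a True by (intro g_slope) auto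
        moreover have "(\<kappa> * d) * indicator {1 - d..1} x \<le> \<kappa> * (x - a)"
          using a ax \<kappa>_pos by (auto simp: indicator_def intro!: mult_left_mono)
        ultimately have "Q \<tau> * ((\<kappa> * d) * indicator {1 - d..1} x) \<le> Q \<tau> * (g x - g a)"
          using Q by (intro mult_left_mono) auto
        then show ?thesis using True by (simp add: F_eq H_def heaviside_def c_def algebra_simps)
      next
        case False
        then have "x \<notin> {1 - d..1}" using right a by force
        then show ?thesis using False by (auto simp: F_eq H_def heaviside_def indicator_def)
      qed
    qed
    also have "\<dots> = (LBINT x. c * (H x * indicator {-1..1} x)) - (LBINT x. (Q \<tau> * (\<kappa> * d)) * indicator {1 - d..1} x)"
      using iH i(2) by (intro Bochner_Integration.integral_diff) auto
    also have "\<dots> = c * m - Q \<tau> * (\<kappa> * d) * d" using a by (simp add: m_def)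
    finally have cm: "Q \<tau> * (\<kappa> * d) * d \<le> c * m" by simp
    moreover have "0 < Q \<tau> * (\<kappa> * d) * d" using Q \<kappa>_pos a by simp
    ultimately have "0 < c * m" by linarith
    then have "0 < c" using m0 by (simp add: zero_less_mult_iff)
    then have "c * m \<le> c * 2" using m by (intro mult_left_mono) auto
    with cm show "Q \<tau> * (\<kappa> * d\<^sup>2 / 2) \<le> 1 - Q \<tau> * g a"
      by (simp add: c_def power2_eq_square mult.assoc)
  qed
qed

text \<open>Lower semicontinuity of the free boundary. Zeros are traced to the supremum
  \<open>ps\<close> of the points where they persist near t; just to the right of it,
  \<open>zero_persists\<close> rules out positivity after t and \<open>no_extinction\<close> rules
  out positivity before t.\<close>

lemma zero_left_of_p_persists:
  assumes t: "0 \<le> t" "t < T" and xh: "-1 \<le> xh" "xh < p t"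
  shows "\<exists>\<delta>>0. \<forall>\<tau>. 0 \<le> \<tau> \<longrightarrow> \<tau> < T \<longrightarrow> \<bar>\<tau> - t\<bar> < \<delta> \<longrightarrow> u xh \<tau> = 0"
proof (rule ccontr)
  assume nz: "\<not> ?thesis"
  define X where "X = {x\<in>{-1..1}. \<exists>\<delta>>0. \<forall>\<tau>. 0 \<le> \<tau> \<longrightarrow> \<tau> < T \<longrightarrow> \<bar>\<tau> - t\<bar> < \<delta> \<longrightarrow> u x \<tau> = 0}"
  have down: "y \<in> X" if "x \<in> X" "-1 \<le> y" "y \<le> x" for x y
  proof -
    obtain \<delta> where \<delta>: "\<delta> > 0" "\<And>\<tau>. 0 \<le> \<tau> \<Longrightarrow> \<tau> < T \<Longrightarrow> \<bar>\<tau> - t\<bar> < \<delta> \<Longrightarrow> u x \<tau> = 0"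
      using \<open>x \<in> X\<close> unfolding X_def by blast
    have "u y \<tau> = 0" if "0 \<le> \<tau>" "\<tau> < T" "\<bar>\<tau> - t\<bar> < \<delta>" for \<tau>
      using u_mono[of \<tau> y x] u_nonneg[of y \<tau>] \<delta>(2)[OF that] that \<open>x \<in> X\<close> \<open>-1 \<le> y\<close> \<open>y \<le> x\<close>
      by (auto simp: X_def)
    then show ?thesis using \<delta>(1) that by (auto simp: X_def)
  qed
  have pt: "p t \<in> {-1..1}" "p t < 1" using p_bounds[OF t] p_less_1[OF t] by auto
  have "xh \<notin> X" using nz by (auto simp: X_def)
  then have X_le: "x \<le> xh" if "x \<in> X" for x using down[OF that xh(1)] by linarith
  \<comment> \<open>Inserting -1 covers the case that no zero persists at all.\<close>
  define ps where "ps = Sup (insert (-1) X)"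
  have bdd: "bdd_above (insert (-1) X)" by (rule bdd_aboveI[of _ 1]) (auto simp: X_def)
  have ps: "-1 \<le> ps" "ps \<le> xh"
    unfolding ps_def using bdd X_le xh by (auto intro: cSup_upper cSup_least)
  have notX: "x \<notin> X" if "ps < x" for x
    using cSup_upper[OF _ bdd, of x] that by (auto simp: ps_def)
  obtain d1 \<delta>1 where d1: "d1 > 0" "\<delta>1 > 0"
      "\<And>x \<tau>. x \<in> {1 - d1..1} \<Longrightarrow> 0 \<le> \<tau> \<Longrightarrow> \<tau> < T \<Longrightarrow> \<bar>\<tau> - t\<bar> < \<delta>1 \<Longrightarrow> 0 < u x \<tau>"
    using positive_near_1[OF t] by blast
  \<comment> \<open>Half of d1 and half of 1 - p t: the interval [1 - d, 1] stays positive near t,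
    and a <= 1 - 2 d as required by \<open>average_exceeds_left_value\<close>.\<close>
  define d where "d = min d1 (1 - p t) / 2"
  have d: "d > 0" "2 * d \<le> 1 - p t" "2 * d \<le> d1" using d1 pt by (auto simp: d_def)
  \<comment> \<open>The gap there is \<kappa> d^2 / 2 = 4 k. Passing from a to xb costs at most 2 k,
    because both lie within \<eta> of ps, and leaves 2 k for the constant c.\<close>
  define k where "k = \<kappa> * d\<^sup>2 / 8"
  have k: "k > 0" using \<kappa>_pos d by (simp add: k_def)
  obtain \<eta> where \<eta>: "\<eta> > 0" "\<And>x. \<bar>x - ps\<bar> < \<eta> \<Longrightarrow> \<bar>g x - g ps\<bar> < k"
    using g_cont k unfolding continuous_on_iff dist_real_def by (metis UNIV_I)
  \<comment> \<open>Left of ps, so that zeros at a persist unless a = -1. By contrast xb and x' are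
    right of ps: x' is outside X, yet u(xb, t) = 0 because xb < p t.\<close>
  define a where "a = max (-1) (ps - \<eta> / 2)"
  define xb where "xb = ps + min (\<eta> / 2) ((p t - ps) / 2)"
  define x' where "x' = (ps + xb) / 2"
  have a: "-1 \<le> a" "a \<le> ps" "\<bar>a - ps\<bar> < \<eta>" using \<eta> ps by (auto simp: a_def max_def)
  have gap: "0 < p t - ps" using ps xh by simp
  have xb: "ps < xb" "xb < p t" "\<bar>xb - ps\<bar> < \<eta>"
  proof -
    define q where "q = min (\<eta> / 2) ((p t - ps) / 2)"
    have q: "q \<le> \<eta> / 2" "q \<le> (p t - ps) / 2" unfolding q_def by (rule min.cobounded1 min.cobounded2)+
    have "0 < q" using \<eta> gap by (simp add: q_def)
    have "xb = ps + q" by (simp add: xb_def q_def)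
    then show "ps < xb" "xb < p t" "\<bar>xb - ps\<bar> < \<eta>"
      using q \<open>0 < q\<close> gap \<eta>(1) by auto
  qed
  have x': "ps < x'" "x' < xb" using xb by (auto simp: x'_def)
  have gxa: "g xb - g a \<le> 2 * k" using \<eta>(2)[OF a(3)] \<eta>(2)[OF xb(3)] by linarith
  have "\<exists>\<delta>>0. \<forall>\<tau>. 0 \<le> \<tau> \<longrightarrow> \<tau> < T \<longrightarrow> \<bar>\<tau> - t\<bar> < \<delta> \<longrightarrow> (\<forall>x\<in>{-1..1}. 0 < u x \<tau> \<longrightarrow> a \<le> x)"
  proof (cases "a = -1")
    case True
    then show ?thesis by (auto intro: exI[of _ 1])
  next
    case False
    then have "a < ps" using \<eta> by (auto simp: a_def max_def split: if_splits)
    then obtain x where "x \<in> insert (-1) X" "a < x"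
      using less_cSup_iff[OF _ bdd, of a] by (auto simp: ps_def)
    then have "a \<in> X" using a down[of x a] by auto
    then obtain \<delta> where \<delta>: "\<delta> > 0" "\<And>\<tau>. 0 \<le> \<tau> \<Longrightarrow> \<tau> < T \<Longrightarrow> \<bar>\<tau> - t\<bar> < \<delta> \<Longrightarrow> u a \<tau> = 0"
      unfolding X_def by blast
    have "a \<le> x" if "0 \<le> \<tau>" "\<tau> < T" "\<bar>\<tau> - t\<bar> < \<delta>" "x \<in> {-1..1}" "0 < u x \<tau>" for x \<tau>
    proof (rule ccontr)
      assume "\<not> a \<le> x"
      then have "u x \<tau> \<le> u a \<tau>" using that a ps xh pt by (intro u_mono) auto
      then show False using \<delta>(2)[OF that(1-3)] that(5) by simp
    qed
    then show ?thesis using \<delta>(1) by blast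
  qed
  then obtain \<delta>2 where \<delta>2: "\<delta>2 > 0"
      "\<And>\<tau> x. 0 \<le> \<tau> \<Longrightarrow> \<tau> < T \<Longrightarrow> \<bar>\<tau> - t\<bar> < \<delta>2 \<Longrightarrow> x \<in> {-1..1} \<Longrightarrow> 0 < u x \<tau> \<Longrightarrow> a \<le> x"
    by blast
  define c where "c = (1 / g1) * (2 * k)"
  have c: "c > 0" using k g1_pos by (simp add: c_def)
  have "a \<le> 1 - 2 * d" using a ps xh d by linarith
  note Qa = average_exceeds_left_value[OF a(1) this d(1)]
  have Qg: "AE r in lborel. 0 < r \<longrightarrow> r < T \<longrightarrow> \<bar>r - t\<bar> < min \<delta>1 \<delta>2 \<longrightarrow> c \<le> 1 - g xb * Q r"
    using Qa
  proof eventually_elim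
    case (elim r)
    show ?case
    proof (intro impI)
      assume r: "0 < r" "r < T" "\<bar>r - t\<bar> < min \<delta>1 \<delta>2"
      have "\<forall>x\<in>{-1..1}. 0 < u x r \<longrightarrow> a \<le> x" using \<delta>2(2)[of r] r by auto
      moreover have "\<forall>x\<in>{1 - d..1}. 0 < u x r" using d1(3)[of _ r] r d by auto
      ultimately have 1: "Q r * (4 * k) \<le> 1 - Q r * g a"
        using elim r by (simp add: k_def)
      have 2: "Q r * (g xb - g a) \<le> Q r * (2 * k)"
        using gxa Q_pos[of r] by (intro mult_left_mono) auto
      have 3: "c \<le> Q r * (2 * k)"
        unfolding c_def using Q_bds(1)[of r] k by (intro mult_right_mono) auto
      show "c \<le> 1 - g xb * Q r" using 1 2 3 by (simp add: algebra_simps)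
    qed
  qed
  define B where "B = (c / 20) * (xb - x')\<^sup>2"
  have B: "B > 0" using c x' by (simp add: B_def)
  have uxb: "u xb t = 0" using p_zero[OF t, of xb] xb ps by auto
  obtain \<delta>3 where \<delta>3: "\<delta>3 > 0" "\<And>\<tau>. \<bar>\<tau> - t\<bar> < \<delta>3 \<Longrightarrow> \<bar>u xb \<tau> - u xb t\<bar> < B"
    using continuity_at_time[OF B] by blast
  define \<delta> where "\<delta> = min (min \<delta>1 \<delta>2) \<delta>3"
  have \<delta>: "\<delta> > 0" "\<delta> \<le> min \<delta>1 \<delta>2" "\<delta> \<le> \<delta>3" using d1 \<delta>2 \<delta>3 by (auto simp: \<delta>_def)
  have persist: "u x' \<tau> = 0" if "0 \<le> s" "s \<le> \<tau>" "\<tau> < T" "\<bar>s - t\<bar> < \<delta>" "\<bar>\<tau> - t\<bar> < \<delta>" "u xb s = 0" for s \<tau>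
  proof (rule zero_persists[of s \<tau> x' xb c])
    show "AE r in lborel. s < r \<longrightarrow> r < \<tau> \<longrightarrow> c \<le> 1 - g xb * Q r"
      using Qg
    proof eventually_elim
      case (elim r)
      show ?case
      proof (intro impI)
        assume "s < r" "r < \<tau>"
        then show "c \<le> 1 - g xb * Q r" using elim that \<delta>(2) by (auto simp: abs_less_iff)
      qed
    qed
    show "u xb r \<le> (c / 20) * (xb - x')\<^sup>2" if "s \<le> r" "r \<le> \<tau>" for r
      using \<delta>3(2)[of r] uxb \<delta>(3) that \<open>\<bar>s - t\<bar> < \<delta>\<close> \<open>\<bar>\<tau> - t\<bar> < \<delta>\<close> by (auto simp: B_def abs_less_iff)
  qed (use that x' ps xb pt c in auto)
  \<comment> \<open>As x' is not in X, positive values of u(x', .) occur arbitrarily close to t;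
    \<open>persist\<close> started at time t itself excludes those from t on.\<close>
  have freq: "\<exists>\<tau>. 0 \<le> \<tau> \<and> \<tau> < t \<and> \<bar>\<tau> - t\<bar> < \<rho> \<and> 0 < u x' \<tau>" if \<rho>: "\<rho> > 0" for \<rho>
  proof -
    have "x' \<notin> X" by (rule notX[OF x'(1)])
    moreover have "x' \<in> {-1..1}" using x' ps xb pt by auto
    moreover have "0 < min \<rho> \<delta>" using \<rho> \<delta>(1) by simp
    ultimately have "\<not> (\<forall>\<tau>. 0 \<le> \<tau> \<longrightarrow> \<tau> < T \<longrightarrow> \<bar>\<tau> - t\<bar> < min \<rho> \<delta> \<longrightarrow> u x' \<tau> = 0)"
      unfolding X_def by blast
    then obtain \<tau> where \<tau>: "0 \<le> \<tau>" "\<tau> < T" "\<bar>\<tau> - t\<bar> < min \<rho> \<delta>" "u x' \<tau> \<noteq> 0"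
      by blast
    have "\<tau> < t"
    proof (rule ccontr)
      assume "\<not> \<tau> < t"
      then show False using persist[of t \<tau>] \<tau> t uxb \<delta>(1) by auto
    qed
    then show ?thesis using \<tau> u_nonneg[of x' \<tau>] by (intro exI[of _ \<tau>]) auto
  qed
  have t_pos: "0 < t" using freq[of 1] by auto
  define b where "b = (xb + p t) / 2"
  have b: "xb < b" "b < p t" using xb by (auto simp: b_def)
  show False
  proof (rule no_extinction[OF t_pos t(2), of xb b \<delta>])
    show "u b t = 0" using p_zero[OF t, of b] b xb ps by auto
    fix s assume s: "0 \<le> s" "t - \<delta> < s" "s < t"
    obtain \<tau> where \<tau>: "0 \<le> \<tau>" "\<tau> < t" "\<bar>\<tau> - t\<bar> < t - s" "0 < u x' \<tau>"
      using freq[of "t - s"] s by auto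
    \<comment> \<open>A zero at (xb, s) would persist at x' up to t, against the positive value at a
      later time found by \<open>freq\<close>. So u(xb, .) is positive on an entire interval before
      t, as \<open>no_extinction\<close> requires.\<close>
    show "0 < u xb s"
    proof (rule ccontr)
      assume "\<not> 0 < u xb s"
      then have "u xb s = 0" using u_nonneg[of xb s] by linarith
      then have "u x' \<tau> = 0"
        using \<tau> s t by (intro persist[of s]) (auto simp: abs_less_iff)
      then show False using \<tau> by simp
    qed
  qed (use b xb ps pt \<delta> in auto)
qed

theorem free_boundary_continuous: "continuous_on {0..<T} p"
  unfolding continuous_on_iff
proof (intro ballI allI impI)
  fix t e :: real assume "t \<in> {0..<T}" and e: "0 < e"
  then have t: "0 \<le> t" "t < T" by auto
  have "\<exists>\<delta>>0. \<forall>\<tau>. 0 \<le> \<tau> \<longrightarrow> \<tau> < T \<longrightarrow> \<bar>\<tau> - t\<bar> < \<delta> \<longrightarrow> p \<tau> < p t + e"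
  proof -
    define x where "x = min 1 (p t + e / 2)"
    have x: "p t < x" "x \<le> 1" "x < p t + e" "-1 \<le> x"
      using p_less_1[OF t] p_bounds[OF t] e by (auto simp: x_def)
    obtain \<delta> where \<delta>: "\<delta> > 0" "\<And>\<tau>. \<bar>\<tau> - t\<bar> < \<delta> \<Longrightarrow> \<bar>u x \<tau> - u x t\<bar> < u x t"
      using continuity_at_time[OF p_pos[OF t x(1,2)]] by blast
    have "p \<tau> < p t + e" if "0 \<le> \<tau>" "\<tau> < T" "\<bar>\<tau> - t\<bar> < \<delta>" for \<tau>
    proof -
      have "0 < u x \<tau>" using \<delta>(2)[OF that(3)] by linarith
      then have "p \<tau> \<le> x" using x that by (intro p_le) auto
      then show ?thesis using x by simp
    qed
    then show ?thesis using \<delta>(1) by blast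
  qed
  then obtain \<delta>1 where \<delta>1: "\<delta>1 > 0" "\<And>\<tau>. 0 \<le> \<tau> \<Longrightarrow> \<tau> < T \<Longrightarrow> \<bar>\<tau> - t\<bar> < \<delta>1 \<Longrightarrow> p \<tau> < p t + e"
    by blast
  have "\<exists>\<delta>>0. \<forall>\<tau>. 0 \<le> \<tau> \<longrightarrow> \<tau> < T \<longrightarrow> \<bar>\<tau> - t\<bar> < \<delta> \<longrightarrow> p t - e < p \<tau>"
  proof (cases "p t - e / 2 < -1")
    case True
    have "p t - e < p \<tau>" if "0 \<le> \<tau>" "\<tau> < T" for \<tau>
      using p_bounds[OF that] True e by auto
    then show ?thesis by (intro exI[of _ 1]) auto
  next
    case False
    then obtain \<delta> where \<delta>: "\<delta> > 0" "\<And>\<tau>. 0 \<le> \<tau> \<Longrightarrow> \<tau> < T \<Longrightarrow> \<bar>\<tau> - t\<bar> < \<delta> \<Longrightarrow> u (p t - e / 2) \<tau> = 0"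
      using zero_left_of_p_persists[OF t, of "p t - e / 2"] e by auto
    have "p t - e < p \<tau>" if "0 \<le> \<tau>" "\<tau> < T" "\<bar>\<tau> - t\<bar> < \<delta>" for \<tau>
    proof (rule ccontr)
      assume "\<not> p t - e < p \<tau>"
      then have "0 < u (p t - e / 2) \<tau>" using that e p_bounds[OF t] by (intro p_pos) auto
      then show False using \<delta>(2)[OF that] by simp
    qed
    then show ?thesis using \<delta>(1) by blast
  qed
  then obtain \<delta>2 where \<delta>2: "\<delta>2 > 0" "\<And>\<tau>. 0 \<le> \<tau> \<Longrightarrow> \<tau> < T \<Longrightarrow> \<bar>\<tau> - t\<bar> < \<delta>2 \<Longrightarrow> p t - e < p \<tau>"
    by blast
  show "\<exists>d>0. \<forall>\<tau>\<in>{0..<T}. dist \<tau> t < d \<longrightarrow> dist (p \<tau>) (p t) < e"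
  proof (intro exI[of _ "min \<delta>1 \<delta>2"] conjI ballI impI)
    fix \<tau> assume \<tau>: "\<tau> \<in> {0..<T}" "dist \<tau> t < min \<delta>1 \<delta>2"
    then show "dist (p \<tau>) (p t) < e"
      using \<delta>1(2)[of \<tau>] \<delta>2(2)[of \<tau>] by (auto simp: dist_real_def abs_less_iff)
  qed (use \<delta>1 \<delta>2 in simp)
qed

end

subsection \<open>Extension of the solution beyond its domain\<close>

lemma AE_lebesgue_on_iff:
  fixes S :: "'a::euclidean_space set"
  assumes "open S"
  shows "(AE x in lebesgue_on S. P x) \<longleftrightarrow> (AE x in lborel. x \<in> S \<longrightarrow> P x)"
  using assms by (subst AE_restrict_space_iff) (auto simp: AE_completion_iff)

lemma AE_lborel_snd:
  assumes "AE t in lborel. P t"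
  shows "AE p in (lborel :: (real \<times> real) measure). P (snd p)"
proof -
  obtain N where N: "{t. \<not> P t} \<subseteq> N" "N \<in> null_sets lborel"
    using assms by (auto elim!: AE_E simp: null_sets_def)
  have "emeasure (lborel \<Otimes>\<^sub>M lborel) ((UNIV :: real set) \<times> N) = emeasure lborel (UNIV :: real set) * emeasure lborel N"
    by (rule lborel.emeasure_pair_measure_Times) (use N in auto)
  then have "UNIV \<times> N \<in> null_sets (lborel \<Otimes>\<^sub>M lborel :: (real \<times> real) measure)"
    using N by (auto simp: null_sets_def)
  then have "UNIV \<times> N \<in> null_sets (lborel :: (real \<times> real) measure)"
    by (simp add: lborel_prod)
  then show ?thesis
    by (rule AE_I') (use N in auto)
qed

text \<open>Differentiability of \<open>u\<close> inside \<open>(-1,1)\<close> is read off along the ray \<open>r e\<^sub>1\<close> of the chart,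
  on which \<open>x = (r\<^sup>2 - 1) / (r\<^sup>2 + 1)\<close>.\<close>

lemma C2_axs_has_derivative:
  assumes "C2_axs v"
  obtains D where "continuous_on {-1<..<1} D" "\<And>x. x \<in> {-1<..<1} \<Longrightarrow> (v has_real_derivative D x) (at x)"
proof -
  define \<Psi> :: "real^2 \<Rightarrow> real" where "\<Psi> = (\<lambda>y. v (inv_stereo 1 y $ 1))"
  have Ck: "Ck_on (Suc (Suc 0)) \<Psi> UNIV"
    using assms by (simp add: C2_axs_def C2_sphere_def \<Psi>_def numeral_2_eq_2 del: Ck_on.simps)
  have \<Psi>: "\<Psi> y = v (((norm y)\<^sup>2 - 1) / ((norm y)\<^sup>2 + 1))" for y
    by (simp add: \<Psi>_def inv_stereo_def)
  define e :: "real^2" where "e = axis 1 1"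
  have e: "e \<in> Basis" "norm e = 1" by (auto simp: e_def axis_in_Basis_iff)
  \<comment> \<open>The inverse of r -> (r^2 - 1) / (r^2 + 1) on positive r.\<close>
  define \<rho> :: "real \<Rightarrow> real" where "\<rho> = (\<lambda>x. sqrt ((1 + x) / (1 - x)))"
  define \<rho>' :: "real \<Rightarrow> real" where "\<rho>' = (\<lambda>x. inverse (sqrt ((1 + x) / (1 - x))) / 2 * (2 / (1 - x)\<^sup>2))"
  define D where "D = (\<lambda>x. frechet_derivative \<Psi> (at (\<rho> x *\<^sub>R e)) e * \<rho>' x)"
  have pos: "(1 + x) / (1 - x) > 0" if "x \<in> {-1<..<1}" for x :: real
    using that by auto
  have \<rho>: "(\<rho> has_real_derivative \<rho>' x) (at x)" if x: "x \<in> {-1<..<1}" for x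
  proof -
    have "((\<lambda>x. (1 + x) / (1 - x)) has_real_derivative 2 / (1 - x)\<^sup>2) (at x)"
      using x by (auto intro!: derivative_eq_intros simp: power2_eq_square)
    then show ?thesis
      unfolding \<rho>_def \<rho>'_def 
      by (rule DERIV_chain2[where f = sqrt and g = "\<lambda>x. (1 + x) / (1 - x)", OF DERIV_real_sqrt[OF pos[OF x]]])
  qed
  have v: "v x = \<Psi> (\<rho> x *\<^sub>R e)" if x: "x \<in> {-1<..<1}" for x
  proof -
    have "(norm (\<rho> x *\<^sub>R e))\<^sup>2 = (1 + x) / (1 - x)"
      using pos[OF x] e by (simp add: \<rho>_def)
    moreover have "((1 + x) / (1 - x) - 1) / ((1 + x) / (1 - x) + 1) = x"
      using x by (simp add: field_simps)
    ultimately show ?thesis by (simp add: \<Psi>)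
  qed
  have der: "(v has_real_derivative D x) (at x)" if x: "x \<in> {-1<..<1}" for x
  proof -
    let ?L = "frechet_derivative \<Psi> (at (\<rho> x *\<^sub>R e))"
    have L: "(\<Psi> has_derivative ?L) (at (\<rho> x *\<^sub>R e))"
      by (rule Ck_on_has_derivative[OF Ck]) simp
    have "((\<lambda>x. \<rho> x *\<^sub>R e) has_derivative (\<lambda>h. (\<rho>' x * h) *\<^sub>R e)) (at x)"
      using \<rho>[OF x] unfolding has_field_derivative_def by (intro has_derivative_scaleR_left)
    then have "((\<lambda>x. \<Psi> (\<rho> x *\<^sub>R e)) has_derivative (\<lambda>h. ?L ((\<rho>' x * h) *\<^sub>R e))) (at x)"
      by (rule has_derivative_compose[where f = "\<lambda>x. \<rho> x *\<^sub>R e" and g = \<Psi>, OF _ L])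
    moreover have "?L ((\<rho>' x * h) *\<^sub>R e) = D x * h" for h
      using linear_scale[OF has_derivative_linear[OF L], of "\<rho>' x * h" e] by (simp add: D_def)
    ultimately have "((\<lambda>x. \<Psi> (\<rho> x *\<^sub>R e)) has_real_derivative D x) (at x)"
      by (simp add: has_field_derivative_def)
    then show ?thesis
      by (rule has_field_derivative_transform_within_open[where S = "{-1<..<1}"]) (use x v in auto)
  qed
  have c\<Psi>: "continuous_on UNIV (\<lambda>y. frechet_derivative \<Psi> (at y) e)"
  proof -
    have "Ck_on (Suc 0) (\<lambda>y. frechet_derivative \<Psi> (at y) e) UNIV"
      using Ck e by simp
    then show ?thesis using Ck_on_SucD Ck_on.simps(1) by blast
  qed
  have c\<rho>: "continuous_on {-1<..<1} \<rho>"
    using DERIV_isCont[OF \<rho>] by (intro continuous_at_imp_continuous_on) auto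
  have "continuous_on {-1<..<1} (\<lambda>x. \<rho> x *\<^sub>R e)"
    by (intro continuous_intros c\<rho>)
  from continuous_on_compose2[OF c\<Psi> this subset_UNIV]
  have "continuous_on {-1<..<1} (\<lambda>x. frechet_derivative \<Psi> (at (\<rho> x *\<^sub>R e)) e)" .
  moreover have "continuous_on {-1<..<1} \<rho>'"
    unfolding \<rho>'_def by (intro continuous_intros) auto
  ultimately have "continuous_on {-1<..<1} D"
    unfolding D_def by (intro continuous_intros)
  with der show ?thesis using that by blast
qed

text \<open>The derivative is positive only almost everywhere, but it is continuous, so it is
  nonnegative everywhere to the right of \<gamma>; up to \<gamma> the function vanishes.\<close>

lemma initial_mono:
  assumes C2: "C2_axs v" and nn: "\<And>x. x \<in> {-1..1} \<Longrightarrow> v x \<ge> 0"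
    and pos: "{x\<in>{-1..1}. v x > 0} = {\<gamma><..1}"
    and deriv: "AE x in lebesgue_on {\<gamma><..<1}. deriv v x > 0"
    and xy: "-1 < y" "y \<le> x" "x < 1"
  shows "v y \<le> v x"
proof (cases "\<gamma> < y")
  case False
  then have "y \<notin> {x\<in>{-1..1}. v x > 0}" using pos by auto
  then have "v y = 0" using nn[of y] xy by force
  then show ?thesis using nn[of x] xy by auto
next
  case True
  obtain D where D: "continuous_on {-1<..<1} D" "\<And>x. x \<in> {-1<..<1} \<Longrightarrow> (v has_real_derivative D x) (at x)"
    using C2_axs_has_derivative[OF C2] by blast
  have nonneg: "0 \<le> D z" if z: "\<gamma> < z" "-1 < z" "z < 1" for z
  proof (rule ccontr)
    assume "\<not> 0 \<le> D z"
    then have Dz: "D z < 0" by simp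
    have "isCont D z" using D(1) z continuous_on_eq_continuous_at[of "{-1<..<1::real}" D] by auto
    then obtain d where d: "d > 0" "\<And>w. dist w z < d \<Longrightarrow> dist (D w) (D z) < - D z"
      using Dz unfolding continuous_at_eps_delta dist_real_def by (metis neg_0_less_iff_less)
    define S where "S = {max (max \<gamma> (-1)) (z - d) <..< min 1 (z + d)}"
    \<comment> \<open>S is a nonempty open interval on which the derivative is negative; an almost
      everywhere contradiction on it is made pointwise with the empty set as the closed set.\<close>
    have "AE w\<in>S in lebesgue. w \<in> {}"
    proof -
      have "AE w in lborel. w \<in> {\<gamma><..<1} \<longrightarrow> deriv v w > 0"
        using deriv by (subst (asm) AE_lebesgue_on_iff) auto
      then have "AE w in lborel. w \<in> S \<longrightarrow> w \<in> {}"
      proof eventually_elim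
        case (elim w)
        show ?case
        proof
          assume w: "w \<in> S"
          then have "dist (D w) (D z) < - D z" by (intro d) (auto simp: S_def dist_real_def abs_less_iff)
          then have "D w < 0" by (simp add: dist_real_def abs_less_iff)
          moreover have "deriv v w = D w" using w by (intro DERIV_imp_deriv D) (auto simp: S_def)
          ultimately show "w \<in> {}" using elim w by (auto simp: S_def)
        qed
      qed
      then show ?thesis by (simp add: AE_completion_iff)
    qed
    then have "z \<in> {}"
      by (rule mem_closed_if_AE_lebesgue_open[rotated 2]) (use z d in \<open>auto simp: S_def\<close>)
    then show False by simp
  qed
  show ?thesis
  proof (rule DERIV_nonneg_imp_nondecreasing[OF xy(2)])
    fix z assume "y \<le> z" "z \<le> x"
    then show "\<exists>d. (v has_real_derivative d) (at z) \<and> 0 \<le> d"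
      using D(2)[of z] nonneg[of z] True xy by auto
  qed
qed

text \<open>Extending \<open>u\<close> and \<open>g\<close> by their boundary values makes continuity and boundedness global;
  clamping \<open>1 / \<lambda>\<close> to its a.e. range \<open>[1/g1, 1/g0]\<close> makes \<open>Q\<close> bounded for every \<open>t\<close>.\<close>

lemma obstacle_of_solution:
  fixes g g' u0 :: "real \<Rightarrow> real" and u :: "real \<Rightarrow> real \<Rightarrow> real" and g0 g1 \<kappa> \<gamma> T :: real
  defines "U \<equiv> \<lambda>x t. u (max (-1) (min 1 x)) (max 0 (min T t))"
  assumes T: "T > 0"
    and g_bounds: "0 < g0" "\<And>x. x \<in> {-1..1} \<Longrightarrow> g0 \<le> g x \<and> g x \<le> g1"
    and g_deriv: "\<And>x. x \<in> {-1..1} \<Longrightarrow> (g has_real_derivative g' x) (at x within {-1..1})"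
    and \<kappa>: "\<kappa> > 0" "\<And>x. x \<in> {-1..1} \<Longrightarrow> g' x \<ge> \<kappa>"
    and u0_mono: "\<And>x y. -1 < y \<Longrightarrow> y \<le> x \<Longrightarrow> x < 1 \<Longrightarrow> u0 y \<le> u0 x"
    and u0_pos: "\<exists>x\<in>{-1<..<1}. 0 < u0 x"
    and u_sol: "axs_obstacle_solution u0 g u"
    and u_cont: "continuous_on ({-1..1} \<times> {0..}) (\<lambda>(x, t). u x t)"
  shows "\<exists>F M gb Q. obstacle U F T M gb Q g0 g1 \<kappa>"
proof -
  have U_eq: "U x t = u x t" if "x \<in> {-1..1}" "t \<in> {0..T}" for x t
    using that by (simp add: U_def)
  obtain lam where lam: "\<forall>T>0.
        (\<exists>ut ux w.
           has_weak_derivative_on (\<lambda>(x, t). u x t) (0, 1) ut ({-1<..<1} \<times> {0<..<T}) \<and>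
           has_weak_derivative_on (\<lambda>(x, t). u x t) (1, 0) ux ({-1<..<1} \<times> {0<..<T}) \<and>
           has_weak_derivative_on (\<lambda>(x, t). (1 - x\<^sup>2) * ux (x, t)) (1, 0) w
             ({-1<..<1} \<times> {0<..<T}) \<and>
           (AE (x, t) in lebesgue_on ({-1<..<1} \<times> {0<..<T}).
              ut (x, t) - w (x, t) = - (1 - g x / lam t) * heaviside (u x t))) \<and>
        (AE t in lebesgue_on {0<..<T}. lam t = average {x\<in>{-1<..<1}. u x t > 0} g) \<and>
        (AE t in lebesgue_on {0<..<T}. AE x in lebesgue_on {-1<..<1}.
           u x t = 0 \<longrightarrow> g x \<le> lam t) \<and>
        (\<forall>x\<in>{-1<..<1}. \<forall>t\<in>{0<..<T}. u x t \<ge> 0) \<and>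
        (\<forall>x\<in>{-1<..<1}. u x 0 = u0 x)"
    using u_sol unfolding axs_obstacle_solution_def by blast
  have lam_avg: "AE t in lebesgue_on {0<..<T}. lam t = average {x\<in>{-1<..<1}. u x t > 0} g"
    and lam_ge: "AE t in lebesgue_on {0<..<T}. AE x in lebesgue_on {-1<..<1}. u x t = 0 \<longrightarrow> g x \<le> lam t"
    and nn: "\<And>x t. x \<in> {-1<..<1} \<Longrightarrow> t \<in> {0<..<T} \<Longrightarrow> u x t \<ge> 0"
    and init: "\<And>x. x \<in> {-1<..<1} \<Longrightarrow> u x 0 = u0 x"
    using lam T by blast+
  define \<Omega> where "\<Omega> = {-1<..<1::real} \<times> {0<..<T}"
  obtain ut ux w where w:
    "has_weak_derivative_on (\<lambda>(x, t). u x t) (0, 1) ut \<Omega>"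
    "has_weak_derivative_on (\<lambda>(x, t). u x t) (1, 0) ux \<Omega>"
    "has_weak_derivative_on (\<lambda>(x, t). (1 - x\<^sup>2) * ux (x, t)) (1, 0) w \<Omega>"
    "AE (x, t) in lebesgue_on \<Omega>. ut (x, t) - w (x, t) = - (1 - g x / lam t) * heaviside (u x t)"
    using lam T unfolding \<Omega>_def by blast
  have u_nn: "u x t \<ge> 0" if "x \<in> {-1..1}" "t \<in> {0..T}" for x t
  proof -
    have cl: "closure \<Omega> = {-1..1} \<times> {0..T}"
      using T by (simp add: \<Omega>_def closure_Times)
    have "0 \<le> (case (x, t) of (x, t) \<Rightarrow> u x t)"
    proof (rule continuous_ge_on_closure[of \<Omega>])
      show "continuous_on (closure \<Omega>) (\<lambda>(x, t). u x t)"
        unfolding cl by (rule continuous_on_subset[OF u_cont]) auto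
      show "0 \<le> (case p of (x, t) \<Rightarrow> u x t)" if "p \<in> \<Omega>" for p
        using that nn by (auto simp: \<Omega>_def)
    qed (use that in \<open>simp add: cl\<close>)
    then show ?thesis by simp
  qed
  have U_nn: "0 \<le> U x t" for x t
    unfolding U_def using T by (intro u_nn) auto
  have U_cont: "continuous_on UNIV (\<lambda>p. U (fst p) (snd p))"
    unfolding U_def
  proof -
    have c: "continuous_on UNIV (\<lambda>p. (max (-1) (min 1 (fst p)), max 0 (min T (snd p))) :: real \<times> real)"
      by (intro continuous_intros)
    have "range (\<lambda>p. (max (-1) (min 1 (fst p)), max 0 (min T (snd p))) :: real \<times> real) \<subseteq> {-1..1} \<times> {0..}"
      by auto
    from continuous_on_compose2[OF u_cont c this]
    show "continuous_on UNIV (\<lambda>p. u (max (-1) (min 1 (fst p))) (max 0 (min T (snd p))))"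
      by simp
  qed
  define gb where "gb = (\<lambda>x. g (max (-1) (min 1 x)))"
  have gb_eq: "gb x = g x" if "x \<in> {-1..1}" for x using that by (simp add: gb_def)
  have g_cont: "continuous_on {-1..1} g"
    by (rule DERIV_continuous_on[OF g_deriv])
  have gb_cont: "continuous_on UNIV gb"
    unfolding gb_def by (intro continuous_on_compose2[OF g_cont] continuous_intros) auto
  have gb_bds: "g0 \<le> gb x" "gb x \<le> g1" for x
    using g_bounds(2)[of "max (-1) (min 1 x)"] by (auto simp: gb_def)
  have g1: "0 < g1" using gb_bds[of 0] g_bounds(1) by linarith
  have [measurable]: "gb \<in> borel_measurable borel" by (rule borel_measurable_continuous_onI[OF gb_cont])
  have gb_slope: "\<kappa> * (x - y) \<le> gb x - gb y" if "-1 \<le> y" "y \<le> x" "x \<le> 1" for x y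
  proof -
    have "g y - \<kappa> * y \<le> g x - \<kappa> * x"
    proof (rule DERIV_nonneg_imp_increasing_open[where f = "\<lambda>x. g x - \<kappa> * x", OF that(2)])
      fix z assume z: "y < z" "z < x"
      then have "(g has_real_derivative g' z) (at z)"
        using g_deriv[of z] that at_within_interior[of z "{-1..1}"] by auto
      then have "((\<lambda>x. g x - \<kappa> * x) has_real_derivative g' z - \<kappa>) (at z)"
        by (auto intro!: derivative_eq_intros)
      then show "\<exists>d. ((\<lambda>x. g x - \<kappa> * x) has_real_derivative d) (at z) \<and> 0 \<le> d"
        using \<kappa>(2)[of z] z that by (intro exI[of _ "g' z - \<kappa>"]) auto
    qed (use that in \<open>auto intro!: continuous_intros continuous_on_subset[OF g_cont]\<close>)
    then show ?thesis using gb_eq[of x] gb_eq[of y] that by (simp add: algebra_simps)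
  qed
  have [measurable]: "heaviside \<in> borel_measurable borel"
    unfolding heaviside_def[abs_def] by measurable
  have UM [measurable]: "(\<lambda>p. U (fst p) (snd p)) \<in> borel_measurable (borel \<Otimes>\<^sub>M borel)"
    using borel_measurable_continuous_onI[OF U_cont] by (simp add: borel_prod)
  have UM' [measurable]: "(\<lambda>p. U (snd p) (fst p)) \<in> borel_measurable (borel \<Otimes>\<^sub>M borel)"
    using measurable_compose[OF measurable_pair_swap' UM] by (simp add: case_prod_beta')
  have UM1 [measurable]: "(\<lambda>x. U x t) \<in> borel_measurable borel" for t
    using measurable_compose[OF _ UM, of "\<lambda>x. (x, t)" borel] by simp
  define h where "h = (\<lambda>x t. heaviside (U x t) * indicator {-1<..<1} x)"
  have h_le: "0 \<le> h x t" "h x t \<le> indicator {-1<..<1} x" for x t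
    by (auto simp: h_def heaviside_def indicator_def)
  have hM [measurable]: "(\<lambda>p. h (snd p) (fst p)) \<in> borel_measurable (borel \<Otimes>\<^sub>M borel)"
    unfolding h_def by measurable
  have [measurable]: "(\<lambda>x. h x t) \<in> borel_measurable borel" for t
    unfolding h_def by measurable
  \<comment> \<open>The measure of the positivity set, with \<open>I\<close> the integral of g over
    it; 1/\<lambda> is therefore m / I for almost every time.\<close>
  define m where "m = (\<lambda>t. LBINT x. h x t)"
  define I where "I = (\<lambda>t. LBINT x. gb x * h x t)"
  have [measurable]: "m \<in> borel_measurable borel" "I \<in> borel_measurable borel"
    unfolding m_def I_def
    by (intro sigma_finite_measure.borel_measurable_lebesgue_integral; simp add: sigma_finite_lborel case_prod_beta')+
  define Q where "Q = (\<lambda>t. max (1 / g1) (min (1 / g0) (m t / I t)))"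
  have Q_meas [measurable]: "Q \<in> borel_measurable borel" unfolding Q_def by measurable
  have "g0 \<le> g1" using gb_bds[of 0] by linarith
  then have Q_bds: "1 / g1 \<le> Q t" "Q t \<le> 1 / g0" for t
    using g_bounds(1) g1 by (auto simp: Q_def intro!: divide_left_mono)
  have ind_int: "integrable lborel (indicator {-1<..<1} :: real \<Rightarrow> real)"
    by (rule integrable_indicator_real) auto
  have h_int: "integrable lborel (\<lambda>x. h x t)" for t
    unfolding h_def by (rule integrable_bounded_mult[OF ind_int, where K = 1]) (auto simp: heaviside_def)
  have gb_abs: "\<bar>gb x\<bar> \<le> g1" for x using gb_bds[of x] g_bounds(1) by auto
  have gh_int: "integrable lborel (\<lambda>x. gb x * h x t)" for t
    by (rule integrable_bounded_mult[OF h_int _ gb_abs]) simp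
  have I_bds: "g0 * m t \<le> I t" "I t \<le> g1 * m t" for t
  proof -
    have "(LBINT x. g0 * h x t) \<le> (LBINT x. gb x * h x t)"
      by (rule integral_mono) (use h_int gh_int gb_bds h_le in \<open>auto intro!: mult_right_mono\<close>)
    then show "g0 * m t \<le> I t" by (simp add: m_def I_def)
    have "(LBINT x. gb x * h x t) \<le> (LBINT x. g1 * h x t)"
      by (rule integral_mono) (use h_int gh_int gb_bds h_le in \<open>auto intro!: mult_right_mono\<close>)
    then show "I t \<le> g1 * m t" by (simp add: m_def I_def)
  qed
  have avg: "average {x\<in>{-1<..<1}. u x t > 0} g = I t / m t" if t: "t \<in> {0<..<T}" for t
  proof -
    define P where "P = {x\<in>{-1<..<1}. u x t > 0}"
    have P_eq: "P = {-1<..<1} \<inter> {x. U x t > 0}" using t by (auto simp: P_def U_eq)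
    have "open {x. U x t > 0}"
      using continuous_on_compose2[OF U_cont continuous_on_Pair[OF continuous_on_id continuous_on_const] subset_UNIV]
      by (intro open_Collect_less) auto
    then have "open P" unfolding P_eq by auto
    have hP: "h x t = indicator P x" for x
      by (auto simp: h_def P_eq heaviside_def indicator_def)
    have "(LINT x|lebesgue_on P. g x) = (LINT x|lebesgue_on P. gb x * h x t)"
      by (rule Bochner_Integration.integral_cong[OF refl]) (auto simp: hP gb_eq P_def)
    also have "\<dots> = I t"
      unfolding I_def
    proof (rule LINT_lebesgue_on_eq_lborel[OF \<open>open P\<close>])
      show "(\<lambda>x. gb x * h x t) \<in> borel_measurable borel" by measurable
    qed (simp add: hP)
    finally have 1: "(LINT x|lebesgue_on P. g x) = I t" .
    have 2: "measure lebesgue P = m t"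
      using \<open>open P\<close> by (simp add: m_def hP measure_completion)
    show ?thesis unfolding average_def P_def[symmetric] 1 2 ..
  qed
  have "AE t in lborel. t \<in> {0<..<T} \<longrightarrow> lam t = average {x\<in>{-1<..<1}. u x t > 0} g"
    using lam_avg by (simp only: AE_lebesgue_on_iff[OF open_greaterThanLessThan])
  moreover have "AE t in lborel. t \<in> {0<..<T} \<longrightarrow> (AE x in lborel. x \<in> {-1<..<1} \<longrightarrow> u x t = 0 \<longrightarrow> g x \<le> lam t)"
    using lam_ge by (simp only: AE_lebesgue_on_iff[OF open_greaterThanLessThan])
  ultimately have good: "AE t in lborel. t \<in> {0<..<T} \<longrightarrow> 1 / lam t = Q t \<and> I t * Q t = m t \<and>
      (AE x in lborel. x \<in> {-1<..<1} \<longrightarrow> U x t = 0 \<longrightarrow> gb x * Q t \<le> 1)"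
  proof eventually_elim
    case (elim t)
    show ?case
    proof
      assume t: "t \<in> {0<..<T}"
      then have l: "lam t = I t / m t" and le: "AE x in lborel. x \<in> {-1<..<1} \<longrightarrow> u x t = 0 \<longrightarrow> g x \<le> lam t"
        using elim avg by auto
      have "0 \<le> m t" unfolding m_def by (rule Bochner_Integration.integral_nonneg) (use h_le in auto)
      \<comment> \<open>If the positivity set were null, division by zero would give \<lambda> = 0
        while u = 0 almost everywhere, and the obstacle condition would force g <= 0.\<close>
      have "m t \<noteq> 0"
      proof
        assume m0: "m t = 0"
        then have "AE x in lborel. h x t = 0"
          using integral_nonneg_eq_0_iff_AE[OF h_int] h_le by (simp add: m_def)
        then have "AE x in lborel. x \<notin> {-1<..<1::real}"
          using le
        proof eventually_elim
          case (elim x)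
          show ?case
          proof
            assume x: "x \<in> {-1<..<1}"
            then have "u x t = 0"
              using elim(1) t U_eq[of x t] U_nn[of x t] by (auto simp: h_def heaviside_def split: if_splits)
            then have "g x \<le> 0" using elim(2) x l m0 by simp
            then show False using g_bounds(1) g_bounds(2)[of x] x by auto
          qed
        qed
        then have "{-1<..<1::real} \<in> null_sets lborel"
          by (subst AE_iff_null_sets) auto
        then show False by (simp add: null_sets_def)
      qed
      then have m: "0 < m t" using \<open>0 \<le> m t\<close> by simp
      have I: "0 < I t" using I_bds(1)[of t] mult_pos_pos[OF g_bounds(1) m] by linarith
      have "1 / g1 \<le> m t / I t" "m t / I t \<le> 1 / g0"
        using I_bds[of t] I g1 g_bounds(1) by (simp_all add: field_simps)
      then have Q: "Q t = m t / I t" by (simp add: Q_def)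
      have lt: "1 / lam t = Q t" "0 < lam t" using m I by (simp_all add: l Q)
      have "AE x in lborel. x \<in> {-1<..<1} \<longrightarrow> U x t = 0 \<longrightarrow> gb x * Q t \<le> 1"
        using le
      proof eventually_elim
        case (elim x)
        show ?case
        proof (intro impI)
          assume "x \<in> {-1<..<1}" "U x t = 0"
          then have "gb x \<le> lam t" using elim t U_eq[of x t] gb_eq[of x] by auto
          then have "gb x / lam t \<le> 1" using lt by simp
          then show "gb x * Q t \<le> 1" using lt(1)[symmetric] by simp
        qed
      qed
      then show "1 / lam t = Q t \<and> I t * Q t = m t \<and> (AE x in lborel. x \<in> {-1<..<1} \<longrightarrow> U x t = 0 \<longrightarrow> gb x * Q t \<le> 1)"
        using lt I by (simp add: Q)
    qed
  qed
  define F where "F = (\<lambda>x t. (1 - gb x * Q t) * heaviside (U x t))"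
  have FM [measurable]: "(\<lambda>p. F (fst p) (snd p)) \<in> borel_measurable (borel \<Otimes>\<^sub>M borel)"
    unfolding F_def by measurable
  have "bounded ((\<lambda>(x, t). u x t) ` ({-1..1} \<times> {0..T}))"
    by (intro compact_imp_bounded compact_continuous_image continuous_on_subset[OF u_cont] compact_Times) auto
  then obtain M0 where M0: "\<And>x t. x \<in> {-1..1} \<Longrightarrow> t \<in> {0..T} \<Longrightarrow> \<bar>u x t\<bar> \<le> M0"
    unfolding bounded_iff by force
  define M where "M = max M0 (1 + g1 / g0)"
  have U_bdd: "\<bar>U x t\<bar> \<le> M" for x t
  proof -
    have "\<bar>U x t\<bar> \<le> M0" unfolding U_def using T by (intro M0) auto
    then show ?thesis by (simp add: M_def)
  qed
  have F_bdd: "\<bar>F x t\<bar> \<le> M" for x t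
  proof -
    have Q0: "0 < Q t" using Q_bds(1)[of t] g1 by (meson divide_pos_pos less_le_trans zero_less_one)
    have "gb x * Q t \<le> g1 * (1 / g0)"
      using gb_bds Q_bds Q0 g1 by (intro mult_mono) auto
    moreover have "0 \<le> gb x * Q t" using gb_bds(1)[of x] g_bounds(1) Q0 by auto
    ultimately have "\<bar>1 - gb x * Q t\<bar> \<le> 1 + g1 / g0" by auto
    then have "\<bar>F x t\<bar> \<le> 1 + g1 / g0"
      using g1 g_bounds(1) by (auto simp: F_def heaviside_def)
    then show ?thesis by (simp add: M_def)
  qed
  have pde: "AE p in lebesgue_on \<Omega>. ut p - w p = - F (fst p) (snd p)"
  proof -
    have op: "open \<Omega>" unfolding \<Omega>_def by (intro open_Times) auto
    have "AE t in lborel. t \<in> {0<..<T} \<longrightarrow> 1 / lam t = Q t"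
      using good by eventually_elim simp
    then have "AE p in (lborel :: (real \<times> real) measure). snd p \<in> {0<..<T} \<longrightarrow> 1 / lam (snd p) = Q (snd p)"
      by (rule AE_lborel_snd)
    moreover have "AE p in lborel. p \<in> \<Omega> \<longrightarrow> ut p - w p = - (1 - g (fst p) / lam (snd p)) * heaviside (u (fst p) (snd p))"
      using w(4) unfolding AE_lebesgue_on_iff[OF op] case_prod_beta' prod.collapse .
    ultimately have "AE p in lborel. p \<in> \<Omega> \<longrightarrow> ut p - w p = - F (fst p) (snd p)"
    proof eventually_elim
      case (elim p)
      show ?case
      proof
        assume p: "p \<in> \<Omega>"
        then have *: "fst p \<in> {-1..1}" "snd p \<in> {0..T}" "snd p \<in> {0<..<T}" by (auto simp: \<Omega>_def)
        then have "g (fst p) / lam (snd p) = gb (fst p) * Q (snd p)"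
          using elim(1) gb_eq[of "fst p"] by (metis mult.right_neutral times_divide_eq_right)
        then show "ut p - w p = - F (fst p) (snd p)"
          using elim(2) p U_eq[OF *(1,2)] by (simp add: F_def minus_mult_left del: mult_minus_left)
      qed
    qed
    then show ?thesis by (simp add: AE_lebesgue_on_iff[OF op])
  qed
  have "obstacle U F T M gb Q g0 g1 \<kappa>"
  proof (unfold_locales)
    show "(\<lambda>p. F (fst p) (snd p)) \<in> borel_measurable borel"
      using FM by (simp add: borel_prod)
    fix a a' m m' b b' :: "real \<Rightarrow> real"
    assume a: "a \<in> test_functions {-1<..<1}" "\<And>x. (a has_real_derivative a' x) (at x)"
      and m: "m \<in> test_functions {-1<..<1}" "\<And>x. (m has_real_derivative m' x) (at x)"
      and ma: "\<And>x. m x = (1 - x\<^sup>2) * a' x"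
      and b: "b \<in> test_functions {0<..<T}" "\<And>x. (b has_real_derivative b' x) (at x)"
    show "(LBINT p. U (fst p) (snd p) * (a (fst p) * b' (snd p)))
        + (LBINT p. U (fst p) (snd p) * (m' (fst p) * b (snd p)))
      = (LBINT p. F (fst p) (snd p) * (a (fst p) * b (snd p)))"
    proof (rule weak_equation_product[OF w(1-3)[unfolded \<Omega>_def] pde[unfolded \<Omega>_def] _ _ _ a m ma b])
      show "(\<lambda>p. U (fst p) (snd p)) \<in> borel_measurable borel" "(\<lambda>p. F (fst p) (snd p)) \<in> borel_measurable borel"
        using UM FM by (simp_all add: borel_prod)
    qed (auto simp: U_eq)
  next
    \<comment> \<open>The obstacle condition is known for almost every t and then almost every x.
      Time integration at fixed x needs the opposite order, which measurability of the joint
      predicate permits.\<close>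
    define C where "C = (\<lambda>x t. x \<in> {-1<..<1} \<longrightarrow> t \<in> {0<..<T} \<longrightarrow> U x t = 0 \<longrightarrow> gb x * Q t \<le> 1)"
    have "AE t in lborel. AE x in lborel. C x t"
      using good
    proof eventually_elim
      case (elim t)
      then show ?case by (cases "t \<in> {0<..<T}") (auto simp: C_def)
    qed
    moreover have "Measurable.pred (lborel \<Otimes>\<^sub>M lborel) (\<lambda>p. C (fst p) (snd p))"
      unfolding C_def by measurable
    then have "{p \<in> space (lborel \<Otimes>\<^sub>M lborel). C (fst p) (snd p)} \<in> sets (lborel \<Otimes>\<^sub>M lborel)"
      by (simp only: pred_def)
    from lborel_pair.AE_commute[OF this]
    have "(AE x in lborel. AE t in lborel. C x t) \<longleftrightarrow> (AE t in lborel. AE x in lborel. C x t)" .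
    ultimately have "AE x in lborel. AE t in lborel. C x t" by (simp only:)
    then show "AE x in lborel. AE t in lborel. x \<in> {-1<..<1} \<longrightarrow> t \<in> {0<..<T} \<longrightarrow> U x t = 0 \<longrightarrow> gb x * Q t \<le> 1"
      by (simp only: C_def)
  next
    show "AE t in lborel. t \<in> {0<..<T} \<longrightarrow> (LBINT x. F x t * indicator {-1..1} x) = 0"
      using good
    proof eventually_elim
      case (elim t)
      show ?case
      proof
        assume t: "t \<in> {0<..<T}"
        have [measurable]: "(\<lambda>x. F x t) \<in> borel_measurable borel"
          using measurable_compose[OF _ FM, of "\<lambda>x. (x, t)" borel] by simp
        have "(LBINT x. F x t * indicator {-1..1} x) = (LBINT x. h x t - Q t * (gb x * h x t))"
        proof (rule integral_cong_AE)
          show "AE x in lborel. F x t * indicator {-1..1} x = h x t - Q t * (gb x * h x t)"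
            using AE_lborel_singleton[of "-1::real"] AE_lborel_singleton[of "1::real"]
            by eventually_elim (auto simp: F_def h_def indicator_def algebra_simps)
        qed simp_all
        also have "\<dots> = m t - Q t * I t"
          unfolding m_def I_def using h_int[of t] gh_int[of t]
          by (subst Bochner_Integration.integral_diff) auto
        finally show "(LBINT x. F x t * indicator {-1..1} x) = 0"
          using elim t by (simp add: mult.commute)
      qed
    qed
  next
    fix x y :: real assume xy: "-1 \<le> y" "y \<le> x" "x \<le> 1"
    \<comment> \<open>Initial values are prescribed on the open interval only; the points e n * z
      lie in it and tend to z, and n + 2 keeps e n positive.\<close>
    define e where "e = (\<lambda>n. 1 - 1 / real (n + 2))"
    have e: "0 < e n" "e n < 1" for n by (auto simp: e_def field_simps)
    have "(\<lambda>n. 1 / real (n + 2)) \<longlonglongrightarrow> 0"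
      by (rule LIMSEQ_ignore_initial_segment[OF lim_const_over_n])
    then have elim: "e \<longlonglongrightarrow> 1 - 0" unfolding e_def by (intro tendsto_diff tendsto_const)
    have in_open: "e n * z \<in> {-1<..<1}" if "z \<in> {-1..1}" for z n
    proof -
      have "\<bar>e n * z\<bar> \<le> e n * 1" unfolding abs_mult using e[of n] that by (intro mult_mono) auto
      then show ?thesis using e(2)[of n] by auto
    qed
    have lim: "(\<lambda>n. U (e n * z) 0) \<longlonglongrightarrow> U z 0" for z
    proof -
      have c: "continuous_on UNIV (\<lambda>x. U x 0)"
        using continuous_on_compose2[OF U_cont continuous_on_Pair[OF continuous_on_id continuous_on_const] subset_UNIV]
        by simp
      have "(\<lambda>n. e n * z) \<longlonglongrightarrow> (1 - 0) * z" by (intro tendsto_intros elim)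
      then show ?thesis using continuous_on_tendsto_compose[OF c] by simp
    qed
    show "U y 0 \<le> U x 0"
    proof (rule LIMSEQ_le[OF lim lim])
      have "U (e n * y) 0 \<le> U (e n * x) 0" for n
      proof -
        have "U (e n * z) 0 = u0 (e n * z)" if "z \<in> {-1..1}" for z
          using in_open[OF that, of n] U_eq[of "e n * z" 0] init[of "e n * z"] T by auto
        moreover have "u0 (e n * y) \<le> u0 (e n * x)"
          using in_open[of x n] in_open[of y n] xy e[of n] by (intro u0_mono) auto
        ultimately show ?thesis using xy by simp
      qed
      then show "\<exists>N. \<forall>n\<ge>N. U (e n * y) 0 \<le> U (e n * x) 0" by blast
    qed
  next
    obtain x where x: "x \<in> {-1<..<1}" "0 < u0 x" using u0_pos by blast
    then have "0 < U x 0" using U_eq[of x 0] init[of x] T by auto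
    then show "\<exists>x\<in>{-1..1}. 0 < U x 0" using x by (intro bexI[of _ x]) auto
  qed (fact T U_cont U_bdd F_bdd U_nn gb_cont gb_bds g_bounds(1) \<kappa>(1) gb_slope Q_meas Q_bds | simp add: F_def)+
  then show ?thesis by blast
qed

theorem theorem2p2:
  fixes g g' u0 :: "real \<Rightarrow> real"
    and u :: "real \<Rightarrow> real \<Rightarrow> real"
    and g0 g1 \<kappa> \<gamma> :: real
  assumes g_C2: "C2_axs g"
    and g_bounds: "0 < g0" "g0 < g1" "g1 < 1" "\<And>x. x \<in> {-1..1} \<Longrightarrow> g0 \<le> g x \<and> g x \<le> g1"
    and g_deriv: "\<And>x. x \<in> {-1..1} \<Longrightarrow> (g has_real_derivative g' x) (at x within {-1..1})"
    and \<kappa>: "\<kappa> > 0" "\<And>x. x \<in> {-1..1} \<Longrightarrow> g' x \<ge> \<kappa>"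
    and u0_C2: "C2_axs u0"
    and u0_nonneg: "\<And>x. x \<in> {-1..1} \<Longrightarrow> u0 x \<ge> 0"
    and u0_nontrivial: "measure lebesgue {x\<in>{-1..1}. u0 x > 0} > 0"
    and \<gamma>: "\<gamma> \<in> {-1..<1}"
    and u0_pos: "{x\<in>{-1..1}. u0 x > 0} = {\<gamma><..1}"
    and u0_deriv: "AE x in lebesgue_on {\<gamma><..<1}. deriv u0 x > 0"
    and u_sol: "axs_obstacle_solution u0 g u"
    and u_reg: "\<And>T q. 0 < T \<Longrightarrow> 1 \<le> q \<Longrightarrow> W21q_axs q u T"
    and u_cont: "continuous_on ({-1..1} \<times> {0..}) (\<lambda>(x, t). u x t)"
  shows "(\<forall>t\<ge>0. {x\<in>{-1..1}. u x t > 0} \<noteq> {} \<and> free_boundary u t \<in> {-1..1})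
         \<and> continuous_on {0..} (free_boundary u)"
proof -
  have pos: "\<exists>x\<in>{-1<..<1}. 0 < u0 x"
  proof
    have "(\<gamma> + 1) / 2 \<in> {\<gamma><..1}" using \<gamma> by auto
    then show "0 < u0 ((\<gamma> + 1) / 2)" using u0_pos by blast
  qed (use \<gamma> in auto)
  \<comment> \<open>The truncated U agrees with u before the horizon T, hence has the same free
    boundary there. At time t the horizon t + 1 leaves a full neighbourhood in
    \<open>{0..}\<close>.\<close>
  have local: "(\<forall>t. 0 \<le> t \<longrightarrow> t < T \<longrightarrow> {x\<in>{-1..1}. u x t > 0} \<noteq> {} \<and> free_boundary u t \<in> {-1..1})
      \<and> continuous_on {0..<T} (free_boundary u)" if T: "T > 0" for T
  proof -
    define U where "U = (\<lambda>x t. u (max (-1) (min 1 x)) (max 0 (min T t)))"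
    obtain F M gb Q where O: "obstacle U F T M gb Q g0 g1 \<kappa>"
      using obstacle_of_solution[OF T g_bounds(1,4) g_deriv \<kappa>
          initial_mono[OF u0_C2 u0_nonneg u0_pos u0_deriv] pos u_sol u_cont]
      unfolding U_def by blast
    have supp: "{x\<in>{-1..1}. U x t > 0} = {x\<in>{-1..1}. u x t > 0}" if "0 \<le> t" "t < T" for t
      using that by (auto simp: U_def)
    then have fb: "free_boundary U t = free_boundary u t" if "0 \<le> t" "t < T" for t
      using that by (simp add: free_boundary_def)
    have "{x\<in>{-1..1}. u x t > 0} \<noteq> {} \<and> free_boundary u t \<in> {-1..1}" if "0 \<le> t" "t < T" for t
      using obstacle.support_nonempty[OF O that] obstacle.p_bounds[OF O that] supp[OF that] fb[OF that]
      by auto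
    moreover have "continuous_on {0..<T} (free_boundary u)"
      using obstacle.free_boundary_continuous[OF O] fb by (auto intro: continuous_on_eq)
    ultimately show ?thesis by blast
  qed
  have "continuous_on {0..} (free_boundary u)"
    unfolding continuous_on_iff
  proof (intro ballI allI impI)
    fix t e :: real assume t: "t \<in> {0..}" and e: "0 < e"
    then obtain d where d: "d > 0"
      "\<And>s. s \<in> {0..<t + 1} \<Longrightarrow> dist s t < d \<Longrightarrow> dist (free_boundary u s) (free_boundary u t) < e"
      using local[of "t + 1"] unfolding continuous_on_iff by force
    show "\<exists>d>0. \<forall>s\<in>{0..}. dist s t < d \<longrightarrow> dist (free_boundary u s) (free_boundary u t) < e"
      by (intro exI[of _ "min d 1"] conjI ballI impI d) (use d in \<open>auto simp: dist_real_def\<close>)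
  qed
  moreover have "{x\<in>{-1..1}. u x t > 0} \<noteq> {} \<and> free_boundary u t \<in> {-1..1}" if "0 \<le> t" for t
    using local[of "t + 1"] that by simp
  ultimately show ?thesis by blast
qed

end
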